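(* For every positive integer $d$ and every $\beta\in(0,1/2)$, with probability $1-o_n(1)$ over $H\sim\mathcal{G}_{\mathrm{reg}}(n,d)$, for every subset $S$ of vertices with $|S|=\alpha n$ where $\alpha\in[\beta,1/2]$, \[ \left| \frac{\mathrm{cut}_H(S)}{d\alpha(1-\alpha)n} - 1\right| \le \frac{1}{\sqrt d}\left( 2\sqrt{\frac 2\pi} + o_{n,d}(1)\right), \] where $2\sqrt{2/\pi}=1.595\ldots$.
   Context: $\mathcal{G}_{\mathrm{reg}}(n,d)$ ($n$ even) is the distribution of the $d$-regular multigraph on $[n]$ obtained as the disjoint union of $d$ independent uniformly random perfect matchings. $\mathrm{cut}_H(S)$ is the number of edges (with multiplicity) of $H$ with exactly one endpoint in $S$. The notation $o_{n,d}(1)$ denotes an error term such that after taking $n\to\infty$ one obtains an expression depending only on $d$ which tends to $0$ as $d\to\infty$. *)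

theory Defs
  imports "HOL-Probability.Probability"
begin

definition perfect_matchings :: "nat \<Rightarrow> nat set set set" where
  "perfect_matchings n =
     {M. (\<forall>e\<in>M. e \<subseteq> {1..n} \<and> card e = 2) \<and> (\<forall>v\<in>{1..n}. \<exists>!e. e \<in> M \<and> v \<in> e)}"

text \<open>A multigraph on the vertex set \<open>{1..n}\<close> is the multiset of its edges, an edge being
  the two-element set of its endpoints. The set of perfect matchings is empty for odd \<open>n\<close>, so
  the following distribution is meaningful only for even \<open>n\<close>.\<close>

definition G_reg :: "nat \<Rightarrow> nat \<Rightarrow> nat set multiset pmf" where
  "G_reg n d =
     map_pmf (\<lambda>M. \<Sum>i<d. mset_set (M i))
       (Pi_pmf {..<d} {} (\<lambda>_. pmf_of_set (perfect_matchings n)))"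

definition edge_cut :: "nat set multiset \<Rightarrow> nat set \<Rightarrow> nat" where
  "edge_cut H S = size {#e \<in># H. card (e \<inter> S) = 1#}"

definition evens_at_top :: "nat filter" where
  "evens_at_top = inf at_top (principal {n. even n})"

text \<open>\<open>little_o_nd \<epsilon>\<close> says that \<open>\<epsilon> n d\<close> is an error term of the form \<open>o\<^sub>n\<^sub>,\<^sub>d(1)\<close>:
  first \<open>n\<close> tends to infinity for fixed \<open>d\<close>, then \<open>d\<close> tends to infinity.\<close>

definition little_o_nd :: "(nat \<Rightarrow> nat \<Rightarrow> real) \<Rightarrow> bool" where
  "little_o_nd \<epsilon> \<longleftrightarrow>
     (\<exists>g :: nat \<Rightarrow> real. (\<forall>d\<ge>1. ((\<lambda>n. \<epsilon> n d) \<longlongrightarrow> g d) evens_at_top) \<and> g \<longlonglongrightarrow> 0)"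

end

theory Submission
  imports Defs "HOL-Real_Asymp.Real_Asymp"
begin

text \<open>
  The proof is a first moment computation over \<^emph>\<open>locally optimal\<close> sets. If some set violates the
  bound, take the set \<open>S\<close> of size \<open>\<alpha>n\<close> that maximises (or minimises) the ratio
  \<open>1 + \<delta> = cut(S) / (d \<alpha> (1 - \<alpha>) n)\<close>, and put \<open>w = |\<delta>| \<surd>d \<ge> 2 \<surd>(2/\<pi>)\<close>.
  Given the numbers \<open>c\<^sub>k\<close> of cut edges in the \<open>d\<close> matchings, the endpoints of the cut edges are, up to
  factors polynomial in \<open>n\<close>, independent Bernoulli sets with parameters \<open>c\<^sub>k/|S|\<close> on \<open>S\<close> and
  \<open>c\<^sub>k/(n - |S|)\<close> off \<open>S\<close>; the \<open>c\<^sub>k\<close> themselves cost a factor of about \<open>exp (- n w\<^sup>2/4)\<close>.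
  Since no single vertex can be moved to improve the ratio, the cut degree of every vertex
  is at least its mean minus \<open>w \<surd>d / 2\<close> (with the sign of \<open>\<delta>\<close>), which by the central limit theorem has
  probability about \<open>\<Phi>(w / (2 \<surd>(\<alpha>(1 - \<alpha>))))\<close>. Hence the expected number of such sets is
  exponentially small as soon as \<open>H(\<alpha>) - w\<^sup>2/4 + ln \<Phi>(w / (2 \<surd>(\<alpha>(1 - \<alpha>)))) < 0\<close>, where \<open>H\<close> is the
  binary entropy, and \<open>w = 2 \<surd>(2/\<pi>)\<close> already satisfies this for every \<open>\<alpha>\<close>.
  For \<open>\<alpha> \<le> 3/10\<close> the first two terms suffice; for \<open>\<alpha> < 1/d\<close> the Gaussian rate \<open>w\<^sup>2/4\<close> has to be replaced by
  a Poissonian one. So the error term can be taken to be \<open>0\<close> for all large \<open>d\<close>.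
\<close>

section \<open>Perfect matchings and their cut vertices\<close>

text \<open>A plain union bound over all sets is too weak: at \<alpha> = 1/2 and w = 2 sqrt (2/pi)
  the entropy ln 2 = 0.693... exceeds w^2/4 = 2/pi = 0.636..., and only the constant 2 sqrt (ln 2) =
  1.665... would result. Local optimality supplies the missing factor, about Phi(w) per vertex, but
  with little to spare: ln (2 Phi(w)) falls short of 2/pi by only about 3/10000, which is why the
  numerical bounds are so fine. The obstacle is that the cut degrees of different vertices are
  dependent. For given numbers c_k, however, the number of matchings with a prescribed set of cut
  vertices depends on that set only through c_k, and so does the probability of the set in the
  Bernoulli model. Comparing the two set by set loses polynomial factors only, whatever further
  event is imposed. In the Bernoulli table of vertices against matchings the rows are independent,
  so optimality at all vertices factors.\<close>

definition matchings :: "nat set \<Rightarrow> nat set set set" where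
  "matchings A =
     {M. (\<forall>e\<in>M. e \<subseteq> A \<and> card e = 2) \<and> (\<forall>v\<in>A. \<exists>!e. e \<in> M \<and> v \<in> e)}"

definition partner :: "nat set set \<Rightarrow> nat \<Rightarrow> nat" where
  "partner M v = (THE w. w \<noteq> v \<and> {v, w} \<in> M)"

text \<open>Cut edges are recorded by their endpoints on both sides: the sets
  \<open>cross S (M k)\<close> then form a 0/1 table of vertices against matchings whose row sums
  are the cut degrees.\<close>

definition cross :: "nat set \<Rightarrow> nat set set \<Rightarrow> nat set" where
  "cross S M = {v. \<exists>w. {v, w} \<in> M \<and> (v \<in> S \<longleftrightarrow> w \<notin> S)}"

lemma perfect_matchings_eq: "perfect_matchings n = matchings {1..n}"
  by (simp add: perfect_matchings_def matchings_def)

lemma finite_matchings: "finite A \<Longrightarrow> finite (matchings A)"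
  by (rule finite_subset[of _ "Pow (Pow A)"]) (auto simp: matchings_def)

lemma matchings_finite: "M \<in> matchings A \<Longrightarrow> finite A \<Longrightarrow> finite M"
  by (rule finite_subset[of _ "Pow A"]) (auto simp: matchings_def)

lemma matchings_edge:
  assumes "M \<in> matchings A" "{v, w} \<in> M"
  shows "v \<in> A" "w \<in> A" "v \<noteq> w"
proof -
  have "{v, w} \<subseteq> A" "card {v, w} = 2" using assms by (auto simp: matchings_def)
  thus "v \<in> A" "w \<in> A" "v \<noteq> w" by (auto simp: card_insert_if split: if_splits)
qed

lemma matchings_edge_cases:
  assumes "M \<in> matchings A" "e \<in> M" "v \<in> e"
  obtains w where "e = {v, w}" "w \<noteq> v"
proof -
  have "card e = 2" using assms by (auto simp: matchings_def)
  then obtain x y where "e = {x, y}" "x \<noteq> y" by (auto simp: card_2_iff)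
  thus ?thesis using that[of x] that[of y] assms(3) by (cases "v = x") auto
qed

lemma matchings_unique:
  assumes "M \<in> matchings A" "{v, w} \<in> M" "{v, w'} \<in> M"
  shows "w = w'"
proof -
  have "v \<in> A" using matchings_edge[OF assms(1,2)] by simp
  hence "\<exists>!e. e \<in> M \<and> v \<in> e" using assms(1) by (auto simp: matchings_def)
  hence "{v, w} = {v, w'}" using assms(2,3) by (metis insertI1)
  thus ?thesis by (metis doubleton_eq_iff)
qed

lemma partner_edge:
  assumes "M \<in> matchings A" "v \<in> A"
  shows "{v, partner M v} \<in> M" "partner M v \<noteq> v"
proof -
  obtain e where "e \<in> M" "v \<in> e" using assms by (auto simp: matchings_def)
  then obtain w where w: "w \<noteq> v" "{v, w} \<in> M" using matchings_edge_cases[OF assms(1)] by metis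
  have "\<exists>!w. w \<noteq> v \<and> {v, w} \<in> M" using w matchings_unique[OF assms(1)] by blast
  from theI'[OF this] show "{v, partner M v} \<in> M" "partner M v \<noteq> v" by (auto simp: partner_def)
qed

lemma partner_eqI: "M \<in> matchings A \<Longrightarrow> {v, w} \<in> M \<Longrightarrow> partner M v = w"
  using partner_edge(1) matchings_unique matchings_edge(1) by metis

lemma cross_subset: "M \<in> matchings A \<Longrightarrow> cross S M \<subseteq> A"
  by (auto simp: cross_def dest: matchings_edge)

lemma mem_cross_iff:
  assumes "M \<in> matchings A" "{v, w} \<in> M"
  shows "v \<in> cross S M \<longleftrightarrow> (v \<in> S \<longleftrightarrow> w \<notin> S)"
  using assms matchings_unique[OF assms(1)] by (auto simp: cross_def)

lemma mem_cross_partner: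
  assumes "M \<in> matchings A" "{v, w} \<in> M"
  shows "v \<in> cross S M \<longleftrightarrow> w \<in> cross S M"
  using mem_cross_iff[OF assms] mem_cross_iff[OF assms(1), of w v] assms(2)
  by (auto simp: insert_commute)

lemma cross_Compl: "cross (-S) M = cross S M"
  by (auto simp: cross_def)

lemma card_Int_edge:
  assumes "v \<noteq> w"
  shows "card ({v, w} \<inter> S) = 1 \<longleftrightarrow> (v \<in> S \<longleftrightarrow> w \<notin> S)"
  using assms by (cases "v \<in> S"; cases "w \<in> S") auto

lemma card_cut_edges:
  assumes M: "M \<in> matchings A"
  shows "card {e \<in> M. card (e \<inter> S) = 1} = card (cross S M \<inter> S)"
proof -
  have "bij_betw (\<lambda>v. {v, partner M v}) (cross S M \<inter> S) {e \<in> M. card (e \<inter> S) = 1}"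
    unfolding bij_betw_def
  proof
    have P: "{v, partner M v} \<in> M" "partner M v \<noteq> v" "partner M v \<notin> S"
      if "v \<in> cross S M \<inter> S" for v
    proof -
      have "v \<in> A" using cross_subset[OF M] that by auto
      thus a: "{v, partner M v} \<in> M" "partner M v \<noteq> v" using partner_edge[OF M] by auto
      show "partner M v \<notin> S" using mem_cross_iff[OF M a(1)] that by auto
    qed
    show "inj_on (\<lambda>v. {v, partner M v}) (cross S M \<inter> S)"
    proof (rule inj_onI)
      fix v w assume vw: "v \<in> cross S M \<inter> S" "w \<in> cross S M \<inter> S" "{v, partner M v} = {w, partner M w}"
      have "v \<noteq> partner M w" using P(3)[OF vw(2)] vw(1) by auto
      thus "v = w" using vw(3) by (simp add: doubleton_eq_iff)
    qed
    show "(\<lambda>v. {v, partner M v}) ` (cross S M \<inter> S) = {e \<in> M. card (e \<inter> S) = 1}" (is "?l = ?r")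
    proof
      show "?l \<subseteq> ?r"
      proof
        fix e assume "e \<in> ?l"
        then obtain v where v: "v \<in> cross S M \<inter> S" "e = {v, partner M v}" by auto
        have "card ({v, partner M v} \<inter> S) = 1"
          using P[OF v(1)] v(1) by (subst card_Int_edge) auto
        thus "e \<in> ?r" using P(1)[OF v(1)] v(2) by simp
      qed
      show "?r \<subseteq> ?l"
      proof
        fix e assume e: "e \<in> ?r"
        hence "e \<inter> S \<noteq> {}" by (intro notI) simp
        then obtain v where "v \<in> e" "v \<in> S" by blast
        then obtain w where w: "e = {v, w}" "w \<noteq> v" using matchings_edge_cases[OF M, of e v] e by auto
        have "v \<in> S \<longleftrightarrow> w \<notin> S" using e w card_Int_edge[of v w S] by blast
        hence "v \<in> cross S M" using e w mem_cross_iff[OF M, of v w S] by blast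
        moreover have "partner M v = w" using partner_eqI[OF M, of v w] e w by blast
        ultimately show "e \<in> ?l" using \<open>v \<in> S\<close> w by auto
      qed
    qed
  qed
  from bij_betw_same_card[OF this] show ?thesis by simp
qed

lemma card_cut_edges_Compl:
  assumes M: "M \<in> matchings A"
  shows "{e \<in> M. card (e \<inter> -S) = 1} = {e \<in> M. card (e \<inter> S) = 1}"
proof -
  have "card (e \<inter> -S) = 1 \<longleftrightarrow> card (e \<inter> S) = 1" if "e \<in> M" for e
  proof -
    have "card e = 2" using that M by (auto simp: matchings_def)
    then obtain v w where "e = {v, w}" "v \<noteq> w" by (auto simp: card_2_iff)
    thus ?thesis using card_Int_edge[of v w S] card_Int_edge[of v w "- S"]
      by (metis Compl_iff)
  qed
  thus ?thesis by blast
qed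

lemma card_cross_Diff:
  assumes M: "M \<in> matchings A"
  shows "card (cross S M - S) = card (cross S M \<inter> S)"
  using card_cut_edges[OF M, of S] card_cut_edges[OF M, of "-S"] card_cut_edges_Compl[OF M, of S]
  by (simp add: cross_Compl Diff_eq)

text \<open>The double factorial (m - 1)!! for even \<open>m\<close>, and 0 for odd
  \<open>m\<close>: a fixed vertex has m - 1 possible partners, and the rest is matched
  freely.\<close>

fun nmatch :: "nat \<Rightarrow> nat" where
  "nmatch 0 = 1"
| "nmatch (Suc 0) = 0"
| "nmatch (Suc (Suc m)) = Suc m * nmatch m"

lemma matchings_empty: "matchings {} = {{}}"
  by (auto simp: matchings_def)

lemma insert_matching:
  assumes "finite A" "v \<in> A" "w \<in> A" "v \<noteq> w"
    and M: "M \<in> matchings (A - {v, w})"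
  shows "insert {v, w} M \<in> matchings A"
proof -
  have 1: "\<forall>e\<in>insert {v, w} M. e \<subseteq> A \<and> card e = 2"
    using assms by (auto simp: matchings_def)
  have 2: "\<exists>!e. e \<in> insert {v, w} M \<and> u \<in> e" if "u \<in> A" for u
  proof (cases "u \<in> {v, w}")
    case True
    thus ?thesis using M by (intro ex1I[of _ "{v, w}"]) (auto simp: matchings_def)
  next
    case False
    hence "\<exists>!e. e \<in> M \<and> u \<in> e" using M that by (auto simp: matchings_def)
    thus ?thesis using False by (metis insert_iff)
  qed
  show ?thesis using 1 2 by (auto simp: matchings_def)
qed

lemma remove_matching:
  assumes M: "M \<in> matchings A" and e: "{v, w} \<in> M"
  shows "M - {{v, w}} \<in> matchings (A - {v, w})"
proof -
  have U: "\<exists>!e. e \<in> M \<and> u \<in> e" if "u \<in> A" for u using M that by (auto simp: matchings_def)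
  have D: "e' \<inter> {v, w} = {}" if "e' \<in> M" "e' \<noteq> {v, w}" for e'
    using U[of v] U[of w] matchings_edge[OF M e] that e by auto
  show ?thesis unfolding matchings_def
  proof (intro CollectI conjI ballI)
    fix e' assume "e' \<in> M - {{v, w}}"
    thus "e' \<subseteq> A - {v, w}" "card e' = 2" using D[of e'] M by (auto simp: matchings_def)
  next
    fix u assume u: "u \<in> A - {v, w}"
    hence "\<exists>!e. e \<in> M \<and> u \<in> e" "\<And>e. u \<in> e \<Longrightarrow> e \<noteq> {v, w}" using U[of u] by auto
    thus "\<exists>!e. e \<in> M - {{v, w}} \<and> u \<in> e" by blast
  qed
qed

lemma card_matchings: "finite A \<Longrightarrow> card (matchings A) = nmatch (card A)"
proof (induction "card A" arbitrary: A rule: nmatch.induct)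
  case 1
  thus ?case by (auto simp: matchings_empty)
next
  case 2
  then obtain v where "A = {v}" by (metis One_nat_def card_1_singletonE)
  moreover have "matchings {v} = {}"
  proof -
    have False if "M \<in> matchings {v}" for M
      using partner_edge[OF that, of v] matchings_edge[OF that, of v "partner M v"] by auto
    thus ?thesis by auto
  qed
  ultimately show ?case by simp
next
  case (3 m)
  then obtain v where v: "v \<in> A" by fastforce
  have cA: "card (A - {v, w}) = m" if "w \<in> A - {v}" for w
    using 3 that v by (subst card_Diff_subset) auto
  have "bij_betw (\<lambda>(w, M). insert {v, w} M) (SIGMA w:A - {v}. matchings (A - {v, w})) (matchings A)"
  proof (rule bij_betwI[where g = "\<lambda>M. (partner M v, M - {{v, partner M v}})"])
    show "(\<lambda>(w, M). insert {v, w} M) \<in> (SIGMA w:A - {v}. matchings (A - {v, w})) \<rightarrow> matchings A"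
      using v 3 by (auto intro!: insert_matching)
    show "(\<lambda>M. (partner M v, M - {{v, partner M v}})) \<in> matchings A \<rightarrow> (SIGMA w:A - {v}. matchings (A - {v, w}))"
    proof
      fix M assume M: "M \<in> matchings A"
      show "(partner M v, M - {{v, partner M v}}) \<in> (SIGMA w:A - {v}. matchings (A - {v, w}))"
        using partner_edge[OF M v] matchings_edge(2)[OF M partner_edge(1)[OF M v]]
          remove_matching[OF M partner_edge(1)[OF M v]] by auto
    qed
    fix p assume p: "p \<in> (SIGMA w:A - {v}. matchings (A - {v, w}))"
    obtain w M where [simp]: "p = (w, M)" by force
    have "insert {v, w} M \<in> matchings A" using p v 3 by (auto intro!: insert_matching)
    hence "partner (insert {v, w} M) v = w" by (rule partner_eqI) auto
    moreover have "{v, w} \<notin> M" using p by (auto simp: matchings_def)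
    ultimately show "(\<lambda>M. (partner M v, M - {{v, partner M v}})) ((\<lambda>(w, M). insert {v, w} M) p) = p"
      by auto
  next
    fix M assume "M \<in> matchings A"
    thus "(\<lambda>(w, M). insert {v, w} M) (partner M v, M - {{v, partner M v}}) = M"
      using partner_edge(1)[OF _ v] by auto
  qed
  hence "card (matchings A) = card (SIGMA w:A - {v}. matchings (A - {v, w}))"
    by (metis bij_betw_same_card)
  also have "\<dots> = (\<Sum>w\<in>A - {v}. card (matchings (A - {v, w})))"
    using 3 by (intro card_SigmaI) (auto intro!: finite_matchings)
  also have "\<dots> = (\<Sum>w\<in>A - {v}. nmatch m)"
    using 3 cA by (intro sum.cong refl) (metis finite_Diff)
  also have "\<dots> = nmatch (card A)"
    using 3 v by (simp flip: 3(2))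
  finally show ?case .
qed

text \<open>An edge either stays inside one side, and then avoids \<open>C\<close>, or it is cut,
  and then it is found from its endpoint in \<open>S\<close>. So the three pieces determine the
  matching, which makes the encoding in \<open>card_matchings_cross_le\<close> injective.\<close>

lemma matchings_cross_decomposition:
  fixes S :: "nat set"
  assumes M: "M \<in> matchings A"
  defines "C \<equiv> cross S M"
  shows "M = (M \<inter> Pow (S - C)) \<union> (M \<inter> Pow (A - S - C)) \<union> (\<lambda>v. {v, partner M v}) ` (C \<inter> S)"
    (is "M = ?R")
proof
  show "?R \<subseteq> M" using partner_edge[OF M] cross_subset[OF M] by (auto simp: C_def)
  show "M \<subseteq> ?R"
  proof
    fix e assume e: "e \<in> M"
    hence "card e = 2" "e \<subseteq> A" using M by (auto simp: matchings_def)
    then obtain v w where vw: "e = {v, w}" "v \<noteq> w" by (auto simp: card_2_iff)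
    have 1: "{v, w} \<in> M" "{w, v} \<in> M" using e vw by (auto simp: insert_commute[of w v])
    note 2 = mem_cross_iff[OF M 1(1), of S] mem_cross_iff[OF M 1(2), of S]
      partner_eqI[OF M 1(1)] partner_eqI[OF M 1(2)]
    show "e \<in> ?R"
    proof (cases "v \<in> S \<longleftrightarrow> w \<in> S")
      case True
      hence "v \<notin> C" "w \<notin> C" using 2 by (simp_all add: C_def)
      thus ?thesis using True vw e \<open>e \<subseteq> A\<close> by auto
    next
      case False
      hence 3: "v \<in> C" "w \<in> C" using 2 by (auto simp: C_def)
      have "e = {v, partner M v}" "e = {w, partner M w}" using 2 vw(1) by auto
      thus ?thesis using 3 False by blast
    qed
  qed
qed

lemma matchings_restrict:
  assumes M: "M \<in> matchings A" and B: "B \<subseteq> A"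
    and closed: "\<And>v w. {v, w} \<in> M \<Longrightarrow> v \<in> B \<Longrightarrow> w \<in> B"
  shows "M \<inter> Pow B \<in> matchings B"
proof -
  have "\<exists>!e. e \<in> M \<inter> Pow B \<and> v \<in> e" if v: "v \<in> B" for v
  proof -
    have "v \<in> A" using v B by auto
    hence "\<exists>!e. e \<in> M \<and> v \<in> e" using M by (simp add: matchings_def)
    moreover have "e \<in> Pow B" if e: "e \<in> M" "v \<in> e" for e
    proof -
      obtain w where "e = {v, w}" using matchings_edge_cases[OF M e] by metis
      thus ?thesis using closed[of v w] e v by auto
    qed
    ultimately show ?thesis by blast
  qed
  thus ?thesis using M by (auto simp: matchings_def)
qed

text \<open>The uncut vertices of each side are matched among themselves, and the cut edges form a
  bijection from \<open>C \<inter> S\<close> to \<open>C - S\<close>, which accounts for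
  \<open>fact c\<close>.\<close>

lemma card_matchings_cross_le:
  assumes A: "finite A" "S \<subseteq> A" "C \<subseteq> A" and c: "card (C \<inter> S) = c" "card (C - S) = c"
  shows "card {M \<in> matchings A. cross S M = C}
           \<le> fact c * nmatch (card S - c) * nmatch (card A - card S - c)"
proof -
  \<comment> \<open>A fixed enumeration of \<open>C \<inter> S\<close>, so that the bijection given
    by the cut edges becomes a list of distinct elements of \<open>C - S\<close>.\<close>
  define l where "l = sorted_list_of_set (C \<inter> S)"
  have fin: "finite S" "finite C" using A finite_subset by auto
  have l: "set l = C \<inter> S" "distinct l" "length l = c"
    using fin c by (auto simp: l_def)
  define F where "F M = (M \<inter> Pow (S - C), M \<inter> Pow (A - S - C), map (partner M) l)" for M
  define X where "X = matchings (S - C) \<times> matchings (A - S - C) \<times>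
    {xs. length xs = c \<and> distinct xs \<and> set xs \<subseteq> C - S}"
  have "finite {xs. length xs = c \<and> distinct xs \<and> set xs \<subseteq> C - S}"
    by (rule finite_subset[OF _ finite_lists_length_eq[of "C - S" c]]) (use fin in auto)
  hence finX: "finite X" unfolding X_def
    using fin A by (intro finite_cartesian_product finite_matchings) simp_all
  have inj: "inj_on F {M \<in> matchings A. cross S M = C}"
  proof (rule inj_onI)
    fix M N assume MN: "M \<in> {M \<in> matchings A. cross S M = C}" "N \<in> {M \<in> matchings A. cross S M = C}"
      and eq: "F M = F N"
    have "\<forall>v\<in>C \<inter> S. partner M v = partner N v" using eq l by (auto simp: F_def)
    hence "(\<lambda>v. {v, partner M v}) ` (C \<inter> S) = (\<lambda>v. {v, partner N v}) ` (C \<inter> S)"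
      by (intro image_cong) auto
    moreover have "M \<inter> Pow (S - C) = N \<inter> Pow (S - C)" "M \<inter> Pow (A - S - C) = N \<inter> Pow (A - S - C)"
      using eq by (auto simp: F_def)
    moreover have "M = M \<inter> Pow (S - C) \<union> M \<inter> Pow (A - S - C) \<union> (\<lambda>v. {v, partner M v}) ` (C \<inter> S)"
      using matchings_cross_decomposition[of M A S] MN(1) by blast
    moreover have "N = N \<inter> Pow (S - C) \<union> N \<inter> Pow (A - S - C) \<union> (\<lambda>v. {v, partner N v}) ` (C \<inter> S)"
      using matchings_cross_decomposition[of N A S] MN(2) by blast
    ultimately show "M = N" by argo
  qed
  have img: "F ` {M \<in> matchings A. cross S M = C} \<subseteq> X"
  proof
    fix x assume "x \<in> F ` {M \<in> matchings A. cross S M = C}"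
    then obtain M where M: "M \<in> matchings A" "cross S M = C" "x = F M" by auto
    have closed: "(w \<in> S \<longleftrightarrow> v \<in> S) \<and> w \<notin> C \<and> w \<in> A" if "{v, w} \<in> M" "v \<notin> C" for v w
      using that mem_cross_iff[OF M(1) that(1), of S] mem_cross_partner[OF M(1) that(1), of S]
        matchings_edge[OF M(1) that(1)] M(2) by auto
    have 1: "M \<inter> Pow (S - C) \<in> matchings (S - C)"
      by (rule matchings_restrict[OF M(1)]) (use A closed in auto)
    have 2: "M \<inter> Pow (A - S - C) \<in> matchings (A - S - C)"
      by (rule matchings_restrict[OF M(1)]) (use closed in auto)
    have p: "partner M v \<in> C - S" "{v, partner M v} \<in> M" if "v \<in> C \<inter> S" for v
    proof -
      show e: "{v, partner M v} \<in> M" using partner_edge[OF M(1), of v] that A by auto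
      show "partner M v \<in> C - S"
        using that mem_cross_iff[OF M(1) e, of S] mem_cross_partner[OF M(1) e, of S] M(2) by auto
    qed
    have "inj_on (partner M) (C \<inter> S)"
    proof (rule inj_onI)
      fix v w assume "v \<in> C \<inter> S" "w \<in> C \<inter> S" "partner M v = partner M w"
      thus "v = w" using p(2)[of v] p(2)[of w] matchings_unique[OF M(1), of "partner M v" v w]
        by (metis insert_commute)
    qed
    hence "distinct (map (partner M) l)" using l by (simp add: distinct_map)
    thus "x \<in> X" using 1 2 p l M by (auto simp: F_def X_def)
  qed
  have "card {M \<in> matchings A. cross S M = C} \<le> card X"
    by (rule card_inj_on_le[OF inj img finX])
  also have "\<dots> = nmatch (card (S - C)) * nmatch (card (A - S - C)) * fact c"
    using fin A c by (simp add: X_def card_cartesian_product card_matchings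
        card_lists_distinct_length_eq fact_prod)
  also have "card (S - C) = card S - c" using c fin by (metis card_Diff_subset_Int Int_commute finite_Int)
  also have "card (A - S - C) = card A - card S - c"
  proof -
    have "A - S - C = A - S - (C - S)" by auto
    also have "card \<dots> = card (A - S) - card (C - S)"
      using A fin by (intro card_Diff_subset) auto
    also have "card (A - S) = card A - card S" using A fin by (intro card_Diff_subset) auto
    finally show ?thesis using c by simp
  qed
  finally show ?thesis by (simp add: mult_ac)
qed

section \<open>Stirling estimates and the rate function of one matching\<close>

definition xlnx :: "real \<Rightarrow> real" where
  "xlnx x = x * ln x"

lemma xlnx_0 [simp]: "xlnx 0 = 0"
  by (simp add: xlnx_def)

text \<open>Convexity of x ln x, obtained from ln z \<le> z - 1 at z = y / x. Both the Stirling
  bounds and Jensen's inequality are read off from it.\<close>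

lemma xlnx_tangent:
  assumes "x \<ge> 0" "y > 0"
  shows "xlnx x \<ge> xlnx y + (1 + ln y) * (x - y)"
proof (cases "x = 0")
  case False
  hence x: "x > 0" using assms by simp
  have "ln (y / x) \<le> y / x - 1" using x assms by (intro ln_le_minus_one) auto
  hence "x * ln (y / x) \<le> x * (y / x - 1)" using x by (intro mult_left_mono) auto
  also have "x * (y / x - 1) = y - x" using x by (simp add: field_simps)
  finally show ?thesis using x assms by (simp add: xlnx_def ln_div algebra_simps)
qed (use assms in \<open>simp add: xlnx_def algebra_simps\<close>)

lemma xlnx_jensen:
  fixes x :: "nat \<Rightarrow> real"
  assumes x: "\<And>k. k < d \<Longrightarrow> x k \<ge> 0"
  shows "(\<Sum>k<d. xlnx (x k)) \<ge> real d * xlnx ((\<Sum>k<d. x k) / real d)"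
proof (cases "(\<Sum>k<d. x k) > 0")
  case True
  hence d: "d > 0" by (intro gr0I) auto
  define y where "y = (\<Sum>k<d. x k) / real d"
  have y: "y > 0" "real d * y = (\<Sum>k<d. x k)" using True d by (auto simp: y_def)
  have "(\<Sum>k<d. xlnx (x k)) \<ge> (\<Sum>k<d. xlnx y + (1 + ln y) * (x k - y))"
    using x y by (intro sum_mono xlnx_tangent) auto
  also have "(\<Sum>k<d. xlnx y + (1 + ln y) * (x k - y)) = real d * xlnx y"
    using y(2) by (simp add: sum.distrib sum_subtractf flip: sum_distrib_left)
  finally show ?thesis by (simp add: y_def)
next
  case False
  hence "(\<Sum>k<d. x k) = 0" using sum_nonneg[of "{..<d}" x] x by fastforce
  moreover have "\<forall>k<d. x k = 0"
    using calculation x sum_nonneg_eq_0_iff[of "{..<d}" x] by auto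
  ultimately show ?thesis by simp
qed

text \<open>Stirling's formula up to a factor linear in \<open>k\<close>. Polynomial factors are
  harmless because the final exponents are negative multiples of \<open>n\<close>.\<close>

lemma fact_bounds:
  "exp (xlnx (real k) - real k) \<le> fact k"
  "fact k \<le> 3 * (real k + 1) * exp (xlnx (real k) - real k)"
proof -
  have step: "xlnx (real k) \<ge> xlnx (real k + 1) - (1 + ln (real k + 1))" for k
    using xlnx_tangent[of "real k" "real k + 1"] by simp
  have "xlnx (real k) - real k \<le> ln (fact k)" for k
  proof (induction k)
    case (Suc k)
    have "ln (fact (Suc k)) = ln (real k + 1) + ln (fact k :: real)"
      by (subst fact_Suc, subst of_nat_Suc, subst ln_mult) (auto simp: add_ac)
    thus ?case using Suc step[of k] by (simp add: add_ac)
  qed simp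
  hence "exp (xlnx (real k) - real k) \<le> exp (ln (fact k))" by (subst exp_le_cancel_iff)
  thus "exp (xlnx (real k) - real k) \<le> fact k" by simp
  \<comment> \<open>With the argument shifted by one the induction closes by the tangent inequality;
    shifting back costs the factor e (k + 1).\<close>
  have "ln (fact k) \<le> xlnx (real k + 1) - real k" for k
  proof (induction k)
    case (Suc k)
    have "ln (fact (Suc k)) = ln (real k + 1) + ln (fact k :: real)"
      by (subst fact_Suc, subst of_nat_Suc, subst ln_mult) (auto simp: add_ac)
    moreover have "xlnx (real k + 2) \<ge> xlnx (real k + 1) + (1 + ln (real k + 1))"
      using xlnx_tangent[of "real k + 2" "real k + 1"] by simp
    ultimately show ?case using Suc by (simp add: add_ac)
  qed (simp add: xlnx_def)
  hence "ln (fact k) \<le> 1 + ln (real k + 1) + (xlnx (real k) - real k)" using step[of k] by (smt (verit))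
  hence "exp (ln (fact k)) \<le> exp (1 + ln (real k + 1) + (xlnx (real k) - real k))" by (subst exp_le_cancel_iff)
  also have "\<dots> = exp 1 * (real k + 1) * exp (xlnx (real k) - real k)"
    by (simp add: exp_add)
  also have "\<dots> \<le> 3 * (real k + 1) * exp (xlnx (real k) - real k)"
    using exp_le by (intro mult_right_mono) auto
  finally show "fact k \<le> 3 * (real k + 1) * exp (xlnx (real k) - real k)" by simp
qed

lemma nmatch_odd: "nmatch (Suc (2 * m)) = 0"
  by (induction m) auto

lemma nmatch_even: "nmatch (2 * m) * (2 ^ m * fact m) = fact (2 * m)"
proof (induction m)
  case (Suc m)
  have "nmatch (2 * Suc m) * (2 ^ Suc m * fact (Suc m)) =
      (2 * m + 1) * (2 * m + 2) * (nmatch (2 * m) * (2 ^ m * fact m))"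
    by (simp add: algebra_simps)
  also have "\<dots> = fact (2 * Suc m)" by (subst Suc) (simp add: algebra_simps)
  finally show ?case .
qed simp

lemma xlnx_double: "xlnx (2 * real m) = 2 * real m * ln 2 + 2 * xlnx (real m)"
  by (cases "m = 0") (auto simp: xlnx_def ln_mult algebra_simps)

lemma nmatch_even_bounds:
  "exp (xlnx (2 * real m) / 2 - real m) / (3 * (2 * real m + 1)) \<le> real (nmatch (2 * m))"
  "real (nmatch (2 * m)) \<le> 3 * (2 * real m + 1) * exp (xlnx (2 * real m) / 2 - real m)"
proof -
  define A where "A = real (nmatch (2 * m))"
  define B :: real where "B = 2 ^ m * fact m"
  define x where "x = exp (xlnx (real m) - real m + real m * ln 2)"
  have "real (nmatch (2 * m) * (2 ^ m * fact m)) = real (fact (2 * m))"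
    by (subst nmatch_even) simp
  hence AB: "A * B = fact (2 * m)" by (simp add: A_def B_def)
  have two: "(2::real) ^ m = exp (real m * ln 2)" by (simp add: exp_of_nat_mult)
  have B: "x \<le> B" "B \<le> 3 * (real m + 1) * x"
    using fact_bounds[of m] by (auto simp: B_def x_def two exp_add mult_ac mult_left_mono)
  have x: "x > 0" by (simp add: x_def)
  have Bpos: "B > 0" by (simp add: B_def)
  have E: "exp (xlnx (2 * real m) - 2 * real m) = exp (xlnx (2 * real m) / 2 - real m) * x"
    unfolding x_def exp_add[symmetric] using xlnx_double[of m] by simp
  let ?y = "exp (xlnx (2 * real m) / 2 - real m)"
  have F: "?y * x \<le> A * B" "A * B \<le> 3 * (2 * real m + 1) * (?y * x)"
    using fact_bounds[of "2 * m"] unfolding AB E[symmetric] by simp_all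
  have "A * x \<le> A * B" using B by (intro mult_left_mono) (auto simp: A_def)
  hence "A * x \<le> (3 * (2 * real m + 1) * ?y) * x" using F(2) by (simp add: mult_ac)
  thus "real (nmatch (2 * m)) \<le> 3 * (2 * real m + 1) * ?y" using x by (simp add: A_def)
  have "?y * x \<le> A * (3 * (real m + 1) * x)"
    using F(1) mult_left_mono[OF B(2), of A] by (simp add: A_def)
  hence "?y * x \<le> (A * (3 * (real m + 1))) * x" by (simp add: mult_ac)
  hence "?y \<le> A * (3 * (real m + 1))" using x by simp
  also have "\<dots> \<le> A * (3 * (2 * real m + 1))" by (intro mult_left_mono) (auto simp: A_def)
  finally show "?y / (3 * (2 * real m + 1)) \<le> real (nmatch (2 * m))"
    by (simp add: A_def field_simps)
qed

lemma nmatch_le: "real (nmatch x) \<le> 3 * (real x + 1) * exp (xlnx (real x) / 2 - real x / 2)"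
proof (cases "even x")
  case True
  then obtain m where "x = 2 * m" by (auto elim: evenE)
  thus ?thesis using nmatch_even_bounds(2)[of m] by simp
next
  case False
  then obtain m where "x = Suc (2 * m)" by (auto elim: oddE)
  thus ?thesis using nmatch_odd[of m] by simp
qed

lemma nmatch_ge:
  "even x \<Longrightarrow> exp (xlnx (real x) / 2 - real x / 2) \<le> 3 * (real x + 1) * real (nmatch x)"
  using nmatch_even_bounds(1)[of "x div 2"] by (auto simp: field_simps elim!: evenE)

text \<open>Up to polynomial factors, exp (- \<open>layer_rate n s c\<close>) bounds the probability
  that a random perfect matching of \<open>n\<close> points has \<open>c\<close> edges leaving a
  fixed set of \<open>s\<close> points. The rate vanishes at c = s (n - s) / n.\<close>

definition layer_rate :: "real \<Rightarrow> real \<Rightarrow> real \<Rightarrow> real" where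
  "layer_rate n s c = xlnx c + xlnx (s - c) / 2 + xlnx (n - s - c) / 2 - xlnx s - xlnx (n - s) + xlnx n / 2"

text \<open>In the model of independent cut vertices, with parameter \<open>p\<close> on a side of
  size \<open>s\<close> and \<open>q\<close> on a side of size \<open>r\<close>, this is the
  probability of any one set with \<open>c\<close> elements on each side.\<close>

definition layer_weight :: "real \<Rightarrow> real \<Rightarrow> nat \<Rightarrow> nat \<Rightarrow> nat \<Rightarrow> real" where
  "layer_weight p q c s r = p ^ c * (1 - p) ^ (s - c) * (q ^ c * (1 - q) ^ (r - c))"

lemma powr_xlnx:
  fixes c s :: nat
  assumes "c \<le> s" "s > 0"
  shows "(real c / real s) ^ c * (1 - real c / real s) ^ (s - c)
       = exp (xlnx (real c) + xlnx (real s - real c) - xlnx (real s))"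
proof -
  have 1: "(real a / real s) ^ a = exp (xlnx (real a) - real a * ln (real s))" for a
  proof (cases "a = 0")
    case False
    have "(real a / real s) ^ a = exp (real a * ln (real a / real s))"
      using False assms by (simp add: exp_of_nat_mult)
    thus ?thesis using False assms by (simp add: ln_div xlnx_def algebra_simps)
  qed simp
  have "1 - real c / real s = real (s - c) / real s" using assms by (simp add: field_simps of_nat_diff)
  hence "(real c / real s) ^ c * (1 - real c / real s) ^ (s - c) =
     exp (xlnx (real c) - real c * ln (real s)) * exp (xlnx (real (s - c)) - real (s - c) * ln (real s))"
    using 1[of c] 1[of "s - c"] by simp
  also have "\<dots> = exp (xlnx (real c) + xlnx (real s - real c) - xlnx (real s))"
    using assms by (simp add: of_nat_diff xlnx_def algebra_simps flip: exp_add)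
  finally show ?thesis .
qed

text \<open>Stirling for each factor; the linear terms c + (s - c)/2 + (n - s - c)/2 add up to n/2
  and cancel against that of \<open>nmatch n\<close>. The remaining exponent is divided into the
  Bernoulli probability of one cut pattern and the cost of having \<open>c\<close> cut edges at
  all.\<close>

lemma layer_count_le:
  assumes "even n" "c \<le> s" "s > 0" "c \<le> n - s" "s < n"
  shows "real (fact c * nmatch (s - c) * nmatch (n - s - c)) \<le>
    (3 * (real n + 1)) ^ 4 * real (nmatch n) *
    (exp (- layer_rate (real n) (real s) (real c)) *
     layer_weight (real c / real s) (real c / real (n - s)) c s (n - s))"
proof -
  let ?P = "3 * (real n + 1)"
  define e1 where "e1 = xlnx (real c) - real c"
  define e2 where "e2 = xlnx (real (s - c)) / 2 - real (s - c) / 2"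
  define e3 where "e3 = xlnx (real (n - s - c)) / 2 - real (n - s - c) / 2"
  define e4 where "e4 = xlnx (real n) / 2 - real n / 2"
  have 1: "fact c \<le> ?P * exp e1"
    using fact_bounds(2)[of c] assms by (auto simp: e1_def elim!: order_trans intro!: mult_right_mono)
  have 2: "real (nmatch (s - c)) \<le> ?P * exp e2"
    using nmatch_le[of "s - c"] assms unfolding e2_def by (elim order_trans) (intro mult_right_mono; simp)
  have 3: "real (nmatch (n - s - c)) \<le> ?P * exp e3"
    using nmatch_le[of "n - s - c"] assms unfolding e3_def by (elim order_trans) (intro mult_right_mono; simp)
  have 4: "exp e4 \<le> ?P * real (nmatch n)" using nmatch_ge[OF assms(1)] by (simp add: e4_def)
  have "real (fact c * nmatch (s - c) * nmatch (n - s - c)) = fact c * real (nmatch (s - c)) * real (nmatch (n - s - c))"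
    by simp
  also have "\<dots> \<le> (?P * exp e1) * (?P * exp e2) * (?P * exp e3)"
    using 1 2 3 by (intro mult_mono) auto
  also have "\<dots> = ?P^3 * (exp e4 * exp (e1 + e2 + e3 - e4))"
    by (simp add: power3_eq_cube exp_add exp_diff)
  also have "\<dots> \<le> ?P^3 * (?P * real (nmatch n) * exp (e1 + e2 + e3 - e4))"
    using 4 by (intro mult_left_mono mult_right_mono) auto
  also have "\<dots> = ?P^4 * real (nmatch n) * exp (e1 + e2 + e3 - e4)"
    by (simp add: eval_nat_numeral)
  also have "exp (e1 + e2 + e3 - e4) = exp (- layer_rate (real n) (real s) (real c)) *
     layer_weight (real c / real s) (real c / real (n - s)) c s (n - s)"
    using powr_xlnx[of c s] powr_xlnx[of c "n - s"] assms
    by (simp add: layer_weight_def layer_rate_def e1_def e2_def e3_def e4_def of_nat_diff flip: exp_add)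
       argo
  finally show ?thesis .
qed

section \<open>Lower bounds for the rate of one matching\<close>

definition bennett :: "real \<Rightarrow> real" where
  "bennett t = (1 + t) * ln (1 + t) - t"

lemma ln_one_plus_ge: "t \<ge> 0 \<Longrightarrow> ln (1 + t) \<ge> 2 * t / (2 + t)" for t :: real
proof -
  assume t: "t \<ge> 0"
  define f where "f x = ln (1 + x) - 2 * x / (2 + x)" for x :: real
  have "f 0 \<le> f t"
  proof (rule DERIV_nonneg_imp_nondecreasing[OF t])
    fix x :: real assume x: "0 \<le> x" "x \<le> t"
    have "(f has_real_derivative 1 / (1 + x) - 4 / (2 + x)\<^sup>2) (at x)"
      unfolding f_def using x by (auto intro!: derivative_eq_intros simp: field_simps power2_eq_square)
    moreover have "1 / (1 + x) - 4 / (2 + x)\<^sup>2 \<ge> 0"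
    proof -
      have "4 * (1 + x) \<le> (2 + x)\<^sup>2" by (simp add: power2_eq_square algebra_simps)
      thus ?thesis using x by (simp add: frac_le_eq divide_le_eq field_simps)
    qed
    ultimately show "\<exists>y. (f has_real_derivative y) (at x) \<and> 0 \<le> y" by blast
  qed
  thus ?thesis by (simp add: f_def)
qed

text \<open>Bernstein's form of the bound: the quadratic term has the sharp constant 1/2 near 0,
  which keeps the Gaussian exponent w^2/4 exact in the limit. For -1 < t < 0 even t^2/2 holds, by
  comparing derivatives.\<close>

lemma bennett_ge: "t \<ge> -1 \<Longrightarrow> bennett t \<ge> t\<^sup>2 / (2 + \<bar>t\<bar>)"
proof -
  assume "t \<ge> -1"
  consider "t \<ge> 0" | "t = -1" | "-1 < t" "t < 0" using \<open>t \<ge> -1\<close> by linarith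
  thus ?thesis
  proof cases
    case 1
    have "(1 + t) * ln (1 + t) \<ge> (1 + t) * (2 * t / (2 + t))"
      using 1 by (intro mult_left_mono ln_one_plus_ge) auto
    moreover have "(1 + t) * (2 * t / (2 + t)) - t = t\<^sup>2 / (2 + t)"
      using 1 by (simp add: field_simps power2_eq_square)
    ultimately show ?thesis using 1 by (simp add: bennett_def)
  next
    case 3
    define f where "f x = bennett x - x\<^sup>2 / 2" for x
    have "f t \<ge> f 0"
    proof (rule DERIV_nonpos_imp_nonincreasing[of t 0])
      fix x assume x: "t \<le> x" "x \<le> 0"
      have "(f has_real_derivative ln (1 + x) - x) (at x)"
        unfolding f_def bennett_def using x 3 by (auto intro!: derivative_eq_intros)
      moreover have "ln (1 + x) - x \<le> 0" using ln_le_minus_one[of "1 + x"] x 3 by simp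
      ultimately show "\<exists>y. (f has_real_derivative y) (at x) \<and> y \<le> 0" by blast
    qed (use 3 in auto)
    hence "bennett t \<ge> t\<^sup>2 / 2" by (simp add: f_def bennett_def)
    moreover have "t\<^sup>2 / (2 + \<bar>t\<bar>) \<le> t\<^sup>2 / 2" by (intro divide_left_mono) auto
    ultimately show ?thesis by linarith
  qed (simp add: bennett_def)
qed

lemma bennett_nonneg: "t \<ge> -1 \<Longrightarrow> bennett t \<ge> 0"
  using bennett_ge[of t] by (smt (verit) divide_nonneg_nonneg zero_le_power2)

lemma xlnx_bennett:
  assumes "q > 0" "t \<ge> -1"
  shows "xlnx (q * (1 + t)) = q * (1 + t) * ln q + q * (bennett t + t)"
proof (cases "t = -1")
  case False
  hence "1 + t > 0" using assms by simp
  hence "ln (q * (1 + t)) = ln q + ln (1 + t)" using assms by (subst ln_mult) auto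
  thus ?thesis unfolding xlnx_def bennett_def by (simp only: algebra_simps)
qed (simp add: bennett_def)

text \<open>\<open>c\<close>, \<open>s - c\<close> and \<open>n - s - c\<close> are compared with s
  (n - s)/n, s^2/n and (n - s)^2/n. Their absolute deviations are x, -x and -x for one number x, and
  the last two carry the weight 1/2, so the first-order terms cancel and only the Bennett terms
  remain.\<close>

lemma layer_rate_eq:
  fixes n s c :: real
  assumes s: "0 < s" "s < n" and c: "0 \<le> c" "c \<le> s" "c \<le> n - s"
  defines "\<delta> \<equiv> c * n / (s * (n - s)) - 1"
  shows "layer_rate n s c = s * (n - s) / n * bennett \<delta> + s\<^sup>2 / (2 * n) * bennett (- (n - s) * \<delta> / s)
           + (n - s)\<^sup>2 / (2 * n) * bennett (- s * \<delta> / (n - s))"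
    and "\<delta> \<ge> -1" "- (n - s) * \<delta> / s \<ge> -1" "- s * \<delta> / (n - s) \<ge> -1"
proof -
  define r where "r = n - s"
  have r: "r > 0" "n = s + r" "n > 0" using s by (auto simp: r_def)
  define q0 q1 q2 where "q0 = s * r / n" and "q1 = s\<^sup>2 / n" and "q2 = r\<^sup>2 / n"
  define t1 t2 where "t1 = - r * \<delta> / s" and "t2 = - s * \<delta> / r"
  have q: "q0 > 0" "q1 > 0" "q2 > 0" using s r by (auto simp: q0_def q1_def q2_def)
  have c0: "c = q0 * (1 + \<delta>)" using s r by (simp add: q0_def \<delta>_def r_def[symmetric])
  have q0\<delta>: "q0 * \<delta> = c - q0" using c0 by (simp add: algebra_simps)
  have q1t: "q1 * t1 = - (q0 * \<delta>)" "q2 * t2 = - (q0 * \<delta>)"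
    using s r by (simp_all add: q0_def q1_def q2_def t1_def t2_def power2_eq_square)
  have "q1 + q0 = s" "q2 + q0 = r"
    using s r(1,3) by (simp_all add: q0_def q1_def q2_def power2_eq_square add_divide_distrib[symmetric])
      (simp_all add: r(2) field_simps)
  hence c1: "s - c = q1 * (1 + t1)" and c2: "r - c = q2 * (1 + t2)"
    using q1t q0\<delta> by (simp_all add: algebra_simps)
  show 1: "\<delta> \<ge> -1" using c s r by (simp add: \<delta>_def r_def[symmetric])
  have "q1 * (1 + t1) \<ge> 0" "q2 * (1 + t2) \<ge> 0" using c c1 c2 by (auto simp: r_def)
  hence t: "t1 \<ge> -1" "t2 \<ge> -1" using q by (auto simp: zero_le_mult_iff)
  thus "- (n - s) * \<delta> / s \<ge> -1" "- s * \<delta> / (n - s) \<ge> -1" by (auto simp: t1_def t2_def r_def)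
  have ln: "ln q0 = ln s + ln r - ln n" "ln q1 = 2 * ln s - ln n" "ln q2 = 2 * ln r - ln n"
    using s r(1,3) by (simp_all add: q0_def q1_def q2_def ln_div ln_mult ln_realpow)
  have x0: "xlnx c = c * ln q0 + q0 * bennett \<delta> + q0 * \<delta>"
    using xlnx_bennett[OF q(1) 1] by (simp add: c0 algebra_simps)
  have x1: "xlnx (s - c) = (s - c) * ln q1 + q1 * bennett t1 + q1 * t1"
    using xlnx_bennett[OF q(2) t(1)] by (simp add: c1 algebra_simps)
  have x2: "xlnx (r - c) = (r - c) * ln q2 + q2 * bennett t2 + q2 * t2"
    using xlnx_bennett[OF q(3) t(2)] by (simp add: c2 algebra_simps)
  have "layer_rate n s c = xlnx c + xlnx (s - c) / 2 + xlnx (r - c) / 2 - xlnx s - xlnx r + xlnx n / 2"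
    by (simp add: layer_rate_def r_def)
  also have "\<dots> = q0 * bennett \<delta> + q1 / 2 * bennett t1 + q2 / 2 * bennett t2
      + (c * ln q0 + (s - c) / 2 * ln q1 + (r - c) / 2 * ln q2 - s * ln s - r * ln r + n / 2 * ln n)"
    unfolding x0 x1 x2 q1t by (simp add: xlnx_def field_simps)
  also have "c * ln q0 + (s - c) / 2 * ln q1 + (r - c) / 2 * ln q2 - s * ln s - r * ln r + n / 2 * ln n = 0"
    unfolding ln by (simp add: r(2) field_simps)
  finally show "layer_rate n s c = s * (n - s) / n * bennett \<delta> + s\<^sup>2 / (2 * n) * bennett (- (n - s) * \<delta> / s)
           + (n - s)\<^sup>2 / (2 * n) * bennett (- s * \<delta> / (n - s))"
    by (simp add: q0_def q1_def q2_def t1_def t2_def r_def)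
qed

text \<open>All three relative deviations are at most |\<delta>| n / s in absolute value, so one
  denominator serves them all, and the weights then add up to exactly n/2. With |\<delta>| = w /
  sqrt d and \<open>s\<close> of order \<open>n\<close>, \<open>d\<close> matchings give about n w^2
  / 4.\<close>

lemma layer_rate_ge_quadratic:
  fixes n s c :: real
  assumes s: "0 < s" "2 * s \<le> n" and c: "0 \<le> c" "c \<le> s"
  defines "\<delta> \<equiv> c * n / (s * (n - s)) - 1"
  shows "layer_rate n s c \<ge> n / 2 * (\<delta>\<^sup>2 / (2 + \<bar>\<delta>\<bar> * n / s))"
proof -
  have sn: "s < n" "c \<le> n - s" using s c by auto
  define r where "r = n - s"
  have r: "r > 0" "n = s + r" "n > 0" "s \<le> r" using s by (auto simp: r_def)
  note eq = layer_rate_eq[OF s(1) sn(1) c sn(2), folded \<delta>_def, folded r_def]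
  define B where "B = 2 + \<bar>\<delta>\<bar> * n / s"
  have B: "B > 0" using s r by (simp add: B_def add_pos_nonneg)
  have b: "bennett (x * \<delta>) \<ge> x\<^sup>2 * (\<delta>\<^sup>2 / B)" if "\<bar>x\<bar> \<le> n / s" "x * \<delta> \<ge> -1" for x
  proof -
    have "\<bar>x * \<delta>\<bar> \<le> \<bar>\<delta>\<bar> * n / s"
      using mult_right_mono[OF that(1), of "\<bar>\<delta>\<bar>"] by (simp add: abs_mult mult_ac)
    hence "(x * \<delta>)\<^sup>2 / B \<le> (x * \<delta>)\<^sup>2 / (2 + \<bar>x * \<delta>\<bar>)"
      using B by (intro divide_left_mono mult_pos_pos) (auto simp: B_def)
    thus ?thesis using bennett_ge[OF that(2)] by (simp add: power_mult_distrib)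
  qed
  have 0: "bennett \<delta> \<ge> \<delta>\<^sup>2 / B" using b[of 1] eq(2) s r by (simp add: field_simps)
  have "bennett (-(r / s) * \<delta>) \<ge> (-(r / s))\<^sup>2 * (\<delta>\<^sup>2 / B)"
    using eq(3) s r by (intro b) (auto simp: abs_divide divide_right_mono)
  hence 1: "bennett (- r * \<delta> / s) \<ge> r\<^sup>2 / s\<^sup>2 * (\<delta>\<^sup>2 / B)" by (simp add: power_divide)
  have "s / r \<le> n / s" using s r by (simp add: field_simps mult_mono add_increasing)
  hence "bennett (-(s / r) * \<delta>) \<ge> (-(s / r))\<^sup>2 * (\<delta>\<^sup>2 / B)"
    using eq(4) s r by (intro b) (auto simp: abs_divide)
  hence 2: "bennett (- s * \<delta> / r) \<ge> s\<^sup>2 / r\<^sup>2 * (\<delta>\<^sup>2 / B)" by (simp add: power_divide)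
  have "layer_rate n s c \<ge> s * r / n * (\<delta>\<^sup>2 / B) + s\<^sup>2 / (2 * n) * (r\<^sup>2 / s\<^sup>2 * (\<delta>\<^sup>2 / B))
     + r\<^sup>2 / (2 * n) * (s\<^sup>2 / r\<^sup>2 * (\<delta>\<^sup>2 / B))"
    unfolding eq(1) using s r by (intro add_mono mult_left_mono 0 1 2) auto
  also have "s * r / n * (\<delta>\<^sup>2 / B) + s\<^sup>2 / (2 * n) * (r\<^sup>2 / s\<^sup>2 * (\<delta>\<^sup>2 / B)) + r\<^sup>2 / (2 * n) * (s\<^sup>2 / r\<^sup>2 * (\<delta>\<^sup>2 / B))
     = ((2 * s * r + r\<^sup>2 + s\<^sup>2) / (2 * n)) * (\<delta>\<^sup>2 / B)"
    using s r(1,3) B by (simp add: field_simps)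
  also have "(2 * s * r + r\<^sup>2 + s\<^sup>2) / (2 * n) = n / 2"
    using r(3) by (simp add: r(2) field_simps power2_eq_square)
  finally show ?thesis by (simp add: B_def)
qed

text \<open>The rate is convex in \<open>c\<close>, so for a given total cut the cheapest
  distribution over the matchings is the even one.\<close>

lemma layer_rate_jensen:
  fixes c :: "nat \<Rightarrow> real"
  assumes d: "d > 0" and c: "\<And>k. k < d \<Longrightarrow> 0 \<le> c k \<and> c k \<le> s \<and> c k \<le> n - s"
  shows "(\<Sum>k<d. layer_rate n s (c k)) \<ge> real d * layer_rate n s ((\<Sum>k<d. c k) / real d)"
proof -
  define m where "m = (\<Sum>k<d. c k) / real d"
  have A: "(\<Sum>k<d. xlnx (c k)) \<ge> real d * xlnx m"
    unfolding m_def using c by (intro xlnx_jensen) auto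
  have "(\<Sum>k<d. xlnx (x - c k)) \<ge> real d * xlnx (x - m)" if "\<And>k. k < d \<Longrightarrow> c k \<le> x" for x
  proof -
    have "(\<Sum>k<d. xlnx (x - c k)) \<ge> real d * xlnx ((\<Sum>k<d. x - c k) / real d)"
      using that by (intro xlnx_jensen) auto
    also have "(\<Sum>k<d. x - c k) / real d = x - m"
      using d by (simp add: sum_subtractf m_def field_simps)
    finally show ?thesis .
  qed
  from this[of s] this[of "n - s"] have B: "(\<Sum>k<d. xlnx (s - c k)) \<ge> real d * xlnx (s - m)"
    "(\<Sum>k<d. xlnx (n - s - c k)) \<ge> real d * xlnx (n - s - m)" using c by auto
  have "(\<Sum>k<d. layer_rate n s (c k)) = (\<Sum>k<d. xlnx (c k)) + (\<Sum>k<d. xlnx (s - c k)) / 2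
    + (\<Sum>k<d. xlnx (n - s - c k)) / 2 + real d * (- xlnx s - xlnx (n - s) + xlnx n / 2)"
    by (simp add: layer_rate_def sum.distrib sum_subtractf sum_divide_distrib algebra_simps)
  also have "\<dots> \<ge> real d * layer_rate n s m"
    using A B by (simp add: layer_rate_def algebra_simps)
  finally show ?thesis by (simp add: m_def)
qed

section \<open>Sums of independent Bernoulli variables\<close>

definition bern :: "nat \<Rightarrow> (nat \<Rightarrow> real) \<Rightarrow> (nat \<Rightarrow> bool) pmf" where
  "bern d p = Pi_pmf {..<d} False (\<lambda>k. bernoulli_pmf (p k))"

text \<open>A finite sum of products, the form in which the count of tuples delivers it. The link to
  a product measure, and so to the central limit theorem, is
  \<open>bern_set_prob_eq\<close>.\<close>

definition bern_set_prob :: "nat \<Rightarrow> (nat \<Rightarrow> real) \<Rightarrow> nat set set \<Rightarrow> real" where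
  "bern_set_prob d p \<R> = (\<Sum>D\<in>Pow {..<d} \<inter> \<R>. \<Prod>k<d. if k \<in> D then p k else 1 - p k)"

lemma bern_set_prob_eq:
  assumes p: "\<And>k. k < d \<Longrightarrow> 0 \<le> p k \<and> p k \<le> 1"
  shows "bern_set_prob d p \<R> = measure_pmf.prob (bern d p) {\<omega>. {k. k < d \<and> \<omega> k} \<in> \<R>}"
proof -
  define F where "F = (\<lambda>D k. k \<in> D :: bool) ` (Pow {..<d} \<inter> \<R>)"
  have inj: "inj_on (\<lambda>D k. k \<in> D :: bool) X" for X :: "nat set set"
    by (auto simp: inj_on_def fun_eq_iff)
  \<comment> \<open>\<open>Pi_pmf\<close> takes the default \<open>False\<close> outside
    \<open>{..<d}\<close>; among such functions the index set
    \<open>{k. k < d \<and> \<omega> k}\<close> determines \<open>\<omega>\<close>, so the event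
    becomes a finite set.\<close>
  have "measure_pmf.prob (bern d p) {\<omega>. {k. k < d \<and> \<omega> k} \<in> \<R>} =
        measure_pmf.prob (bern d p) ({\<omega>. {k. k < d \<and> \<omega> k} \<in> \<R>} \<inter> {f. \<forall>x. x \<notin> {..<d} \<longrightarrow> f x = False})"
    using set_Pi_pmf_subset[of "{..<d}" False "\<lambda>k. bernoulli_pmf (p k)"]
    by (intro measure_pmf.finite_measure_eq_AE)
       (auto simp: AE_measure_pmf_iff bern_def)
  also have "{\<omega>. {k. k < d \<and> \<omega> k} \<in> \<R>} \<inter> {f. \<forall>x. x \<notin> {..<d} \<longrightarrow> f x = False} = F"
  proof (intro equalityI subsetI)
    fix \<omega> assume w: "\<omega> \<in> {\<omega>. {k. k < d \<and> \<omega> k} \<in> \<R>} \<inter> {f. \<forall>x. x \<notin> {..<d} \<longrightarrow> f x = False}"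
    hence "\<omega> = (\<lambda>k. k \<in> {k. k < d \<and> \<omega> k})" by (auto simp: fun_eq_iff)
    moreover have "{k. k < d \<and> \<omega> k} \<in> Pow {..<d} \<inter> \<R>" using w by auto
    ultimately show "\<omega> \<in> F" unfolding F_def by (rule image_eqI)
  next
    fix \<omega> assume "\<omega> \<in> F"
    then obtain D where D: "D \<subseteq> {..<d}" "D \<in> \<R>" "\<omega> = (\<lambda>k. k \<in> D)" by (auto simp: F_def)
    hence "{k. k < d \<and> \<omega> k} = D" by auto
    thus "\<omega> \<in> {\<omega>. {k. k < d \<and> \<omega> k} \<in> \<R>} \<inter> {f. \<forall>x. x \<notin> {..<d} \<longrightarrow> f x = False}"
      using D by auto
  qed
  also have "measure_pmf.prob (bern d p) F = (\<Sum>\<omega>\<in>F. pmf (bern d p) \<omega>)"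
    by (rule measure_measure_pmf_finite) (simp add: F_def)
  also have "\<dots> = (\<Sum>D\<in>Pow {..<d} \<inter> \<R>. pmf (bern d p) (\<lambda>k. k \<in> D))"
    unfolding F_def by (subst sum.reindex[OF inj]) (simp add: o_def)
  also have "\<dots> = bern_set_prob d p \<R>"
    unfolding bern_set_prob_def
  proof (rule sum.cong[OF refl])
    fix D assume "D \<in> Pow {..<d} \<inter> \<R>"
    hence "pmf (bern d p) (\<lambda>k. k \<in> D) = (\<Prod>k<d. pmf (bernoulli_pmf (p k)) (k \<in> D))"
      unfolding bern_def by (intro pmf_Pi') auto
    also have "\<dots> = (\<Prod>k<d. if k \<in> D then p k else 1 - p k)"
      using p by (intro prod.cong refl) auto
    finally show "pmf (bern d p) (\<lambda>k. k \<in> D) = (\<Prod>k<d. if k \<in> D then p k else 1 - p k)" .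
  qed
  finally show ?thesis by simp
qed

definition bern_sum :: "nat \<Rightarrow> (nat \<Rightarrow> real) \<Rightarrow> (nat \<Rightarrow> bool) \<Rightarrow> real" where
  "bern_sum d p \<omega> = (\<Sum>k<d. of_bool (\<omega> k) - p k)"

definition bern_var :: "nat \<Rightarrow> (nat \<Rightarrow> real) \<Rightarrow> real" where
  "bern_var d p = (\<Sum>k<d. p k * (1 - p k))"

lemma bern_sum_eq: "bern_sum d p \<omega> = real (card {k. k < d \<and> \<omega> k}) - (\<Sum>k<d. p k)"
proof -
  have "(\<Sum>k<d. of_bool (\<omega> k) :: real) = real (card ({..<d} \<inter> {k. \<omega> k}))"
    by (subst sum_of_bool_eq) auto
  also have "{..<d} \<inter> {k. \<omega> k} = {k. k < d \<and> \<omega> k}" by auto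
  finally show ?thesis by (simp add: bern_sum_def sum_subtractf)
qed

text \<open>Lindeberg's argument in quantitative form: each factor of the characteristic function is
  compared with that of a normal variable of the same variance, and the product is telescoped. The
  bound involves \<open>d\<close> and \<open>p\<close> only through \<sigma>, the source of the
  uniformity in \<open>bern_sum_CLT\<close>.\<close>

lemma char_bern_sum:
  fixes d p t
  assumes p: "\<And>k. k < d \<Longrightarrow> 0 \<le> p k \<and> p k \<le> 1" and pos: "bern_var d p > 0"
  defines "\<sigma> \<equiv> sqrt (bern_var d p)"
  shows "cmod (char (distr (measure_pmf (bern d p)) borel (\<lambda>\<omega>. bern_sum d p \<omega> / \<sigma>)) t - exp (-(t\<^sup>2) / 2))
           \<le> \<bar>t\<bar>^3 / (6 * \<sigma>) + t^4 / (8 * \<sigma>\<^sup>2)"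
proof -
  let ?Q = "measure_pmf (bern d p)"
  define X where "X k \<omega> = (of_bool (\<omega> k) - p k) / \<sigma>" for k and \<omega> :: "nat \<Rightarrow> bool"
  define v where "v k = p k * (1 - p k)" for k
  have \<sigma>: "\<sigma> > 0" "\<sigma>\<^sup>2 = (\<Sum>k<d. v k)" using pos by (simp_all add: \<sigma>_def v_def bern_var_def)
  have v: "0 \<le> v k" "v k \<le> 1" if "k < d" for k
    using p[OF that] by (auto simp: v_def intro: mult_le_one)
  have "prob_space.indep_vars ?Q (\<lambda>_. borel) (\<lambda>k \<omega>. (\<lambda>b. (of_bool b - p k) / \<sigma>) (\<omega> k)) {..<d}"
    unfolding bern_def
    by (rule prob_space.indep_vars_compose2[OF _ indep_vars_Pi_pmf]) (auto simp: measure_pmf.prob_space_axioms)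
  hence indep: "prob_space.indep_vars ?Q (\<lambda>_. borel) X {..<d}" by (simp add: X_def[abs_def])
  have "char (distr ?Q borel (\<lambda>\<omega>. bern_sum d p \<omega> / \<sigma>)) t = char (distr ?Q borel (\<lambda>\<omega>. \<Sum>k<d. X k \<omega>)) t"
    by (simp add: bern_sum_def X_def sum_divide_distrib)
  also have "\<dots> = (\<Prod>k<d. char (distr ?Q borel (X k)) t)"
    by (rule prob_space.char_distr_sum[OF measure_pmf.prob_space_axioms indep])
  finally have char_eq: "char (distr ?Q borel (\<lambda>\<omega>. bern_sum d p \<omega> / \<sigma>)) t = (\<Prod>k<d. char (distr ?Q borel (X k)) t)" .
  have one: "cmod (char (distr ?Q borel (X k)) t - exp (-(t\<^sup>2 * v k / (2 * \<sigma>\<^sup>2))))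
      \<le> (\<bar>t\<bar>^3 / (6 * \<sigma>^3) + t^4 / (8 * \<sigma>^4)) * v k" if k: "k < d" for k
  proof -
    have E: "measure_pmf.expectation (bern d p) (\<lambda>\<omega>. f (\<omega> k)) = f True * p k + f False * (1 - p k)"
      for f :: "bool \<Rightarrow> real"
    proof -
      have "bernoulli_pmf (p k) = map_pmf (\<lambda>\<omega>. \<omega> k) (bern d p)"
        unfolding bern_def using k by (subst Pi_pmf_component) auto
      hence "measure_pmf.expectation (bern d p) (\<lambda>\<omega>. f (\<omega> k)) = measure_pmf.expectation (bernoulli_pmf (p k)) f"
        by simp
      thus ?thesis using p[OF k] by simp
    qed
    \<comment> \<open>Bounded summands turn the third moment into the second: |X|^3 \<le> X^2 /
      \<sigma>.\<close>
    have bnd: "\<bar>X k \<omega>\<bar> \<le> 1 / \<sigma>" for \<omega>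
      using p[OF k] \<sigma> by (auto simp: X_def divide_right_mono of_bool_def)
    have int: "integrable ?Q (\<lambda>\<omega>. f (\<omega> k))" for f :: "bool \<Rightarrow> real"
      by (rule measure_pmf.integrable_const_bound[where B = "max \<bar>f True\<bar> \<bar>f False\<bar>"])
         (auto intro!: AE_I2 simp: UNIV_bool, metis max.cobounded1 max.cobounded2)
    have E0: "measure_pmf.expectation (bern d p) (X k) = 0"
      using E[of "\<lambda>b. (of_bool b - p k) / \<sigma>"] by (simp add: X_def[abs_def] field_simps)
    have E2: "measure_pmf.expectation (bern d p) (\<lambda>x. (X k x)\<^sup>2) = v k / \<sigma>\<^sup>2"
      using E[of "\<lambda>b. ((of_bool b - p k) / \<sigma>)\<^sup>2"] \<sigma>
      by (simp add: X_def[abs_def] v_def power_divide field_simps power2_eq_square)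
    have "cmod (char (distr ?Q borel (X k)) t - (1 - t^2 * (v k / \<sigma>\<^sup>2) / 2)) \<le>
      (t^2 / 6) * measure_pmf.expectation (bern d p) (\<lambda>x. min (6 * (X k x)^2) (\<bar>t\<bar> * \<bar>X k x\<bar>^3))"
      by (rule prob_space.char_approx3'[OF measure_pmf.prob_space_axioms, where X = "X k"])
         (use int[of "\<lambda>b. (of_bool b - p k) / \<sigma>"] int[of "\<lambda>b. ((of_bool b - p k) / \<sigma>)\<^sup>2"] E0 E2 in
           \<open>auto simp: X_def[abs_def]\<close>)
    also have "measure_pmf.expectation (bern d p) (\<lambda>x. min (6 * (X k x)^2) (\<bar>t\<bar> * \<bar>X k x\<bar>^3))
       \<le> measure_pmf.expectation (bern d p) (\<lambda>x. (\<bar>t\<bar> / \<sigma>) * (X k x)\<^sup>2)"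
    proof (rule integral_mono)
      show "integrable ?Q (\<lambda>x. min (6 * (X k x)^2) (\<bar>t\<bar> * \<bar>X k x\<bar>^3))"
        using int[of "\<lambda>b. min (6 * ((of_bool b - p k) / \<sigma>)^2) (\<bar>t\<bar> * \<bar>(of_bool b - p k) / \<sigma>\<bar>^3)"]
        by (simp add: X_def)
      show "integrable ?Q (\<lambda>x. (\<bar>t\<bar> / \<sigma>) * (X k x)\<^sup>2)"
        using int[of "\<lambda>b. (\<bar>t\<bar> / \<sigma>) * ((of_bool b - p k) / \<sigma>)^2"] by (simp add: X_def)
      fix \<omega>
      have "\<bar>X k \<omega>\<bar>^3 = \<bar>X k \<omega>\<bar> * (X k \<omega>)\<^sup>2" by (simp add: power3_eq_cube power2_eq_square)
      also have "\<dots> \<le> (1 / \<sigma>) * (X k \<omega>)\<^sup>2" by (intro mult_right_mono bnd) auto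
      finally have "\<bar>t\<bar> * \<bar>X k \<omega>\<bar>^3 \<le> \<bar>t\<bar> * ((1 / \<sigma>) * (X k \<omega>)\<^sup>2)" by (intro mult_left_mono) auto
      thus "min (6 * (X k \<omega>)^2) (\<bar>t\<bar> * \<bar>X k \<omega>\<bar>^3) \<le> (\<bar>t\<bar> / \<sigma>) * (X k \<omega>)\<^sup>2" by simp
    qed
    also have "\<dots> = \<bar>t\<bar> / \<sigma> * (v k / \<sigma>\<^sup>2)" using E2 by simp
    also have "t\<^sup>2 / 6 * (\<bar>t\<bar> / \<sigma> * (v k / \<sigma>\<^sup>2)) = \<bar>t\<bar>^3 / (6 * \<sigma>^3) * v k"
      by (simp add: power2_eq_square power3_eq_cube)
    finally have 1: "cmod (char (distr ?Q borel (X k)) t - (1 - t^2 * (v k / \<sigma>\<^sup>2) / 2)) \<le> \<bar>t\<bar>^3 / (6 * \<sigma>^3) * v k"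
      by (simp add: mult_left_mono)
    define y where "y = t\<^sup>2 * v k / (2 * \<sigma>\<^sup>2)"
    have y: "y \<ge> 0" using v[OF k] by (simp add: y_def)
    \<comment> \<open>Second-order expansion of the Gaussian factor; its error y^2/2 yields the t^4
      term because \<open>v k \<le> 1\<close>.\<close>
    have "exp (-y) \<ge> 1 - y" using exp_ge_add_one_self[of "-y"] by simp
    moreover have "exp (-y) \<le> 1 - y + y\<^sup>2 / 2"
    proof -
      obtain s where s: "exp (-y) = (\<Sum>m<3. (-y) ^ m / fact m) + exp s / fact 3 * (-y) ^ 3"
        using Maclaurin_exp_le[of "-y" 3] by blast
      have "exp s / fact 3 * (-y) ^ 3 \<le> 0" using y by (simp add: mult_nonneg_nonpos power_le_zero_eq)
      thus ?thesis using s by (simp add: eval_nat_numeral)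
    qed
    ultimately have 2: "\<bar>(1 - y) - exp (-y)\<bar> \<le> y\<^sup>2 / 2" by simp
    have "y\<^sup>2 / 2 = t^4 / (8 * \<sigma>^4) * (v k * v k)"
      by (simp add: y_def power2_eq_square power4_eq_xxxx mult_ac)
    also have "\<dots> \<le> t^4 / (8 * \<sigma>^4) * (v k * 1)"
      using v[OF k] by (intro mult_left_mono) auto
    finally have 3: "y\<^sup>2 / 2 \<le> t^4 / (8 * \<sigma>^4) * v k" by simp
    have "cmod (char (distr ?Q borel (X k)) t - exp (-y))
       \<le> cmod (char (distr ?Q borel (X k)) t - (1 - y)) + cmod (complex_of_real (1 - y) - complex_of_real (exp (-y)))"
      using norm_triangle_ineq[of "char (distr ?Q borel (X k)) t - (1 - y)" "complex_of_real (1 - y) - exp (-y)"]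
      by simp
    also have "cmod (complex_of_real (1 - y) - complex_of_real (exp (-y))) = \<bar>(1 - y) - exp (-y)\<bar>"
      by (metis norm_of_real of_real_diff)
    also have "cmod (char (distr ?Q borel (X k)) t - (1 - y)) \<le> \<bar>t\<bar>^3 / (6 * \<sigma>^3) * v k"
      using 1 by (simp add: y_def mult_ac)
    finally have "cmod (char (distr ?Q borel (X k)) t - exp (-y)) \<le> \<bar>t\<bar>^3 / (6 * \<sigma>^3) * v k + t^4 / (8 * \<sigma>^4) * v k"
      using 2 3 by linarith
    thus ?thesis by (simp add: y_def algebra_simps)
  qed
  have expprod: "complex_of_real (exp (-(t\<^sup>2) / 2)) = (\<Prod>k<d. complex_of_real (exp (-(t\<^sup>2 * v k / (2 * \<sigma>\<^sup>2)))))"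
  proof -
    have "(\<Sum>k<d. -(t\<^sup>2 * v k / (2 * \<sigma>\<^sup>2))) = -(t\<^sup>2 / (2 * \<sigma>\<^sup>2)) * (\<Sum>k<d. v k)"
      by (simp add: sum_distrib_left sum_negf)
    also have "\<dots> = -(t\<^sup>2) / 2" using \<sigma>(1) by (simp flip: \<sigma>(2))
    finally show ?thesis by (metis (no_types) exp_sum finite_lessThan of_real_prod)
  qed
  have "cmod ((\<Prod>k<d. char (distr ?Q borel (X k)) t) - (\<Prod>k<d. complex_of_real (exp (-(t\<^sup>2 * v k / (2 * \<sigma>\<^sup>2))))))
     \<le> (\<Sum>k<d. cmod (char (distr ?Q borel (X k)) t - exp (-(t\<^sup>2 * v k / (2 * \<sigma>\<^sup>2)))))"
  proof (rule norm_prod_diff)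
    fix k assume "k \<in> {..<d}"
    show "cmod (char (distr ?Q borel (X k)) t) \<le> 1"
      by (intro real_distribution.cmod_char_le_1 prob_space.real_distribution_distr[OF measure_pmf.prob_space_axioms]) auto
    show "cmod (complex_of_real (exp (-(t\<^sup>2 * v k / (2 * \<sigma>\<^sup>2))))) \<le> 1"
      using v[of k] \<open>k \<in> {..<d}\<close> by simp
  qed
  also have "\<dots> \<le> (\<Sum>k<d. (\<bar>t\<bar>^3 / (6 * \<sigma>^3) + t^4 / (8 * \<sigma>^4)) * v k)"
    using one by (intro sum_mono) auto
  also have "\<dots> = (\<bar>t\<bar>^3 / (6 * \<sigma>^3) + t^4 / (8 * \<sigma>^4)) * \<sigma>\<^sup>2"
    by (simp add: \<sigma> sum_distrib_left)
  also have "\<dots> = \<bar>t\<bar>^3 / (6 * \<sigma>) + t^4 / (8 * \<sigma>\<^sup>2)"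
    using \<sigma>(1) by (simp add: field_simps power2_eq_square power3_eq_cube power4_eq_xxxx)
  finally show ?thesis by (simp only: char_eq expprod)
qed

section \<open>The central limit theorem for Bernoulli sums, uniformly in the parameters\<close>

definition gauss_cdf :: "real \<Rightarrow> real" where
  "gauss_cdf = cdf std_normal_distribution"

lemma std_normal_singleton: "measure std_normal_distribution {x} = 0"
proof -
  have "emeasure std_normal_distribution {x} = 0"
    by (subst emeasure_density) (auto simp: nn_integral_null_delta)
  thus ?thesis by (simp add: measure_def)
qed

lemma isCont_gauss_cdf: "isCont gauss_cdf x"
proof -
  interpret N: real_distribution std_normal_distribution by (rule real_dist_normal_dist)
  show ?thesis unfolding gauss_cdf_def by (simp add: N.isCont_cdf std_normal_singleton)
qed

text \<open>By contradiction: counterexamples with variance at least 1, 2, 3, ... form a triangular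
  array, to which Levy's continuity theorem applies since the error in \<open>char_bern_sum\<close>
  tends to 0 with growing variance. Hence one threshold \<open>V\<close> serves all \<open>d\<close>
  and \<open>p\<close>.\<close>

lemma bern_sum_CLT:
  assumes e: "\<epsilon> > 0"
  shows "\<exists>V>0. \<forall>d p. (\<forall>k<d. 0 \<le> p k \<and> p k \<le> 1) \<and> bern_var d p \<ge> V \<longrightarrow>
     \<bar>measure_pmf.prob (bern d p) {\<omega>. bern_sum d p \<omega> \<le> x * sqrt (bern_var d p)} - gauss_cdf x\<bar> \<le> \<epsilon>"
proof (rule ccontr)
  assume "\<not> ?thesis"
  hence "\<forall>j::nat. \<exists>d p. (\<forall>k<d. 0 \<le> p k \<and> p k \<le> 1) \<and> bern_var d p \<ge> real (Suc j) \<and>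
     \<bar>measure_pmf.prob (bern d p) {\<omega>. bern_sum d p \<omega> \<le> x * sqrt (bern_var d p)} - gauss_cdf x\<bar> > \<epsilon>"
    by (metis not_le of_nat_0_less_iff zero_less_Suc)
  then obtain d p where dp: "\<And>j k. k < d j \<Longrightarrow> 0 \<le> p j k \<and> p j k \<le> 1"
      "\<And>j::nat. bern_var (d j) (p j) \<ge> real (Suc j)"
      "\<And>j. \<bar>measure_pmf.prob (bern (d j) (p j)) {\<omega>. bern_sum (d j) (p j) \<omega> \<le> x * sqrt (bern_var (d j) (p j))} - gauss_cdf x\<bar> > \<epsilon>"
    by metis
  define \<sigma> where "\<sigma> j = sqrt (bern_var (d j) (p j))" for j
  have var_pos: "bern_var (d j) (p j) > 0" for j using dp(2)[of j] by linarith
  have \<sigma>_pos: "\<sigma> j > 0" for j using var_pos[of j] by (simp add: \<sigma>_def)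
  have \<sigma>_lim: "filterlim \<sigma> at_top sequentially"
  proof (rule filterlim_at_top_mono)
    show "filterlim (\<lambda>j. sqrt (real (Suc j))) at_top sequentially" by real_asymp
    show "\<forall>\<^sub>F j in sequentially. sqrt (real (Suc j)) \<le> \<sigma> j"
      using dp(2) by (auto simp: \<sigma>_def intro!: always_eventually)
  qed
  define \<mu> where "\<mu> j = distr (measure_pmf (bern (d j) (p j))) borel (\<lambda>\<omega>. bern_sum (d j) (p j) \<omega> / \<sigma> j)" for j
  have "weak_conv_m \<mu> std_normal_distribution"
  proof (rule levy_continuity)
    show "real_distribution (\<mu> j)" for j
      unfolding \<mu>_def by (intro prob_space.real_distribution_distr[OF measure_pmf.prob_space_axioms]) auto
    show "real_distribution std_normal_distribution" by (rule real_dist_normal_dist)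
    fix t
    have lim: "(\<lambda>j. \<bar>t\<bar>^3 / (6 * \<sigma> j) + t^4 / (8 * (\<sigma> j)\<^sup>2)) \<longlonglongrightarrow> 0"
      by (rule filterlim_compose[OF _ \<sigma>_lim]) real_asymp
    have "norm (char (\<mu> j) t - complex_of_real (exp (-(t\<^sup>2) / 2))) \<le> \<bar>t\<bar>^3 / (6 * \<sigma> j) + t^4 / (8 * (\<sigma> j)\<^sup>2)" for j
      unfolding \<mu>_def \<sigma>_def using char_bern_sum[of "d j" "p j" t] dp(1)[of _ j] var_pos[of j] by blast
    hence "(\<lambda>j. char (\<mu> j) t - complex_of_real (exp (-(t\<^sup>2) / 2))) \<longlonglongrightarrow> 0"
      by (intro Lim_null_comparison[OF always_eventually[OF allI] lim])
    thus "(\<lambda>j. char (\<mu> j) t) \<longlonglongrightarrow> char std_normal_distribution t"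
      unfolding char_std_normal_distribution by (rule LIM_zero_cancel)
  qed
  hence "(\<lambda>j. cdf (\<mu> j) x) \<longlonglongrightarrow> gauss_cdf x"
    using isCont_gauss_cdf[of x] unfolding weak_conv_m_def weak_conv_def gauss_cdf_def by blast
  hence "\<forall>\<^sub>F j in sequentially. \<bar>cdf (\<mu> j) x - gauss_cdf x\<bar> < \<epsilon>"
    using e by (auto simp: tendsto_iff dist_real_def)
  then obtain j where j: "\<bar>cdf (\<mu> j) x - gauss_cdf x\<bar> < \<epsilon>" by (auto simp: eventually_sequentially)
  have "cdf (\<mu> j) x = measure_pmf.prob (bern (d j) (p j)) ((\<lambda>\<omega>. bern_sum (d j) (p j) \<omega> / \<sigma> j) -` {..x})"
    unfolding cdf_def \<mu>_def by (subst measure_distr) auto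
  also have "(\<lambda>\<omega>. bern_sum (d j) (p j) \<omega> / \<sigma> j) -` {..x} = {\<omega>. bern_sum (d j) (p j) \<omega> \<le> x * sqrt (bern_var (d j) (p j))}"
    using \<sigma>_pos[of j] by (auto simp: field_simps \<sigma>_def)
  finally show False using j dp(3)[of j] by simp
qed

section \<open>Gaussian numerics\<close>

lemma std_normal_measure_eq:
  assumes "A \<in> sets borel"
  shows "measure std_normal_distribution A = (LINT x|lborel. std_normal_density x * indicator A x)"
proof -
  have "(LINT x|std_normal_distribution. indicator A x :: real) = measure std_normal_distribution A"
    using assms by simp
  moreover have "(LINT x|std_normal_distribution. indicator A x :: real) = (LINT x|lborel. std_normal_density x * indicator A x)"
    using assms by (subst integral_density) (auto simp: normal_density_nonneg)
  ultimately show ?thesis by simp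
qed

lemma integrable_std_normal_indicator:
  "A \<in> sets borel \<Longrightarrow> integrable lborel (\<lambda>x. std_normal_density x * indicator A x)"
  by (intro integrable_real_mult_indicator) auto

lemma gauss_cdf_uminus: "gauss_cdf (-y) = 1 - gauss_cdf y"
proof -
  interpret N: real_distribution std_normal_distribution by (rule real_dist_normal_dist)
  have "gauss_cdf (-y) = (LINT x|lborel. std_normal_density x * indicator {..-y} x)"
    by (simp add: gauss_cdf_def cdf_def std_normal_measure_eq)
  also have "\<dots> = (LINT x|lborel. std_normal_density x * indicator {y..} x)"
    by (subst lborel_integral_real_affine[of "-1" _ 0])
       (auto intro!: Bochner_Integration.integral_cong simp: std_normal_density_def indicator_def)
  also have "\<dots> = measure std_normal_distribution {y..}"
    by (simp add: std_normal_measure_eq)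
  also have "{y..} = {y} \<union> {y<..}" by auto
  also have "measure std_normal_distribution ({y} \<union> {y<..}) = measure std_normal_distribution {y<..}"
    by (subst N.finite_measure_Union) (auto simp: std_normal_singleton)
  also have "{y<..} = space std_normal_distribution - {..y}" by auto
  also have "measure std_normal_distribution (space std_normal_distribution - {..y}) = 1 - gauss_cdf y"
    by (subst N.prob_compl) (auto simp: gauss_cdf_def cdf_def)
  finally show ?thesis .
qed

lemma std_normal_density_le: "std_normal_density x \<le> 2 / 5"
proof -
  have "(5 / 2)\<^sup>2 \<le> 2 * pi" using pi_approx by (simp add: power2_eq_square)
  hence "5 / 2 \<le> sqrt (2 * pi)" by (rule real_le_rsqrt)
  hence "1 / sqrt (2 * pi) \<le> 2 / 5" by (simp add: field_simps)
  moreover have "exp (- x\<^sup>2 / 2) \<le> 1" by simp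
  ultimately have "1 / sqrt (2 * pi) * exp (- x\<^sup>2 / 2) \<le> 2 / 5 * 1" by (intro mult_mono) auto
  thus ?thesis by (simp add: std_normal_density_def)
qed

lemma gauss_cdf_diff:
  assumes "x < y"
  shows "gauss_cdf y - gauss_cdf x = (LINT t|lborel. std_normal_density t * indicator {x<..y} t)"
proof -
  interpret N: real_distribution std_normal_distribution by (rule real_dist_normal_dist)
  show ?thesis using N.cdf_diff_eq[OF assms] by (simp add: gauss_cdf_def std_normal_measure_eq)
qed

lemma gauss_cdf_lipschitz:
  assumes "x \<le> y"
  shows "gauss_cdf y - gauss_cdf x \<le> 2 / 5 * (y - x)"
proof (cases "x = y")
  case False
  hence xy: "x < y" using assms by simp
  have "(LINT t|lborel. std_normal_density t * indicator {x<..y} t) \<le> (LINT t|lborel. 2 / 5 * indicator {x<..y} t)"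
    using std_normal_density_le xy
    by (intro integral_mono integrable_std_normal_indicator integrable_mult_right integrable_real_indicator)
       (auto simp: indicator_def)
  also have "\<dots> = 2 / 5 * (y - x)" using xy by simp
  finally show ?thesis using gauss_cdf_diff[OF xy] by simp
qed simp

lemma gauss_cdf_mono: "x \<le> y \<Longrightarrow> gauss_cdf x \<le> gauss_cdf y"
proof -
  interpret N: real_distribution std_normal_distribution by (rule real_dist_normal_dist)
  show "x \<le> y \<Longrightarrow> gauss_cdf x \<le> gauss_cdf y" unfolding gauss_cdf_def by (rule N.cdf_nondecreasing)
qed

lemma exp_minus_le_taylor6:
  assumes "t \<ge> (0::real)"
  shows "exp (-t) \<le> 1 - t + t^2/2 - t^3/6 + t^4/24 - t^5/120 + t^6/720"
proof -
  obtain s where s: "exp (-t) = (\<Sum>m<7. (-t) ^ m / fact m) + exp s / fact 7 * (-t) ^ 7"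
    using Maclaurin_exp_le[of "-t" 7] by blast
  have "exp s / fact 7 * (-t) ^ 7 \<le> 0" using assms by (simp add: mult_nonneg_nonpos power_le_zero_eq)
  hence "exp (-t) \<le> (\<Sum>m<7. (-t) ^ m / fact m)" using s by linarith
  also have "\<dots> = 1 - t + t^2/2 - t^3/6 + t^4/24 - t^5/120 + t^6/720"
    by (simp add: eval_nat_numeral)
  finally show ?thesis .
qed

lemma inverse_pi_bounds: "0.318309 \<le> 1 / pi" "1 / pi \<le> 0.31831"
  using pi_approx by (simp_all add: field_simps)

abbreviation (input) cut_const :: real where "cut_const \<equiv> 2 * sqrt (2 / pi)"

lemma cut_const_sq: "cut_const\<^sup>2 = 8 / pi"
  by (simp add: power_mult_distrib)

lemma cut_const_bounds: "1595 / 1000 \<le> cut_const" "cut_const < 1596 / 1000"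
proof -
  have "(1595 / 2000)\<^sup>2 \<le> 2 / pi" using pi_approx by (simp add: field_simps power2_eq_square)
  thus "1595 / 1000 \<le> cut_const" using real_le_rsqrt[of "1595 / 2000" "2 / pi"] by simp
  have "2 / pi < (1596 / 2000)\<^sup>2" using pi_approx by (simp add: field_simps power2_eq_square)
  hence "sqrt (2 / pi) < 1596 / 2000" by (intro real_less_lsqrt) auto
  thus "cut_const < 1596 / 1000" by simp
qed

text \<open>The density is integrated over the symmetric interval from -y to y, with the degree 6
  Taylor polynomial of exp (- t) at t = x^2/2 as upper bound. The result has to stay below exp
  (2/pi) / 2 = 0.9450..., which leaves room for an error of about 3/10000 only.\<close>

lemma gauss_cdf_cut_const: "gauss_cdf cut_const \<le> 94478 / 100000"
proof -
  define y where "y = cut_const"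
  define P :: "real \<Rightarrow> real" where
    "P x = 1 - x^2/2 + x^4/8 - x^6/48 + x^8/384 - x^10/3840 + x^12/46080" for x
  define F :: "real \<Rightarrow> real" where
    "F x = x - x^3/6 + x^5/40 - x^7/336 + x^9/3456 - x^11/42240 + x^13/599040" for x
  define r where "r = 1 / sqrt (2 * pi)"
  have y: "y > 0" using cut_const_bounds by (simp add: y_def)
  have P: "std_normal_density x \<le> r * P x" for x
  proof -
    have "exp (- (x\<^sup>2 / 2)) \<le> P x"
      using exp_minus_le_taylor6[of "x\<^sup>2 / 2"]
      by (simp add: P_def power_divide flip: power_mult)
    thus ?thesis by (simp add: std_normal_density_def r_def divide_right_mono)
  qed
  have cont: "isCont P x" for x unfolding P_def by (intro continuous_intros) auto
  have DF: "DERIV F x :> P x" for x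
    unfolding F_def P_def by (auto intro!: derivative_eq_intros simp: field_simps)
  have int: "(LINT t|lborel. P t * indicator {-y..y} t) = F y - F (-y)"
    by (rule integral_FTC_Icc_real) (use y DF cont in auto)
  have integrable: "integrable lborel (\<lambda>t. P t * indicator {-y..y} t)"
    by (rule has_bochner_integral_FTC_Icc_real[THEN integrable.intros]) (use y DF cont in auto)
  have "gauss_cdf y - gauss_cdf (-y) = (LINT t|lborel. std_normal_density t * indicator {-y<..y} t)"
    using y by (intro gauss_cdf_diff) simp
  also have "\<dots> \<le> (LINT t|lborel. r * (P t * indicator {-y..y} t))"
  proof (intro integral_mono integrable_std_normal_indicator integrable_mult_right integrable)
    fix t
    have "0 \<le> r * P t" using P[of t] normal_density_nonneg[of 0 1 t] by linarith
    thus "std_normal_density t * indicator {-y<..y} t \<le> r * (P t * indicator {-y..y} t)"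
      using P[of t] by (auto simp: indicator_def)
  qed auto
  also have "\<dots> = r * (F y - F (-y))" using int by simp
  also have "F (-y) = - F y" by (simp add: F_def)
  \<comment> \<open>By symmetry the mass of the interval is 2 Phi(y) - 1, and \<open>F\<close> is
    odd.\<close>
  finally have "gauss_cdf y \<le> 1 / 2 + r * F y" using gauss_cdf_uminus[of y] by simp
  also have "r * F y \<le> 44478 / 100000"
  proof -
    define q where "q = 1 / pi"
    have q: "0.318309 \<le> q" "q \<le> 0.31831" using inverse_pi_bounds by (simp_all add: q_def)
    have y2: "y\<^sup>2 = 8 * q" using cut_const_sq by (simp add: y_def q_def)
    \<comment> \<open>The square roots cancel: r y = 2/pi and y^2 = 8/pi, so the bound is a
      polynomial in 1/pi alone.\<close>
    have ry: "r * y = 2 * q"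
    proof -
      have "r * y = 2 * (sqrt 2 / sqrt pi) / (sqrt 2 * sqrt pi)"
        by (simp add: r_def y_def real_sqrt_divide real_sqrt_mult)
      also have "\<dots> = 2 / (sqrt pi * sqrt pi)" by (simp add: field_simps)
      finally show ?thesis by (simp add: q_def)
    qed
    have "F y = y * (1 - y\<^sup>2/6 + (y\<^sup>2)^2/40 - (y\<^sup>2)^3/336 + (y\<^sup>2)^4/3456 - (y\<^sup>2)^5/42240 + (y\<^sup>2)^6/599040)"
      by (simp add: F_def algebra_simps flip: power_mult power_Suc)
    hence "r * F y = 2 * q * (1 - (8*q)/6 + (8*q)^2/40 - (8*q)^3/336 + (8*q)^4/3456 - (8*q)^5/42240 + (8*q)^6/599040)"
      using ry y2 by (simp flip: mult.assoc)
    \<comment> \<open>The lower bound for 1/pi enters the negative terms, the upper bound the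
      positive ones.\<close>
    also have "\<dots> \<le> 2 * 0.31831 * (1 - (8*0.318309)/6 + (8*0.31831)^2/40 - (8*0.318309)^3/336
        + (8*0.31831)^4/3456 - (8*0.318309)^5/42240 + (8*0.31831)^6/599040)" (is "_ * ?a \<le> _ * ?b")
    proof (rule mult_mono)
      have "(8*0.318309)^3 \<le> (8*q)^3" "(8*0.318309)^5 \<le> (8*q)^5"
        "(8*q)^2 \<le> (8*0.31831)^2" "(8*q)^4 \<le> (8*0.31831)^4" "(8*q)^6 \<le> (8*0.31831)^6"
        using q by (intro power_mono; simp)+
      thus "?a \<le> ?b" using q by (intro add_mono diff_mono divide_right_mono) auto
      have "(8*q)^3 \<le> (2.55)^3" "(8*q)^5 \<le> (2.55)^5"
        using q by (intro power_mono; simp)+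
      hence "(8*q)^3 / 336 \<le> 1 / 4" "(8*q)^5 / 42240 \<le> 1 / 4" "8*q / 6 \<le> 1 / 2"
        using q by (simp_all add: power_divide)
      moreover have "0 \<le> (8*q)^2 / 40" "0 \<le> (8*q)^4 / 3456" "0 \<le> (8*q)^6 / 599040"
        using q by simp_all
      ultimately show "0 \<le> ?a" by argo
    qed (use q in auto)
    also have "\<dots> \<le> 44478 / 100000" by (simp add: power_divide)
    finally show ?thesis .
  qed
  finally show ?thesis by (simp add: y_def)
qed

lemma exp_two_over_pi: "exp (2 / pi) \<ge> 1.89"
proof -
  define x where "x = 2 / pi"
  have x: "0.636618 \<le> x" using inverse_pi_bounds by (simp add: x_def)
  obtain s where s: "exp (0.636618::real) = (\<Sum>m<8. 0.636618 ^ m / fact m) + exp s / fact 8 * 0.636618 ^ 8"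
    using Maclaurin_exp_le[of "0.636618" 8] by blast
  have "(1.89::real) \<le> (\<Sum>m<8. 0.636618 ^ m / fact m)"
    by (simp add: eval_nat_numeral)
  also have "\<dots> \<le> exp 0.636618" unfolding s by simp
  also have "\<dots> \<le> exp x" using x by simp
  finally show ?thesis by (simp add: x_def)
qed

section \<open>Exponents\<close>

text \<open>\<open>n\<close> times the binary entropy of s/n, in the homogeneous form that matches
  \<open>layer_rate\<close>.\<close>

definition ent :: "real \<Rightarrow> real \<Rightarrow> real" where
  "ent n s = xlnx n - xlnx s - xlnx (n - s)"

text \<open>One term of the binomial expansion of (p + (1 - p))^n = 1 at p = s/n.\<close>

lemma binomial_le_exp_ent:
  assumes "0 < s" "s < n"
  shows "real (n choose s) \<le> exp (ent (real n) (real s))"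
proof -
  let ?p = "real s / real n"
  have "real (n choose s) * (?p ^ s * (1 - ?p) ^ (n - s)) \<le> (\<Sum>k\<le>n. real (n choose k) * ?p ^ k * (1 - ?p) ^ (n - k))"
    using assms member_le_sum[of s "{..n}" "\<lambda>k. real (n choose k) * ?p ^ k * (1 - ?p) ^ (n - k)"]
    by (simp add: mult_ac)
  also have "\<dots> = (?p + (1 - ?p)) ^ n" by (rule binomial_ring[symmetric])
  finally have "real (n choose s) * (?p ^ s * (1 - ?p) ^ (n - s)) \<le> 1" by simp
  also have "?p ^ s * (1 - ?p) ^ (n - s) = exp (- ent (real n) (real s))"
    using assms by (subst powr_xlnx) (auto simp: ent_def)
  finally show ?thesis by (simp add: exp_minus field_simps)
qed

lemma ent_le_small:
  assumes "0 < s" "s < n"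
  shows "ent n s \<le> s * (1 + ln (n / s))"
proof -
  have "ln (n / (n - s)) \<le> n / (n - s) - 1" using assms by (intro ln_le_minus_one) auto
  hence "(n - s) * ln (n / (n - s)) \<le> (n - s) * (n / (n - s) - 1)" using assms by (intro mult_left_mono) auto
  also have "\<dots> = s" using assms by (simp add: field_simps)
  finally have "(n - s) * ln (n / (n - s)) \<le> s" .
  moreover have "ent n s = s * ln (n / s) + (n - s) * ln (n / (n - s))"
    using assms by (simp add: ent_def xlnx_def ln_div algebra_simps)
  ultimately show ?thesis by (simp add: algebra_simps)
qed

lemma bennett_symmetric_ge:
  assumes "0 \<le> t" "t < 1"
  shows "bennett t + bennett (-t) \<ge> t\<^sup>2"
proof -
  define f where "f x = bennett x + bennett (-x) - x\<^sup>2" for x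
  have "f 0 \<le> f t"
  proof (rule DERIV_nonneg_imp_nondecreasing[OF assms(1)])
    fix x assume x: "0 \<le> x" "x \<le> t"
    hence x1: "x < 1" using assms by simp
    have "(f has_real_derivative (ln (1 + x) - ln (1 - x) - 2 * x)) (at x)"
      unfolding f_def bennett_def using x x1 by (auto intro!: derivative_eq_intros)
    moreover have "ln (1 + x) - ln (1 - x) \<ge> 2 * x"
    proof -
      have "ln (1 + x) - ln (1 - x) = ln ((1 + x) / (1 - x))" using x x1 by (simp add: ln_div)
      also have "(1 + x) / (1 - x) = 1 + 2 * x / (1 - x)" using x1 by (simp add: field_simps)
      also have "ln \<dots> \<ge> 2 * (2 * x / (1 - x)) / (2 + 2 * x / (1 - x))"
        using x x1 by (intro ln_one_plus_ge) auto
      also have "2 + 2 * x / (1 - x) = 2 / (1 - x)" using x1 by (simp add: field_simps)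
      also have "2 * (2 * x / (1 - x)) / (2 / (1 - x)) = 2 * x" using x1 by simp
      finally show ?thesis by simp
    qed
    ultimately show "\<exists>y. (f has_real_derivative y) (at x) \<and> 0 \<le> y" by force
  qed
  thus ?thesis by (simp add: f_def bennett_def)
qed

text \<open>Pinsker's inequality against the fair coin: H(1/2 - x) \<le> ln 2 - 2 x^2. This
  quadratic gain pays for the larger normalised threshold of unbalanced sets in
  \<open>gauss_cdf_exponent\<close>.\<close>

lemma ent_le_quadratic:
  assumes "0 < s" "2 * s \<le> n"
  shows "ent n s \<le> n * (ln 2 - 2 * (1 / 2 - s / n)\<^sup>2)"
proof -
  define t where "t = 1 - 2 * s / n"
  have n: "n > 0" using assms by simp
  have t: "0 \<le> t" "t < 1" using assms n by (auto simp: t_def field_simps)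
  have s: "s = n / 2 * (1 + - t)" "n - s = n / 2 * (1 + t)" using n by (auto simp: t_def field_simps)
  have a: "xlnx s = n / 2 * (1 - t) * ln (n / 2) + n / 2 * (bennett (-t) - t)"
    using xlnx_bennett[of "n / 2" "-t"] n t by (subst s(1)) simp
  have b: "xlnx (n - s) = n / 2 * (1 + t) * ln (n / 2) + n / 2 * (bennett t + t)"
    using xlnx_bennett[of "n / 2" t] n t by (subst s(2)) simp
  have "ent n s = n * ln n - n * ln (n / 2) - n / 2 * (bennett t + bennett (-t))"
    unfolding ent_def a b by (simp add: xlnx_def field_simps)
  also have "\<dots> = n * ln 2 - n / 2 * (bennett t + bennett (-t))"
    using n by (simp add: ln_div algebra_simps)
  also have "\<dots> \<le> n * ln 2 - n / 2 * t\<^sup>2"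
    using bennett_symmetric_ge[OF t] n by simp
  also have "\<dots> = n * (ln 2 - 2 * (1 / 2 - s / n)\<^sup>2)"
    using n by (simp add: t_def field_simps power2_eq_square)
  finally show ?thesis .
qed

lemma quadratic_ratio_mono:
  fixes u w k :: real
  assumes "0 \<le> u" "u \<le> w" "k \<ge> 0"
  shows "u\<^sup>2 / (2 + k * u) \<le> w\<^sup>2 / (2 + k * w)"
proof -
  have pos: "2 + k * u > 0" "2 + k * w > 0" using assms by (simp_all add: add_pos_nonneg)
  have "u\<^sup>2 \<le> w\<^sup>2" using assms by (intro power_mono) auto
  moreover have "(k * u * w) * u \<le> (k * u * w) * w" using assms by (intro mult_left_mono) auto
  ultimately have "u\<^sup>2 * (2 + k * w) \<le> w\<^sup>2 * (2 + k * u)"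
    by (simp add: algebra_simps power2_eq_square)
  thus ?thesis using pos by (simp add: frac_le_eq divide_le_eq field_simps)
qed

text \<open>With w = |\<delta>| sqrt d the bound of \<open>layer_rate_ge_quadratic\<close> is
  increasing in w, so any smaller \<open>u\<close> may be substituted. For \<open>u\<close> of
  constant size the correction n u / (s sqrt d) is negligible when s sqrt d is large against
  n.\<close>

lemma mean_rate_ge:
  fixes n s c :: real and d :: nat
  assumes s: "0 < s" "2 * s \<le> n" and c: "0 \<le> c" "c \<le> s" and d: "d > 0"
  defines "\<delta> \<equiv> c * n / (s * (n - s)) - 1"
  assumes u: "0 \<le> u" "u \<le> \<bar>\<delta>\<bar> * sqrt (real d)"
  shows "real d * layer_rate n s c \<ge> n / 2 * (u\<^sup>2 / (2 + n / (s * sqrt (real d)) * u))"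
proof -
  define w where "w = \<bar>\<delta>\<bar> * sqrt (real d)"
  have w: "w\<^sup>2 = real d * \<delta>\<^sup>2" by (simp add: w_def power_mult_distrib)
  have "n / (s * sqrt (real d)) * w = \<bar>\<delta>\<bar> * n / s" using d by (simp add: w_def)
  hence "real d * (n / 2 * (\<delta>\<^sup>2 / (2 + \<bar>\<delta>\<bar> * n / s))) = n / 2 * (w\<^sup>2 / (2 + n / (s * sqrt (real d)) * w))"
    by (simp add: w)
  moreover have "real d * layer_rate n s c \<ge> real d * (n / 2 * (\<delta>\<^sup>2 / (2 + \<bar>\<delta>\<bar> * n / s)))"
    unfolding \<delta>_def using s c by (intro mult_left_mono layer_rate_ge_quadratic) auto
  moreover have "n / 2 * (u\<^sup>2 / (2 + n / (s * sqrt (real d)) * u)) \<le> n / 2 * (w\<^sup>2 / (2 + n / (s * sqrt (real d)) * w))"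
    using u s by (intro mult_left_mono quadratic_ratio_mono) (auto simp: w_def)
  ultimately show ?thesis by linarith
qed

text \<open>For s \<le> n/d the correction in \<open>mean_rate_ge\<close> dominates and the Gaussian
  bound is lost. Here c \<le> s leaves only \<delta> < 0, that is, too many edges inside the set. So
  few of them are expected that their relative excess t is large, and \<open>bennett t\<close>, of
  order t ln t, yields at least 3/32 sqrt d s ln (n/s), against an entropy of at most s (1 + ln
  (n/s)).\<close>

lemma tiny_set_rate:
  fixes n s c :: real and d :: nat
  assumes s: "0 < s" "s * real d \<le> n" and c: "0 \<le> c" "c \<le> s" and d: "d \<ge> 2000"
  defines "\<delta> \<equiv> c * n / (s * (n - s)) - 1"
  assumes \<delta>: "3 / 2 \<le> \<bar>\<delta>\<bar> * sqrt (real d)"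
  shows "ent n s - real d * layer_rate n s c \<le> - s"
proof -
  have "s * 2 \<le> s * real d" using s d by (intro mult_left_mono) auto
  hence n: "2 * s \<le> n" "s < n" "c \<le> n - s" "n > 0" using s c by linarith+
  have rd: "sqrt (real d) \<ge> 32"
  proof -
    have "(32::real)\<^sup>2 \<le> real d" using d by simp
    thus ?thesis by (rule real_le_rsqrt)
  qed
  have rr: "real d = sqrt (real d) * sqrt (real d)" by simp
  note eq = layer_rate_eq[OF s(1) n(2) c n(3), folded \<delta>_def]
  \<comment> \<open>A positive deviation is at most s / (n - s) \<le> 2 / d, too small for the
    hypothesis.\<close>
  have neg: "\<delta> < 0"
  proof (rule ccontr)
    assume "\<not> \<delta> < 0"
    have "c * n \<le> s * n" using c n by (intro mult_right_mono) auto
    hence "c * n / (s * (n - s)) \<le> s * n / (s * (n - s))" using s n by (intro divide_right_mono) auto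
    also have "\<dots> = 1 + s / (n - s)" using s n by (simp add: field_simps)
    finally have "\<delta> \<le> s / (n - s)" by (simp add: \<delta>_def)
    also have "\<dots> \<le> s / (n / 2)" using s n by (intro divide_left_mono) auto
    also have "\<dots> \<le> 2 / real d" using s n d by (simp add: field_simps)
    finally have "\<bar>\<delta>\<bar> * sqrt (real d) \<le> 2 / real d * sqrt (real d)"
      using \<open>\<not> \<delta> < 0\<close> by (intro mult_right_mono) auto
    also have "\<dots> = 2 / sqrt (real d)" using d by (simp add: real_div_sqrt field_simps)
    also have "\<dots> \<le> 2 / 32" using rd d by (intro divide_left_mono) auto
    finally show False using \<delta> by simp
  qed
  define \<Lambda> where "\<Lambda> = ln (n / s)"
  have ld: "ln (real d) \<le> \<Lambda>" unfolding \<Lambda>_def using s d n by (subst ln_le_cancel_iff) (auto simp: field_simps)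
  \<comment> \<open>Prepares \<Lambda> \<ge> 16/3, the value from which on \<Lambda>/2 - 1/3 - 1
    \<ge> \<Lambda>/4.\<close>
  have "exp (16/3::real) \<le> 2000"
  proof -
    have "exp (16/3::real) \<le> exp (real 6)" by simp
    also have "\<dots> = exp 1 ^ 6" by (subst exp_of_nat_mult[symmetric]) simp
    also have "exp 1 ^ 6 \<le> (2.8::real) ^ 6" using e_less_272 by (intro power_mono) auto
    finally show ?thesis by (simp add: power_divide)
  qed
  also have "2000 \<le> real d" using d by simp
  finally have "ln (exp (16/3)) \<le> ln (real d)" using d by (subst ln_le_cancel_iff) auto
  hence L: "\<Lambda> \<ge> 16 / 3" using ld by simp
  define t where "t = - (n - s) * \<delta> / s"
  \<comment> \<open>A lower bound for \<open>t\<close>, from n - s \<ge> n/2 and |\<delta>| \<ge>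
    3/2 / sqrt d. Since sqrt d \<le> sqrt (n/s), it is at least 3/4 sqrt (n/s), so ln t0 \<ge> ln
    (3/4) + \<Lambda>/2.\<close>
  define t0 where "t0 = 3 / 4 * (n / s) / sqrt (real d)"
  have t0pos: "t0 > 0" using s n d by (simp add: t0_def)
  have ad: "\<bar>\<delta>\<bar> = - \<delta>" using neg by simp
  have \<delta>': "3 / 2 / sqrt (real d) \<le> - \<delta>" using \<delta> d ad by (simp add: field_simps)
  have tt: "t0 \<le> t"
  proof -
    have "t0 = (n / 2) / s * (3 / 2 / sqrt (real d))" by (simp add: t0_def)
    also have "\<dots> \<le> (n - s) / s * (- \<delta>)"
      using s n \<delta>' by (intro mult_mono divide_right_mono) auto
    also have "\<dots> = t" by (simp only: t_def minus_mult_minus mult_minus_left mult_minus_right times_divide_eq_left minus_divide_left)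
    finally show ?thesis .
  qed
  have "ln t0 = ln (3 / 4) + ln (n / s) - ln (sqrt (real d))"
  proof -
    have "ln (3 / 4 * (n / s)) = ln (3 / 4) + ln (n / s)" using s n by (subst ln_mult) auto
    moreover have "ln t0 = ln (3 / 4 * (n / s)) - ln (sqrt (real d))"
      unfolding t0_def using s n d by (subst ln_div) auto
    ultimately show ?thesis by simp
  qed
  also have "ln (sqrt (real d)) = ln (real d) / 2" using d by (simp add: ln_sqrt)
  finally have "ln t0 \<ge> ln (3/4) + \<Lambda> - \<Lambda> / 2" using ld by (simp add: \<Lambda>_def)
  moreover have "ln (3/4::real) \<ge> - 1 / 3"
    using ln_le_minus_one[of "4/3::real"] by (simp add: ln_div)
  ultimately have lt0: "ln t0 - 1 \<ge> \<Lambda> / 4" using L by linarith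
  have tpos: "t > 0" using tt t0pos by simp
  have "bennett t = t * (ln (1 + t) - 1) + ln (1 + t)" by (simp add: bennett_def algebra_simps)
  also have "\<dots> \<ge> t * (ln t0 - 1)"
  proof -
    have "ln t0 \<le> ln (1 + t)" using tt t0pos by simp
    hence "t * (ln t0 - 1) \<le> t * (ln (1 + t) - 1)" using tpos by (intro mult_left_mono) auto
    thus ?thesis using tpos by (simp add: add_increasing2)
  qed
  finally have bt: "bennett t \<ge> t * (\<Lambda> / 4)" using mult_left_mono[OF lt0, of t] tpos by linarith
  have "layer_rate n s c \<ge> s\<^sup>2 / (2 * n) * bennett t"
    unfolding eq(1) t_def using bennett_nonneg[OF eq(2)] bennett_nonneg[OF eq(4)] s n by simp
  moreover have "s\<^sup>2 / (2 * n) * bennett t \<ge> s\<^sup>2 / (2 * n) * (t * (\<Lambda> / 4))"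
    using bt n by (intro mult_left_mono) auto
  moreover have "s\<^sup>2 / (2 * n) * t \<ge> 3 / 8 * s / sqrt (real d)"
  proof -
    have "s\<^sup>2 / (2 * n) * t0 = 3 / 8 * s / sqrt (real d)"
      using s n by (simp add: t0_def field_simps power2_eq_square)
    thus ?thesis using mult_left_mono[OF tt, of "s\<^sup>2 / (2 * n)"] n by simp
  qed
  ultimately have "layer_rate n s c \<ge> 3 / 8 * s / sqrt (real d) * (\<Lambda> / 4)"
    using mult_right_mono[of "3 / 8 * s / sqrt (real d)" "s\<^sup>2 / (2 * n) * t" "\<Lambda> / 4"] L by (simp add: mult_ac)
  hence "real d * layer_rate n s c \<ge> real d * (3 / 8 * s / sqrt (real d) * (\<Lambda> / 4))"
    by (intro mult_left_mono) auto
  also have "real d * (3 / 8 * s / sqrt (real d) * (\<Lambda> / 4)) = 3 / 32 * sqrt (real d) * (s * \<Lambda>)"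
    using d by (subst rr) (simp add: field_simps)
  finally have "real d * layer_rate n s c \<ge> 3 / 32 * sqrt (real d) * (s * \<Lambda>)" .
  moreover have "3 / 32 * sqrt (real d) * (s * \<Lambda>) \<ge> 3 * (s * \<Lambda>)"
    using rd s L by (intro mult_right_mono) auto
  moreover have "ent n s \<le> s + s * \<Lambda>" using ent_le_small[OF s(1) n(2)] by (simp add: \<Lambda>_def algebra_simps)
  moreover have "s * \<Lambda> \<ge> s * 1" using s L by (intro mult_left_mono) auto
  ultimately show ?thesis by linarith
qed

text \<open>The range where the entropy is beaten without local optimality. Above 3n/10, w \<ge>
  17/10 gives w^2/4 = 0.7225 > ln 2. Below, the entropy per vertex is at most ln 2 - 2/25 < 0.62,
  less than 2/pi; for \<open>s\<close> much smaller than \<open>n\<close> the loss in the Gaussian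
  rate is weighed against an entropy of order s ln (n/s).\<close>

lemma first_moment_exponent:
  "\<exists>d0\<ge>1. \<forall>d\<ge>d0. \<forall>n s c :: real. 0 < s \<and> 2 * s \<le> n \<and> 0 \<le> c \<and> c \<le> s \<and>
     cut_const \<le> \<bar>c * n / (s * (n - s)) - 1\<bar> * sqrt (real d) \<and>
     (10 * s \<le> 3 * n \<or> 17 / 10 \<le> \<bar>c * n / (s * (n - s)) - 1\<bar> * sqrt (real d))
     \<longrightarrow> ent n s - real d * layer_rate n s c \<le> - s / 100"
proof -
  have "\<forall>\<^sub>F d in at_top. (1 + ln (real d)) * (2 / real d powr (1/4) + 16 / 10 / sqrt (real d)) \<le> 1 / 2"
    by real_asymp
  moreover have "\<forall>\<^sub>F d in at_top. 16 / 10 / real d powr (1/4) \<le> 1 / 100" by real_asymp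
  moreover have "\<forall>\<^sub>F d in at_top. 17 / 3 / sqrt (real d) \<le> 1 / 100" by real_asymp
  moreover have "\<forall>\<^sub>F d in at_top. d \<ge> (2000 :: nat)" by (rule eventually_ge_at_top)
  ultimately have "\<forall>\<^sub>F d in at_top. d \<ge> (2000 :: nat) \<and> 17 / 3 / sqrt (real d) \<le> 1 / 100 \<and>
    16 / 10 / real d powr (1/4) \<le> 1 / 100 \<and>
    (1 + ln (real d)) * (2 / real d powr (1/4) + 16 / 10 / sqrt (real d)) \<le> 1 / 2"
    by eventually_elim simp
  then obtain d0 where d0: "\<And>d. d \<ge> d0 \<Longrightarrow> d \<ge> (2000 :: nat) \<and> 17 / 3 / sqrt (real d) \<le> 1 / 100 \<and>
    16 / 10 / real d powr (1/4) \<le> 1 / 100 \<and>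
    (1 + ln (real d)) * (2 / real d powr (1/4) + 16 / 10 / sqrt (real d)) \<le> 1 / 2"
    by (auto simp: eventually_at_top_linorder)
  show ?thesis
  proof (rule exI[of _ "max 1 d0"], intro conjI allI impI)
    fix d :: nat and n s c :: real
    assume "max 1 d0 \<le> d"
    hence d: "d \<ge> 2000" "17 / 3 / sqrt (real d) \<le> 1 / 100"
      "16 / 10 / real d powr (1/4) \<le> 1 / 100"
      "(1 + ln (real d)) * (2 / real d powr (1/4) + 16 / 10 / sqrt (real d)) \<le> 1 / 2"
      using d0[of d] by auto
    define \<delta> where "\<delta> = c * n / (s * (n - s)) - 1"
    assume "0 < s \<and> 2 * s \<le> n \<and> 0 \<le> c \<and> c \<le> s \<and>
     cut_const \<le> \<bar>c * n / (s * (n - s)) - 1\<bar> * sqrt (real d) \<and>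
     (10 * s \<le> 3 * n \<or> 17 / 10 \<le> \<bar>c * n / (s * (n - s)) - 1\<bar> * sqrt (real d))"
    hence s: "0 < s" "2 * s \<le> n" and c: "0 \<le> c" "c \<le> s" and
      w: "cut_const \<le> \<bar>\<delta>\<bar> * sqrt (real d)" and
      w': "10 * s \<le> 3 * n \<or> 17 / 10 \<le> \<bar>\<delta>\<bar> * sqrt (real d)" by (auto simp: \<delta>_def)
    have n: "n > 0" "s < n" using s by auto
    have sd: "sqrt (real d) > 0" using d by simp
    \<comment> \<open>The scale d^(1/4) separates two regimes: for s \<ge> n/q the correction is at
      most 1.6/q and negligible; for n/d < s < n/q the rate divided by \<open>s\<close> is at least
      1.27/X with X at most of order d^(-1/4), which beats 1 + ln d.\<close>
    define q where "q = real d powr (1/4)"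
    have q: "q > 0" "q * q = sqrt (real d)"
      using d by (auto simp: q_def powr_half_sqrt simp flip: powr_add)
    note R = mean_rate_ge[OF s c, of d, folded \<delta>_def]
    have ln2: "ln 2 \<le> (25 / 36 :: real)" by (rule ln2_le_25_over_36)
    have cc: "cut_const\<^sup>2 \<ge> 254 / 100" "cut_const \<ge> 0" "cut_const \<le> 16 / 10"
      using cut_const_bounds cut_const_sq pi_approx by (auto simp: field_simps)
    define k where "k = n / (s * sqrt (real d))"
    have kpos: "k > 0" using s n sd by (simp add: k_def)
    have R0: "real d * layer_rate n s c \<ge> n / 2 * (254 / 100 / (2 + k * (16 / 10)))"
    proof -
      have "254 / 100 / (2 + k * (16/10)) \<le> cut_const\<^sup>2 / (2 + k * cut_const)"
        using cc kpos by (intro frac_le add_left_mono mult_left_mono) (auto intro!: add_pos_nonneg)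
      thus ?thesis using R[of cut_const] w cc(2) d mult_left_mono[of _ _ "n / 2"] n
        by (fastforce simp: k_def)
    qed
    show "ent n s - real d * layer_rate n s c \<le> - s / 100"
    proof (cases "10 * s \<le> 3 * n")
      case False
      hence "17 / 10 \<le> \<bar>\<delta>\<bar> * sqrt (real d)" using w' by simp
      hence 1: "real d * layer_rate n s c \<ge> n / 2 * ((17/10)\<^sup>2 / (2 + k * (17/10)))"
        using R[of "17/10"] d by (simp add: k_def)
      have "n / s \<le> 10 / 3" using False s by (simp add: field_simps)
      hence "k * (17/10) \<le> (10 / 3) / sqrt (real d) * (17/10)"
        unfolding k_def using sd by (intro mult_right_mono) (auto simp: divide_simps mult_ac)
      also have "\<dots> \<le> 1 / 100" using d(2) by simp
      finally have "(17/10)\<^sup>2 / (2 + k * (17/10)) \<ge> (17/10)\<^sup>2 / (2 + 1/100)"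
        using kpos by (intro divide_left_mono) (auto intro!: mult_pos_pos add_pos_nonneg)
      hence "n / 2 * ((17/10)\<^sup>2 / (2 + k * (17/10))) \<ge> n / 2 * ((17/10)\<^sup>2 / (2 + 1/100))"
        using n by (intro mult_left_mono) auto
      hence 2: "real d * layer_rate n s c \<ge> 718 / 1000 * n" using 1 n by (simp add: power2_eq_square)
      have "ent n s \<le> n * (ln 2 - 2 * (1 / 2 - s / n)\<^sup>2)" by (rule ent_le_quadratic[OF s])
      also have "ln 2 - 2 * (1 / 2 - s / n)\<^sup>2 \<le> 25 / 36"
        using ln2 zero_le_power2[of "1 / 2 - s / n"] by linarith
      finally have "ent n s \<le> n * (25 / 36)" using n by (simp add: mult_left_mono)
      thus ?thesis using 2 s n by linarith
    next
      case small: True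
      show ?thesis
      proof (cases "n \<le> q * s")
        case True
        have "k * (16/10) \<le> (q / sqrt (real d)) * (16/10)"
          unfolding k_def using True sd s by (intro mult_right_mono) (auto simp: field_simps)
        also have "q / sqrt (real d) = 1 / q" using q by (simp flip: q(2))
        also have "1 / q * (16/10) \<le> 1 / 100" using d(3) by (simp add: q_def)
        finally have "254 / 100 / (2 + k * (16/10)) \<ge> 254 / 100 / (2 + 1/100)"
          using kpos by (intro divide_left_mono) (auto intro!: mult_pos_pos add_pos_nonneg)
        hence "n / 2 * (254 / 100 / (2 + k * (16/10))) \<ge> n / 2 * (254 / 100 / (2 + 1/100))"
          using n by (intro mult_left_mono) auto
        hence 2: "real d * layer_rate n s c \<ge> 63 / 100 * n" using R0 n by simp
        \<comment> \<open>The reason for the threshold 3/10: 2 (1/5)^2 = 0.08 brings ln 2 below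
          0.62, while the rate is at least 0.63.\<close>
        have "s / n \<le> 3 / 10" using small n by (simp add: field_simps)
        hence "(1 / 2 - s / n)\<^sup>2 \<ge> (1 / 5)\<^sup>2" by (intro power_mono) auto
        hence "ln 2 - 2 * (1 / 2 - s / n)\<^sup>2 \<le> 62 / 100" using ln2 by (simp add: power2_eq_square)
        hence "n * (ln 2 - 2 * (1 / 2 - s / n)\<^sup>2) \<le> n * (62 / 100)" using n by (intro mult_left_mono) auto
        hence "ent n s \<le> n * (62 / 100)" using ent_le_quadratic[OF s] by linarith
        thus ?thesis using 2 s n by linarith
      next
        case nq: False
        show ?thesis
        proof (cases "s * real d \<le> n")
          case True
          have "3 / 2 \<le> \<bar>\<delta>\<bar> * sqrt (real d)" using w cut_const_bounds by linarith
          hence "ent n s - real d * layer_rate n s c \<le> - s"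
            using tiny_set_rate[OF s(1) True c d(1)] by (simp add: \<delta>_def)
          thus ?thesis using s by linarith
        next
          case False
          define X where "X = 2 * (s / n) + 16 / 10 / sqrt (real d)"
          have X: "X > 0" using s n sd by (auto simp: X_def intro!: add_pos_pos)
          have "s / n \<le> 1 / q" using nq q n by (simp add: field_simps)
          hence Xle: "X \<le> 2 / q + 16 / 10 / sqrt (real d)" by (simp add: X_def)
          have lpos: "1 + ln (real d) > 0" using d by (simp add: add_pos_nonneg)
          have "(1 + ln (real d)) * X \<le> (1 + ln (real d)) * (2 / q + 16 / 10 / sqrt (real d))"
            using Xle lpos by (intro mult_left_mono) auto
          also have "\<dots> \<le> 1 / 2" using d(4) by (simp add: q_def)
          finally have lX: "(1 + ln (real d)) \<le> 1 / 2 / X" using X by (simp add: field_simps)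
          have "n / 2 * (254 / 100 / (2 + k * (16 / 10))) = s * (127 / 100 / X)"
          proof -
            have "2 + k * (16/10) = X * n / s" using s n sd by (simp add: k_def X_def field_simps)
            hence "n / 2 * (254 / 100 / (2 + k * (16/10))) = n / 2 * (254 / 100 / (X * n / s))" by (simp only:)
            thus ?thesis using s n X by (simp add: field_simps)
          qed
          hence 2: "real d * layer_rate n s c \<ge> s * (127 / 100 / X)" using R0 by simp
          have "ln (n / s) \<le> ln (real d)"
            using s n d False by (subst ln_le_cancel_iff) (auto simp: field_simps)
          hence "s * (1 + ln (n / s)) \<le> s * (1 + ln (real d))" using s by (intro mult_left_mono) auto
          hence 3: "ent n s \<le> s * (1 + ln (real d))" using ent_le_small[OF s(1) n(2)] by linarith
          have "127 / 100 / X \<ge> 2 * (1 + ln (real d))" using lX X by (simp add: field_simps)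
          hence "s * (127 / 100 / X) \<ge> s * (2 * (1 + ln (real d)))" using s by (intro mult_left_mono) auto
          moreover have "s * (1 + ln (real d)) \<ge> s * 1" using s d by (intro mult_left_mono) auto
          ultimately show ?thesis using 2 3 s by linarith
        qed
      qed
    qed
  qed simp
qed


section \<open>Probability of local optimality at a single vertex\<close>

lemma bern_sum_CLT_uniform:
  assumes e: "\<epsilon> > 0"
  shows "\<exists>V>0. \<forall>d p. (\<forall>k<d. 0 \<le> p k \<and> p k \<le> 1) \<and> bern_var d p \<ge> V \<longrightarrow>
     (\<forall>x\<in>{-3..3}. \<bar>measure_pmf.prob (bern d p) {\<omega>. bern_sum d p \<omega> \<le> x * sqrt (bern_var d p)} - gauss_cdf x\<bar> \<le> \<epsilon>)"
proof -
  \<comment> \<open>A grid of step \<epsilon> from -3 on: monotonicity of the distribution function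
    and the Lipschitz constant 2/5 of Phi carry the bound \<epsilon>/2 from the grid points to every
    x, as 1/2 + 2/5 \<le> 1.\<close>
  define g where "g i = -3 + real i * \<epsilon>" for i :: nat
  have "\<forall>i. \<exists>V>0. \<forall>d p. (\<forall>k<d. 0 \<le> p k \<and> p k \<le> 1) \<and> bern_var d p \<ge> V \<longrightarrow>
     \<bar>measure_pmf.prob (bern d p) {\<omega>. bern_sum d p \<omega> \<le> g i * sqrt (bern_var d p)} - gauss_cdf (g i)\<bar> \<le> \<epsilon> / 2"
    using bern_sum_CLT[of "\<epsilon> / 2"] e by simp
  then obtain V where V: "\<And>i. V i > 0" "\<And>i d p. (\<forall>k<d. 0 \<le> p k \<and> p k \<le> 1) \<Longrightarrow> bern_var d p \<ge> V i \<Longrightarrow>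
     \<bar>measure_pmf.prob (bern d p) {\<omega>. bern_sum d p \<omega> \<le> g i * sqrt (bern_var d p)} - gauss_cdf (g i)\<bar> \<le> \<epsilon> / 2"
    by metis
  define N where "N = nat \<lceil>6 / \<epsilon>\<rceil> + 1"
  define W where "W = Max (V ` {..N})"
  have W: "V i \<le> W" if "i \<le> N" for i using that by (auto simp: W_def)
  have "W > 0" using W[of 0] V(1)[of 0] by simp
  moreover have "\<bar>measure_pmf.prob (bern d p) {\<omega>. bern_sum d p \<omega> \<le> x * sqrt (bern_var d p)} - gauss_cdf x\<bar> \<le> \<epsilon>"
    if p: "\<forall>k<d. 0 \<le> p k \<and> p k \<le> 1" and v: "bern_var d p \<ge> W" and x: "x \<in> {-3..3}" for d p x
  proof -
    define F where "F y = measure_pmf.prob (bern d p) {\<omega>. bern_sum d p \<omega> \<le> y * sqrt (bern_var d p)}" for y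
    have mono: "F y \<le> F z" if "y \<le> z" for y z
      unfolding F_def
    proof (rule measure_pmf.finite_measure_mono)
      have "y * sqrt (bern_var d p) \<le> z * sqrt (bern_var d p)"
        using that v \<open>W > 0\<close> by (intro mult_right_mono) auto
      thus "{\<omega>. bern_sum d p \<omega> \<le> y * sqrt (bern_var d p)} \<subseteq> {\<omega>. bern_sum d p \<omega> \<le> z * sqrt (bern_var d p)}"
        by auto
    qed simp
    define i where "i = nat \<lfloor>(x + 3) / \<epsilon>\<rfloor>"
    have "real i \<le> (x + 3) / \<epsilon>" "(x + 3) / \<epsilon> \<le> real i + 1"
      using x e by (auto simp: i_def)
    hence gi: "g i \<le> x" "x \<le> g (Suc i)" "g (Suc i) = g i + \<epsilon>"
      using e by (auto simp: g_def field_simps)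
    have "(x + 3) / \<epsilon> \<le> 6 / \<epsilon>" using x e by (intro divide_right_mono) auto
    hence "i \<le> nat \<lceil>6 / \<epsilon>\<rceil>" unfolding i_def
      by (intro nat_mono) linarith
    hence iN: "i \<le> N" "Suc i \<le> N" by (auto simp: N_def)
    have F1: "\<bar>F (g i) - gauss_cdf (g i)\<bar> \<le> \<epsilon> / 2" "\<bar>F (g (Suc i)) - gauss_cdf (g (Suc i))\<bar> \<le> \<epsilon> / 2"
      unfolding F_def using W[OF iN(1)] W[OF iN(2)] v V(2)[OF p, of i] V(2)[OF p, of "Suc i"] by linarith+
    have "gauss_cdf (g (Suc i)) - gauss_cdf x \<le> 2 / 5 * (g (Suc i) - x)" "gauss_cdf x - gauss_cdf (g i) \<le> 2 / 5 * (x - g i)"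
      by (rule gauss_cdf_lipschitz, use gi in simp)+
    moreover have "F (g (Suc i)) - gauss_cdf (g (Suc i)) \<le> \<epsilon> / 2" "gauss_cdf (g i) - F (g i) \<le> \<epsilon> / 2"
      using F1 by (simp_all only: abs_le_iff minus_diff_eq)
    moreover have "g (Suc i) - x \<le> \<epsilon>" "x - g i \<le> \<epsilon>" using gi by linarith+
    ultimately have "F x - gauss_cdf x \<le> \<epsilon>" "gauss_cdf x - F x \<le> \<epsilon>"
      using mono[OF gi(1)] mono[OF gi(2)] e by argo+
    hence "\<bar>F x - gauss_cdf x\<bar> \<le> \<epsilon>" by linarith
    thus ?thesis by (simp add: F_def)
  qed
  ultimately show ?thesis by blast
qed

text \<open>\<open>D\<close> stands for the set of matchings that cut the edge at a given vertex and
  \<mu> for its expected size; \<open>sg\<close> selects too large or too small cuts.\<close>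

definition local_sets :: "real \<Rightarrow> real \<Rightarrow> real \<Rightarrow> nat set set" where
  "local_sets sg \<mu> W = {D. sg * (real (card D) - \<mu>) \<ge> - W}"

text \<open>Both signs give the same bound because Phi(-y) = 1 - Phi(y). The strict inequality for
  \<open>W\<close> makes the closed event for sg = 1 disjoint from the closed event to which the
  central limit theorem is applied.\<close>

lemma bern_local_le:
  assumes e: "\<epsilon> > 0"
  shows "\<exists>V>0. \<forall>d p sg W y. (\<forall>k<d. 0 \<le> p k \<and> p k \<le> 1) \<and> bern_var d p \<ge> V \<and> (sg = 1 \<or> sg = -1) \<and>
     0 \<le> y \<and> y \<le> 3 \<and> W < y * sqrt (bern_var d p)
      \<longrightarrow> bern_set_prob d p (local_sets sg (\<Sum>k<d. p k) W) \<le> gauss_cdf y + \<epsilon>"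
proof -
  obtain V where V: "V > 0" "\<And>d p x. (\<forall>k<d. 0 \<le> p k \<and> p k \<le> 1) \<Longrightarrow> bern_var d p \<ge> V \<Longrightarrow> x \<in> {-3..3} \<Longrightarrow>
     \<bar>measure_pmf.prob (bern d p) {\<omega>. bern_sum d p \<omega> \<le> x * sqrt (bern_var d p)} - gauss_cdf x\<bar> \<le> \<epsilon>"
    using bern_sum_CLT_uniform[OF e] by metis
  have "bern_set_prob d p (local_sets sg (\<Sum>k<d. p k) W) \<le> gauss_cdf y + \<epsilon>"
    if p: "\<forall>k<d. 0 \<le> p k \<and> p k \<le> 1" and v: "bern_var d p \<ge> V" and sg: "sg = 1 \<or> sg = -1"
      and y: "0 \<le> y" "y \<le> 3" "W < y * sqrt (bern_var d p)" for d p sg W y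
  proof -
    let ?P = "measure_pmf.prob (bern d p)"
    have "bern_set_prob d p (local_sets sg (\<Sum>k<d. p k) W) = ?P {\<omega>. sg * bern_sum d p \<omega> \<ge> - W}"
      using p by (subst bern_set_prob_eq) (auto simp: local_sets_def bern_sum_eq)
    also have "\<dots> \<le> gauss_cdf y + \<epsilon>"
    proof (cases "sg = 1")
      case True
      have "?P {\<omega>. sg * bern_sum d p \<omega> \<ge> - W} \<le> ?P (UNIV - {\<omega>. bern_sum d p \<omega> \<le> -y * sqrt (bern_var d p)})"
        using y True by (intro measure_pmf.finite_measure_mono) auto
      also have "\<dots> = 1 - ?P {\<omega>. bern_sum d p \<omega> \<le> -y * sqrt (bern_var d p)}"
        using measure_pmf.prob_compl[of "{\<omega>. bern_sum d p \<omega> \<le> -y * sqrt (bern_var d p)}" "bern d p"] by simp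
      also have "\<dots> \<le> 1 - gauss_cdf (-y) + \<epsilon>"
        using V(2)[OF p v, of "-y"] y by auto
      also have "\<dots> = gauss_cdf y + \<epsilon>" using gauss_cdf_uminus[of y] by simp
      finally show ?thesis .
    next
      case False
      hence "?P {\<omega>. sg * bern_sum d p \<omega> \<ge> - W} \<le> ?P {\<omega>. bern_sum d p \<omega> \<le> y * sqrt (bern_var d p)}"
        using y sg by (intro measure_pmf.finite_measure_mono) auto
      also have "\<dots> \<le> gauss_cdf y + \<epsilon>" using V(2)[OF p v, of y] y by auto
      finally show ?thesis .
    qed
    finally show ?thesis .
  qed
  thus ?thesis using V(1) by blast
qed

lemma bern_set_prob_bounds:
  assumes "\<And>k. k < d \<Longrightarrow> 0 \<le> p k \<and> p k \<le> 1"
  shows "0 \<le> bern_set_prob d p \<R>" "bern_set_prob d p \<R> \<le> 1"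
  using bern_set_prob_eq[OF assms, where \<R> = \<R>] by auto

text \<open>With \<open>x = 1/2 - |S|/n\<close> and \<open>w = |\<delta>| \<surd>d\<close>, this is the inequality
  \<open>H(|S|/n) - w\<^sup>2/4 + ln \<Phi>(y) < 0\<close>. At \<open>x = 0\<close> and \<open>w = y = 2 \<surd>(2/\<pi>)\<close> it reads
  \<open>2 \<Phi>(2 \<surd>(2/\<pi>)) < exp (2/\<pi>)\<close>, where the two sides are 1.8895 and 1.8901.\<close>

lemma gauss_cdf_exponent:
  fixes w x y e :: real
  assumes w: "cut_const \<le> w" and e: "0 \<le> e" "e \<le> 1 / 10000"
    and y: "y \<le> cut_const + (w - cut_const) + 408 / 100 * x\<^sup>2 + e"
  shows "2 * (gauss_cdf y + e) \<le> exp (w\<^sup>2 / 4 + 2 * x\<^sup>2 - 1 / 50000)"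
proof -
  define u where "u = w - cut_const"
  have u: "u \<ge> 0" using w by (simp add: u_def)
  define Z where "Z = u + 408 / 100 * x\<^sup>2 + e"
  have "gauss_cdf y \<le> gauss_cdf (cut_const + Z)"
    using y by (intro gauss_cdf_mono) (simp add: u_def Z_def)
  moreover have "gauss_cdf (cut_const + Z) - gauss_cdf cut_const \<le> 2 / 5 * (cut_const + Z - cut_const)"
    by (rule gauss_cdf_lipschitz) (use u e in \<open>simp add: Z_def\<close>)
  ultimately have "gauss_cdf y \<le> 94478 / 100000 + 2 / 5 * Z"
    using gauss_cdf_cut_const by simp
  hence 1: "2 * (gauss_cdf y + e) \<le> 188956 / 100000 + 4 / 5 * u + 3264 / 1000 * x\<^sup>2 + 28 / 10 * e"
    unfolding Z_def by argo
  define t where "t = (w\<^sup>2 - cut_const\<^sup>2) / 4 + 2 * x\<^sup>2 - 1 / 50000"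
  have "w\<^sup>2 = cut_const\<^sup>2 + 2 * cut_const * u + u\<^sup>2" by (simp add: u_def power2_eq_square algebra_simps)
  moreover have "cut_const * u \<ge> 1595 / 1000 * u" using cut_const_bounds u by (intro mult_right_mono) auto
  ultimately have "(w\<^sup>2 - cut_const\<^sup>2) / 4 \<ge> 1595 / 2000 * u"
    using zero_le_power2[of u] by argo
  hence t: "t \<ge> 1595 / 2000 * u + 2 * x\<^sup>2 - 1 / 50000" by (simp add: t_def)
  have tpos: "1 + t \<ge> 0" using t u zero_le_power2[of x] by linarith
  have "w\<^sup>2 / 4 + 2 * x\<^sup>2 - 1 / 50000 = 2 / pi + t"
    using cut_const_sq by (simp add: t_def field_simps)
  hence "exp (w\<^sup>2 / 4 + 2 * x\<^sup>2 - 1 / 50000) = exp (2 / pi) * exp t" by (simp add: exp_add)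
  also have "\<dots> \<ge> 1.89 * (1 + t)"
    using exp_two_over_pi exp_ge_add_one_self[of t] tpos by (intro mult_mono) auto
  finally have 2: "exp (w\<^sup>2 / 4 + 2 * x\<^sup>2 - 1 / 50000) \<ge> 189 / 100 * (1 + t)" by simp
  \<comment> \<open>Coefficientwise: 0.8 < 1.5 for u, 3.264 < 3.78 for x^2, and 1.88956 + 2.8 e <
    1.89 (1 - 1/50000) for the constants, which is why \<open>e\<close> is as small as
    1/10000.\<close>
  show ?thesis using 1 2 t u e zero_le_power2[of x] by argo
qed

lemma inverse_sqrt_le:
  fixes v :: real
  assumes "0 \<le> v" "v \<le> 18 / 100"
  shows "1 \<le> (1 + 3 / 5 * v) * sqrt (1 - v)"
proof -
  have "v * v \<le> 18 / 100 * v" "v * v * v \<le> (18/100) * (18 / 100) * v"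
    using assms by (intro mult_mono; simp)+
  hence "1 \<le> (1 + 3 / 5 * v)\<^sup>2 * (1 - v)"
    using assms unfolding power2_eq_square by (simp only: distrib_left distrib_right right_diff_distrib left_diff_distrib)
  hence "sqrt 1 \<le> sqrt ((1 + 3 / 5 * v)\<^sup>2 * (1 - v))" by (rule real_sqrt_le_mono)
  thus ?thesis using assms by (simp add: real_sqrt_mult)
qed


text \<open>With a = \<alpha>(1 - \<alpha>) and v = 4 x^2 + 4 h, 1 / sqrt (a - h) is 2 / sqrt (1 -
  v), which \<open>inverse_sqrt_le\<close> bounds linearly with slope 3/5. The coefficient 408/100
  is 3/5 * 4 * 17/10, with 17/10 the bound on \<open>w\<close>; \<open>h\<close> and
  \<open>r\<close> are errors that will vanish for large d.\<close>

lemma local_threshold_le: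
  fixes a x w h r :: real
  assumes a: "a = 1 / 4 - x\<^sup>2" and x: "x\<^sup>2 \<le> 4 / 100"
    and h: "0 \<le> h" "h \<le> 1 / 200" and r: "0 \<le> r" and w: "0 \<le> w" "w \<le> 17 / 10"
  shows "(w / 2 + r) / sqrt (a - h) \<le> w + 408 / 100 * x\<^sup>2 + 408 / 100 * h + 24 / 10 * r"
proof -
  define v where "v = 4 * x\<^sup>2 + 4 * h"
  have v: "0 \<le> v" "v \<le> 18 / 100" using x h by (auto simp: v_def)
  have "a - h = (1 - v) / 4" by (simp add: a v_def)
  hence s: "sqrt (a - h) = sqrt (1 - v) / 2" by (simp only: real_sqrt_divide) simp
  have pos: "sqrt (1 - v) > 0" using v by simp
  have "(w / 2 + r) / sqrt (a - h) = (w + 2 * r) / sqrt (1 - v)"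
    unfolding s using pos by (simp add: field_simps)
  also have "\<dots> \<le> (w + 2 * r) * (1 + 3 / 5 * v)"
  proof -
    have "(w + 2 * r) * 1 \<le> (w + 2 * r) * ((1 + 3 / 5 * v) * sqrt (1 - v))"
      using w r by (intro mult_left_mono inverse_sqrt_le v) auto
    thus ?thesis using pos by (simp add: divide_le_eq mult_ac)
  qed
  also have "\<dots> = w + 3 / 5 * (v * w) + 2 * r + 6 / 5 * (v * r)" by (simp add: algebra_simps)
  also have "\<dots> \<le> w + 3 / 5 * (v * (17 / 10)) + 2 * r + 6 / 5 * (18 / 100 * r)"
    using v w r by (intro add_mono mult_left_mono mult_right_mono) auto
  also have "\<dots> \<le> w + 408 / 100 * x\<^sup>2 + 408 / 100 * h + 24 / 10 * r"
    using r unfolding v_def by argo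
  finally show ?thesis .
qed

text \<open>The cut densities of the matchings may differ. To first order the variance feels only
  their mean deviation, to second order the sum of squares, and both coefficients are at most 1 in
  absolute value for 0 \<le> q \<le> 1.\<close>

lemma bern_var_perturbed_ge:
  fixes \<delta> :: "nat \<Rightarrow> real"
  assumes q: "0 \<le> q" "q \<le> 1" and sum: "(\<Sum>k<d. \<delta> k) = real d * \<delta>'" and sq: "(\<Sum>k<d. (\<delta> k)\<^sup>2) \<le> K"
  shows "bern_var d (\<lambda>k. q * (1 + \<delta> k)) \<ge> real d * (q * (1 - q)) - real d * \<bar>\<delta>'\<bar> - K"
proof -
  have "bern_var d (\<lambda>k. q * (1 + \<delta> k)) = (\<Sum>k<d. q * (1 - q) + q * (1 - 2 * q) * \<delta> k - q\<^sup>2 * (\<delta> k)\<^sup>2)"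
    unfolding bern_var_def by (intro sum.cong) (auto simp: power2_eq_square algebra_simps)
  also have "\<dots> = real d * (q * (1 - q)) + q * (1 - 2 * q) * (real d * \<delta>') - q\<^sup>2 * (\<Sum>k<d. (\<delta> k)\<^sup>2)"
    by (simp add: sum.distrib sum_subtractf sum_distrib_left flip: sum)
  finally have 0: "bern_var d (\<lambda>k. q * (1 + \<delta> k)) =
    real d * (q * (1 - q)) + q * (1 - 2 * q) * (real d * \<delta>') - q\<^sup>2 * (\<Sum>k<d. (\<delta> k)\<^sup>2)" .
  have "q\<^sup>2 * (\<Sum>k<d. (\<delta> k)\<^sup>2) \<le> 1 * K"
    using q sq by (intro mult_mono) (auto simp: power_le_one sum_nonneg)
  hence 1: "bern_var d (\<lambda>k. q * (1 + \<delta> k)) \<ge> real d * (q * (1 - q)) + q * (1 - 2 * q) * (real d * \<delta>') - K"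
    using 0 by simp
  have "\<bar>q * (1 - 2 * q) * (real d * \<delta>')\<bar> = (q * \<bar>1 - 2 * q\<bar>) * (real d * \<bar>\<delta>'\<bar>)"
    using q by (simp add: abs_mult)
  also have "\<dots> \<le> 1 * (real d * \<bar>\<delta>'\<bar>)"
    using q by (intro mult_right_mono mult_le_one) auto
  finally show ?thesis using 1 by linarith
qed

text \<open>The critical range. Either the cuts of the matchings are so atypical that their rate
  alone exceeds ln 2 per vertex, or the squared deviations sum up to at most 8; then every row has
  variance at least about d \<alpha>(1 - \<alpha>), and the central limit theorem gives Phi(y) +
  1/10000 per vertex.\<close>

lemma local_exponent:
  "\<exists>d0\<ge>1. \<forall>d\<ge>d0. \<forall>n s :: nat. \<forall>(c :: nat \<Rightarrow> nat) sg \<delta>. 0 < s \<and> 2 * s \<le> n \<and> 3 * n \<le> 10 * s \<and>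
     (\<forall>k<d. c k \<le> s) \<and> (sg = 1 \<or> sg = -1) \<and>
     \<delta> = (\<Sum>k<d. real (c k)) / real d * real n / (real s * (real n - real s)) - 1 \<and>
     cut_const \<le> \<bar>\<delta>\<bar> * sqrt (real d) \<and> \<bar>\<delta>\<bar> * sqrt (real d) \<le> 17 / 10
     \<longrightarrow> exp (- (\<Sum>k<d. layer_rate (real n) (real s) (real (c k)))) *
       (bern_set_prob d (\<lambda>k. real (c k) / real s)
          (local_sets sg (\<Sum>k<d. real (c k) / real s) (\<bar>\<delta>\<bar> * real d / 2 + 1)) ^ s *
        bern_set_prob d (\<lambda>k. real (c k) / real (n - s))
          (local_sets sg (\<Sum>k<d. real (c k) / real (n - s)) (\<bar>\<delta>\<bar> * real d / 2 + 1)) ^ (n - s))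
       \<le> exp (- ent (real n) (real s) - real n / 100000)"
proof -
  obtain V where V: "V > 0" "\<And>d p sg W y. (\<forall>k<d. 0 \<le> p k \<and> p k \<le> 1) \<Longrightarrow> bern_var d p \<ge> V \<Longrightarrow> sg = 1 \<or> sg = -1 \<Longrightarrow>
     0 \<le> y \<Longrightarrow> y \<le> 3 \<Longrightarrow> W < y * sqrt (bern_var d p)
      \<Longrightarrow> bern_set_prob d p (local_sets sg (\<Sum>k<d. p k) W) \<le> gauss_cdf y + 1 / 10000"
    using bern_local_le[of "1 / 10000"] by (metis divide_pos_pos zero_less_numeral zero_less_one)
  \<comment> \<open>Loss of variance per matching: d h = 17/10 sqrt d + 8 is the sum of the two
    error terms of \<open>bern_var_perturbed_ge\<close>.\<close>
  define h where "h d = 17 / 10 / sqrt (real d) + 8 / real d" for d :: nat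
  have "\<forall>\<^sub>F d in at_top. h d \<le> 1 / 200" unfolding h_def by real_asymp
  moreover have "\<forall>\<^sub>F d in at_top. 408 / 100 * h d + 24 / 10 * (2 / sqrt (real d)) \<le> 1 / 10000"
    unfolding h_def by real_asymp
  moreover have "\<forall>\<^sub>F d in at_top. 21 / 10 / sqrt (real d) \<le> 1 / 100000" by real_asymp
  moreover have "\<forall>\<^sub>F d in at_top. real d * (1 / 10) \<ge> V" by real_asymp
  moreover have "\<forall>\<^sub>F d in at_top. d \<ge> (1 :: nat)" by (rule eventually_ge_at_top)
  ultimately have "\<forall>\<^sub>F d in at_top. d \<ge> 1 \<and> real d * (1 / 10) \<ge> V \<and> 21 / 10 / sqrt (real d) \<le> 1 / 100000 \<and>
      408 / 100 * h d + 24 / 10 * (2 / sqrt (real d)) \<le> 1 / 10000 \<and> h d \<le> 1 / 200"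
    by eventually_elim simp
  then obtain d0 where d0: "\<And>d. d \<ge> d0 \<Longrightarrow> d \<ge> 1 \<and> real d * (1 / 10) \<ge> V \<and> 21 / 10 / sqrt (real d) \<le> 1 / 100000 \<and>
      408 / 100 * h d + 24 / 10 * (2 / sqrt (real d)) \<le> 1 / 10000 \<and> h d \<le> 1 / 200"
    by (auto simp: eventually_at_top_linorder)
  show ?thesis
  proof (rule exI[of _ "max 1 d0"], intro conjI allI impI)
    fix d n s :: nat and c :: "nat \<Rightarrow> nat" and sg \<delta> :: real
    assume "max 1 d0 \<le> d"
    hence d: "d \<ge> 1" "real d * (1 / 10) \<ge> V" "21 / 10 / sqrt (real d) \<le> 1 / 100000"
      "408 / 100 * h d + 24 / 10 * (2 / sqrt (real d)) \<le> 1 / 10000" "h d \<le> 1 / 200"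
      using d0[of d] by auto
    assume "0 < s \<and> 2 * s \<le> n \<and> 3 * n \<le> 10 * s \<and>
     (\<forall>k<d. c k \<le> s) \<and> (sg = 1 \<or> sg = -1) \<and>
     \<delta> = (\<Sum>k<d. real (c k)) / real d * real n / (real s * (real n - real s)) - 1 \<and>
     cut_const \<le> \<bar>\<delta>\<bar> * sqrt (real d) \<and> \<bar>\<delta>\<bar> * sqrt (real d) \<le> 17 / 10"
    hence s: "0 < s" "2 * s \<le> n" "3 * n \<le> 10 * s" and c: "\<And>k. k < d \<Longrightarrow> c k \<le> s" and sg: "sg = 1 \<or> sg = -1"
      and \<delta>: "\<delta> = (\<Sum>k<d. real (c k)) / real d * real n / (real s * (real n - real s)) - 1"
      and w1: "cut_const \<le> \<bar>\<delta>\<bar> * sqrt (real d)" and w2: "\<bar>\<delta>\<bar> * sqrt (real d) \<le> 17 / 10"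
      by auto
    define w where "w = \<bar>\<delta>\<bar> * sqrt (real d)"
    define N S :: real where "N = real n" and "S = real s"
    have NS: "0 < S" "2 * S \<le> N" "3 * N \<le> 10 * S" "S < N" "N > 0"
      using s by (auto simp: N_def S_def)
    have Nms: "real (n - s) = N - S" using s by (simp add: N_def S_def of_nat_diff)
    have sd: "sqrt (real d) > 0" "sqrt (real d) * sqrt (real d) = real d" using d by auto
    have w: "cut_const \<le> w" "w \<le> 17 / 10" "0 \<le> w" using w1 w2 by (auto simp: w_def)
    define R where "R = (\<Sum>k<d. layer_rate N S (real (c k)))"
    define bS where "bS = bern_set_prob d (\<lambda>k. real (c k) / S) (local_sets sg (\<Sum>k<d. real (c k) / S) (\<bar>\<delta>\<bar> * real d / 2 + 1))"
    define bT where "bT = bern_set_prob d (\<lambda>k. real (c k) / (N - S)) (local_sets sg (\<Sum>k<d. real (c k) / (N - S)) (\<bar>\<delta>\<bar> * real d / 2 + 1))"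
    have cS: "0 \<le> real (c k) / S \<and> real (c k) / S \<le> 1" if "k < d" for k
      using c[OF that] NS by (auto simp: S_def)
    have cT: "0 \<le> real (c k) / (N - S) \<and> real (c k) / (N - S) \<le> 1" if "k < d" for k
    proof -
      have "real (c k) \<le> S" using c[OF that] by (simp add: S_def)
      thus ?thesis using NS by (auto simp: divide_le_eq)
    qed
    have b01: "0 \<le> bS" "bS \<le> 1" "0 \<le> bT" "bT \<le> 1"
      unfolding bS_def bT_def using cS cT by (auto intro!: bern_set_prob_bounds)
    have ent: "ent N S \<le> N * (ln 2 - 2 * (1 / 2 - S / N)\<^sup>2)" by (rule ent_le_quadratic[OF NS(1,2)])
    have "exp (- R) * (bS ^ s * bT ^ (n - s)) \<le> exp (- ent N S - N / 100000)"
    \<comment> \<open>7/10 just exceeds the bound 25/36 for ln 2.\<close>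
    proof (cases "R \<ge> 7 / 10 * N")
      case True
      have "ln 2 - 2 * (1 / 2 - S / N)\<^sup>2 \<le> 25 / 36"
        using ln2_le_25_over_36 zero_le_power2[of "1 / 2 - S / N"] by linarith
      hence "N * (ln 2 - 2 * (1 / 2 - S / N)\<^sup>2) \<le> N * (25 / 36)" using NS by (intro mult_left_mono) auto
      hence "- R \<le> - ent N S - N / 100000" using True ent NS by linarith
      moreover have "bS ^ s * bT ^ (n - s) \<le> 1" using b01 by (intro mult_le_one power_le_one) auto
      ultimately have "exp (- R) * (bS ^ s * bT ^ (n - s)) \<le> exp (- ent N S - N / 100000) * 1"
        using b01 by (intro mult_mono) auto
      thus ?thesis by simp
    next
      case False
      define \<delta>k where "\<delta>k k = real (c k) * N / (S * (N - S)) - 1" for k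
      have sum_\<delta>: "(\<Sum>k<d. \<delta>k k) = real d * \<delta>"
      proof -
        have "(\<Sum>k<d. real (c k) * N / (S * (N - S))) = (\<Sum>k<d. real (c k)) * (N / (S * (N - S)))"
          unfolding sum_distrib_right by (intro sum.cong) auto
        moreover have "real d * \<delta> = (\<Sum>k<d. real (c k)) * (N / (S * (N - S))) - real d"
          unfolding \<delta> N_def S_def using d by (simp only: right_diff_distrib) simp
        ultimately show ?thesis by (simp only: \<delta>k_def sum_subtractf) simp
      qed
      \<comment> \<open>|\<delta>k k| \<le> 1 and N/S \<le> 10/3 bound the denominator by 16/3, and
        N/2 * 3/16 = 3N/32.\<close>
      have rate_k: "layer_rate N S (real (c k)) \<ge> 3 * N / 32 * (\<delta>k k)\<^sup>2" if k: "k < d" for k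
      proof -
        have ck: "real (c k) \<le> S" using c[OF k] by (simp add: S_def)
        have "real (c k) * N / (S * (N - S)) \<le> S * N / (S * (N - S))"
          using ck NS by (intro divide_right_mono mult_right_mono) auto
        also have "\<dots> = N / (N - S)" using NS by simp
        also have "\<dots> \<le> 2" using NS by (simp add: divide_le_eq)
        finally have "\<delta>k k \<le> 1" by (simp add: \<delta>k_def)
        moreover have "\<delta>k k \<ge> -1" using NS by (simp add: \<delta>k_def)
        ultimately have ab: "\<bar>\<delta>k k\<bar> \<le> 1" by simp
        have "N / S \<le> 10 / 3" using NS by (simp add: field_simps)
        hence "\<bar>\<delta>k k\<bar> * (N / S) \<le> 1 * (10 / 3)" using ab NS by (intro mult_mono) auto
        hence "2 + \<bar>\<delta>k k\<bar> * N / S \<le> 16 / 3" by simp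
        hence "(\<delta>k k)\<^sup>2 / (16 / 3) \<le> (\<delta>k k)\<^sup>2 / (2 + \<bar>\<delta>k k\<bar> * N / S)"
          using NS by (intro divide_left_mono) (auto intro!: mult_pos_pos add_pos_nonneg)
        hence "N / 2 * ((\<delta>k k)\<^sup>2 / (16 / 3)) \<le> N / 2 * ((\<delta>k k)\<^sup>2 / (2 + \<bar>\<delta>k k\<bar> * N / S))"
          using NS by (intro mult_left_mono) auto
        also have "\<dots> \<le> layer_rate N S (real (c k))"
          unfolding \<delta>k_def using NS ck by (intro layer_rate_ge_quadratic) auto
        finally show ?thesis by simp
      qed
      have "3 * N / 32 * (\<Sum>k<d. (\<delta>k k)\<^sup>2) \<le> R"
        unfolding R_def sum_distrib_left using rate_k by (intro sum_mono) auto
      hence "3 * N / 32 * (\<Sum>k<d. (\<delta>k k)\<^sup>2) \<le> 3 * N / 32 * 8" using False NS by linarith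
      hence sq: "(\<Sum>k<d. (\<delta>k k)\<^sup>2) \<le> 8" using NS by simp
      define x a where "x = 1 / 2 - S / N" and "a = 1 / 4 - x\<^sup>2"
      have x: "0 \<le> x" "x \<le> 1 / 5" using NS by (auto simp: x_def field_simps)
      have x2: "x\<^sup>2 \<le> 4 / 100" using power_mono[OF x(2,1), of 2] by (simp add: power2_eq_square)
      have aq: "S / N * (1 - S / N) = a" "(N - S) / N * (1 - (N - S) / N) = a"
        using NS by (auto simp: a_def x_def field_simps power2_eq_square)
      have hpos: "0 \<le> h d" by (simp add: h_def)
      have dh: "real d * (a - h d) = real d * a - sqrt (real d) * (17 / 10) - 8"
      proof -
        have "real d * (17 / 10 / sqrt (real d)) = (real d / sqrt (real d)) * (17 / 10)" by simp
        also have "real d / sqrt (real d) = sqrt (real d)" by (rule real_div_sqrt) simp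
        finally have "real d * (17 / 10 / sqrt (real d)) = sqrt (real d) * (17 / 10)" .
        moreover have "real d * (8 / real d) = 8" using d by simp
        ultimately show ?thesis by (simp only: h_def right_diff_distrib distrib_left)
      qed
      have d\<delta>: "real d * \<bar>\<delta>\<bar> = sqrt (real d) * w" using sd by (simp add: w_def mult_ac)
      have "real d * \<bar>\<delta>\<bar> \<le> sqrt (real d) * (17 / 10)" unfolding d\<delta> using w sd by (intro mult_left_mono) auto
      hence var: "bern_var d (\<lambda>k. q * (1 + \<delta>k k)) \<ge> real d * (a - h d)" if "0 \<le> q" "q \<le> 1" "q * (1 - q) = a" for q
        using bern_var_perturbed_ge[OF that(1,2) sum_\<delta> sq] dh that(3) by simp
      have pS: "(\<lambda>k. real (c k) / S) = (\<lambda>k. (N - S) / N * (1 + \<delta>k k))"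
        and pT: "(\<lambda>k. real (c k) / (N - S)) = (\<lambda>k. S / N * (1 + \<delta>k k))"
        using NS by (auto simp: \<delta>k_def fun_eq_iff)
      have varS: "bern_var d (\<lambda>k. real (c k) / S) \<ge> real d * (a - h d)"
        unfolding pS using NS aq by (intro var) auto
      have varT: "bern_var d (\<lambda>k. real (c k) / (N - S)) \<ge> real d * (a - h d)"
        unfolding pT using NS aq by (intro var) auto
      have ah: "a - h d \<ge> 1 / 10" using x2 d(5) by (simp add: a_def)
      hence dV: "real d * (a - h d) \<ge> V" using d(1,2) mult_left_mono[OF ah, of "real d"] by linarith
      \<comment> \<open>The local threshold in units of the standard deviation; 2 / sqrt d covers
        the summand 1 of the threshold and makes the inequality strict.\<close>
      define y where "y = (w / 2 + 2 / sqrt (real d)) / sqrt (a - h d)"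
      have y_le: "y \<le> w + 408 / 100 * x\<^sup>2 + 1 / 10000"
        using local_threshold_le[OF a_def x2 hpos d(5), of "2 / sqrt (real d)" w] w sd d(4)
        by (simp add: y_def)
      have y03: "0 \<le> y" "y \<le> 3" using y_le w x2 ah sd by (auto simp: y_def)
      have thr: "\<bar>\<delta>\<bar> * real d / 2 + 1 < y * sqrt v" if "v \<ge> real d * (a - h d)" for v
      proof -
        have "\<bar>\<delta>\<bar> * real d / 2 + 1 < (w / 2 + 2 / sqrt (real d)) * sqrt (real d)"
        proof -
          have "(w / 2 + 2 / sqrt (real d)) * sqrt (real d) = w * sqrt (real d) / 2 + 2"
            using sd(1) by (simp add: distrib_right)
          thus ?thesis using d\<delta> by (simp add: mult_ac)
        qed
        also have "\<dots> = y * (sqrt (real d) * sqrt (a - h d))" using ah by (simp add: y_def)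
        also have "\<dots> = y * sqrt (real d * (a - h d))" by (simp add: real_sqrt_mult)
        also have "\<dots> \<le> y * sqrt v" using y03 that by (intro mult_left_mono) auto
        finally show ?thesis .
      qed
      define B where "B = gauss_cdf y + 1 / 10000"
      have bB: "bS \<le> B" "bT \<le> B"
        unfolding bS_def bT_def B_def using cS cT varS varT dV sg y03 thr by (auto intro!: V(2))
      have B2: "2 * B \<le> exp (w\<^sup>2 / 4 + 2 * x\<^sup>2 - 1 / 50000)"
        unfolding B_def using w y_le by (intro gauss_cdf_exponent) auto
      have Bpos: "0 \<le> B" using bB b01 by linarith
      have "B \<le> exp (w\<^sup>2 / 4 + 2 * x\<^sup>2 - 1 / 50000 - ln 2)" using B2 by (simp add: exp_diff)
      hence "B ^ n \<le> exp (w\<^sup>2 / 4 + 2 * x\<^sup>2 - 1 / 50000 - ln 2) ^ n" using Bpos by (intro power_mono)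
      also have "\<dots> = exp (N * (w\<^sup>2 / 4 + 2 * x\<^sup>2 - 1 / 50000 - ln 2))"
        by (simp add: N_def exp_of_nat_mult)
      finally have Bn: "B ^ n \<le> exp (N * (w\<^sup>2 / 4 + 2 * x\<^sup>2 - 1 / 50000 - ln 2))" .
      have "bS ^ s * bT ^ (n - s) \<le> B ^ s * B ^ (n - s)"
        using bB b01 Bpos by (intro mult_mono power_mono) auto
      also have "\<dots> = B ^ n" using s by (simp flip: power_add)
      finally have bn: "bS ^ s * bT ^ (n - s) \<le> exp (N * (w\<^sup>2 / 4 + 2 * x\<^sup>2 - 1 / 50000 - ln 2))" using Bn by simp
      \<comment> \<open>Convexity collects the Gaussian rate w^2/4 from the total cut; the loss
        1/100000 uses up half of the reserve 1/50000 in \<open>gauss_cdf_exponent\<close>, and the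
        other half survives in the conclusion.\<close>
      have Rw: "R \<ge> N * (w\<^sup>2 / 4 - 1 / 100000)"
      proof -
        define cm where "cm = (\<Sum>k<d. real (c k)) / real d"
        have cm: "0 \<le> cm" "cm \<le> S"
        proof -
          show "0 \<le> cm" by (simp add: cm_def sum_nonneg)
          have "(\<Sum>k<d. real (c k)) \<le> (\<Sum>k<d. S)" using c by (intro sum_mono) (auto simp: S_def)
          thus "cm \<le> S" using d by (simp add: cm_def divide_le_eq mult_ac)
        qed
        have "R \<ge> real d * layer_rate N S cm"
          unfolding R_def cm_def using d NS c by (intro layer_rate_jensen) (force simp: S_def N_def)+
        moreover have "real d * layer_rate N S cm \<ge> N / 2 * (w\<^sup>2 / (2 + N / (S * sqrt (real d)) * w))"
          using d w by (intro mean_rate_ge NS cm) (auto simp: w_def \<delta> cm_def N_def S_def)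
        moreover have "w\<^sup>2 / (2 + N / (S * sqrt (real d)) * w) \<ge> w\<^sup>2 / 2 - 2 / 100000"
        proof -
          define t where "t = N / (S * sqrt (real d)) * w"
          have t0: "t \<ge> 0" using NS w by (simp add: t_def)
          have "N / S \<le> 10 / 3" using NS by (simp add: field_simps)
          hence "N / S / sqrt (real d) * w \<le> 10 / 3 / sqrt (real d) * (17 / 10)"
            using sd w NS by (intro mult_mono divide_right_mono) auto
          hence t1: "t \<le> 17 / 3 / sqrt (real d)" by (simp add: t_def)
          have "1 / (2 + t) \<ge> 1 / 2 - t / 4"
            using t0 by (simp add: field_simps)
          hence "w\<^sup>2 * (1 / (2 + t)) \<ge> w\<^sup>2 * (1 / 2 - t / 4)" by (intro mult_left_mono) auto
          moreover have "w\<^sup>2 * t \<le> (17/10)\<^sup>2 * (17 / 3 / sqrt (real d))"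
            using t0 t1 w by (intro mult_mono power_mono) auto
          moreover have "(17/10)\<^sup>2 * (17 / 3 / sqrt (real d)) \<le> 8 * (21 / 10 / sqrt (real d))"
            using sd by (simp add: power2_eq_square divide_simps)
          moreover have "w\<^sup>2 * (1 / (2 + t)) = w\<^sup>2 / (2 + t)" "w\<^sup>2 * (1 / 2 - t / 4) = w\<^sup>2 / 2 - w\<^sup>2 * t / 4"
            by (simp_all add: right_diff_distrib)
          ultimately have "w\<^sup>2 / (2 + t) \<ge> w\<^sup>2 / 2 - 2 / 100000" using d(3) by linarith
          thus ?thesis by (simp only: t_def)
        qed
        hence "N / 2 * (w\<^sup>2 / (2 + N / (S * sqrt (real d)) * w)) \<ge> N / 2 * (w\<^sup>2 / 2 - 2 / 100000)"
          using NS by (intro mult_left_mono) auto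
        ultimately show ?thesis by (simp add: algebra_simps)
      qed
      have "exp (- R) * (bS ^ s * bT ^ (n - s)) \<le>
          exp (- (N * (w\<^sup>2 / 4 - 1 / 100000))) * exp (N * (w\<^sup>2 / 4 + 2 * x\<^sup>2 - 1 / 50000 - ln 2))"
        using Rw bn b01 by (intro mult_mono) auto
      also have "\<dots> = exp (- (N * (ln 2 - 2 * x\<^sup>2)) - N / 100000)"
        by (simp add: algebra_simps flip: exp_add)
      also have "\<dots> \<le> exp (- ent N S - N / 100000)" using ent by (simp add: x_def)
      finally show ?thesis .
    qed
    thus "exp (- (\<Sum>k<d. layer_rate (real n) (real s) (real (c k)))) *
       (bern_set_prob d (\<lambda>k. real (c k) / real s)
          (local_sets sg (\<Sum>k<d. real (c k) / real s) (\<bar>\<delta>\<bar> * real d / 2 + 1)) ^ s *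
        bern_set_prob d (\<lambda>k. real (c k) / real (n - s))
          (local_sets sg (\<Sum>k<d. real (c k) / real (n - s)) (\<bar>\<delta>\<bar> * real d / 2 + 1)) ^ (n - s))
       \<le> exp (- ent (real n) (real s) - real n / 100000)"
      by (simp add: R_def bS_def bT_def Nms N_def[symmetric] S_def[symmetric])
  qed simp
qed

section \<open>Cuts of tuples of matchings and local optimality\<close>

definition tuple_cut :: "nat \<Rightarrow> (nat \<Rightarrow> nat set set) \<Rightarrow> nat set \<Rightarrow> nat" where
  "tuple_cut d M S = (\<Sum>k<d. card (cross S (M k) \<inter> S))"

lemma edge_cut_add: "edge_cut (A + B) S = edge_cut A S + edge_cut B S"
  by (simp add: edge_cut_def)

lemma edge_cut_tuple:
  assumes "\<And>k. k < d \<Longrightarrow> M k \<in> matchings V" "finite V"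
  shows "edge_cut (\<Sum>k<d. mset_set (M k)) S = tuple_cut d M S"
  using assms(1)
proof (induction d)
  case (Suc d)
  have Md: "M d \<in> matchings V" using Suc.prems by simp
  have "edge_cut (mset_set (M d)) S = card {e \<in> M d. card (e \<inter> S) = 1}"
    using matchings_finite[OF Md assms(2)] by (simp add: edge_cut_def filter_mset_mset_set)
  also have "\<dots> = card (cross S (M d) \<inter> S)" by (rule card_cut_edges[OF Md])
  finally have "edge_cut (mset_set (M d)) S = card (cross S (M d) \<inter> S)" .
  moreover have "edge_cut (\<Sum>k<d. mset_set (M k)) S = tuple_cut d M S" using Suc by simp
  ultimately show ?case by (simp add: edge_cut_add tuple_cut_def)
qed (simp add: edge_cut_def tuple_cut_def)

definition flip :: "nat \<Rightarrow> nat set \<Rightarrow> nat set" where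
  "flip i S = (if i \<in> S then S - {i} else insert i S)"

text \<open>Only the edge at \<open>i\<close> changes its status.\<close>

lemma card_cross_flip:
  assumes M: "M \<in> matchings V" and V: "finite V" and i: "i \<in> V"
  shows "real (card (cross (flip i S) M \<inter> flip i S)) =
           real (card (cross S M \<inter> S)) + 1 - 2 * of_bool (i \<in> cross S M)"
proof -
  define X where "X S = {e \<in> M. card (e \<inter> S) = 1}" for S
  have fin: "finite (X S)" for S using matchings_finite[OF M V] by (simp add: X_def)
  obtain j where j: "{i, j} \<in> M" "j \<noteq> i" using partner_edge[OF M i] by blast
  have other: "e \<inter> flip i S = e \<inter> S" if e: "e \<in> M" "e \<noteq> {i, j}" for e
  proof -
    have "i \<notin> e"
    proof
      assume "i \<in> e"
      then obtain w where "e = {i, w}" using matchings_edge_cases[OF M e(1)] by metis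
      thus False using matchings_unique[OF M j(1), of w] e by auto
    qed
    thus ?thesis by (auto simp: flip_def)
  qed
  have cutij: "{i, j} \<in> X T \<longleftrightarrow> (i \<in> T \<longleftrightarrow> j \<notin> T)" for T
    unfolding X_def using j card_Int_edge[of i j T] by blast
  have memi: "i \<in> cross S M \<longleftrightarrow> {i, j} \<in> X S" using mem_cross_iff[OF M j(1)] cutij by blast
  have flipij: "{i, j} \<in> X (flip i S) \<longleftrightarrow> {i, j} \<notin> X S"
    unfolding cutij using j(2) by (auto simp: flip_def)
  have rest: "X (flip i S) - {{i, j}} = X S - {{i, j}}"
  proof -
    have "card (e \<inter> flip i S) = 1 \<longleftrightarrow> card (e \<inter> S) = 1" if "e \<in> M" "e \<noteq> {i, j}" for e
      by (simp only: other[OF that])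
    thus ?thesis unfolding X_def by blast
  qed
  have c: "card (X T) = card (X T - {{i, j}}) + of_bool ({i, j} \<in> X T)" for T
    using fin[of T] by (cases "{i, j} \<in> X T") (auto simp: card_Suc_Diff1[symmetric] simp del: card_Diff_insert)
  have "real (card (X (flip i S))) = real (card (X S)) + 1 - 2 * of_bool ({i, j} \<in> X S)"
    using c[of S] c[of "flip i S"] rest flipij by (auto simp: of_bool_def)
  thus ?thesis using card_cut_edges[OF M] memi by (simp add: X_def)
qed

lemma tuple_cut_flip:
  assumes M: "\<And>k. k < d \<Longrightarrow> M k \<in> matchings V" and V: "finite V" and i: "i \<in> V"
  shows "real (tuple_cut d M (flip i S)) =
           real (tuple_cut d M S) + real d - 2 * real (card {k. k < d \<and> i \<in> cross S (M k)})"
proof -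
  have "real (tuple_cut d M (flip i S)) =
     (\<Sum>k<d. real (card (cross S (M k) \<inter> S)) + 1 - 2 * of_bool (i \<in> cross S (M k)))"
    unfolding tuple_cut_def of_nat_sum using M by (intro sum.cong refl card_cross_flip[OF _ V i]) auto
  also have "\<dots> = real (tuple_cut d M S) + real d - 2 * (\<Sum>k<d. of_bool (i \<in> cross S (M k)))"
    by (simp add: tuple_cut_def sum.distrib sum_subtractf sum_distrib_left)
  also have "(\<Sum>k<d. of_bool (i \<in> cross S (M k)) :: real) = real (card ({..<d} \<inter> {k. i \<in> cross S (M k)}))"
    by (subst sum_of_bool_eq) auto
  also have "{..<d} \<inter> {k. i \<in> cross S (M k)} = {k. k < d \<and> i \<in> cross S (M k)}" by auto
  finally show ?thesis .
qed

lemma tuple_cut_Diff: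
  assumes M: "\<And>k. k < d \<Longrightarrow> M k \<in> matchings V"
  shows "tuple_cut d M (V - S) = tuple_cut d M S"
  unfolding tuple_cut_def
proof (rule sum.cong[OF refl])
  fix k assume "k \<in> {..<d}"
  hence Mk: "M k \<in> matchings V" using M by simp
  have "{e \<in> M k. card (e \<inter> (V - S)) = 1} = {e \<in> M k. card (e \<inter> - S) = 1}"
  proof -
    have "e \<inter> (V - S) = e \<inter> - S" if "e \<in> M k" for e using Mk that by (auto simp: matchings_def)
    thus ?thesis by auto
  qed
  thus "card (cross (V - S) (M k) \<inter> (V - S)) = card (cross S (M k) \<inter> S)"
    using card_cut_edges[OF Mk, of "V - S"] card_cut_edges[OF Mk, of S] card_cut_edges_Compl[OF Mk, of S] by simp
qed

lemma tuple_cut_le: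
  assumes "finite S"
  shows "tuple_cut d M S \<le> d * card S"
proof -
  have "tuple_cut d M S \<le> (\<Sum>k<d. card S)"
    unfolding tuple_cut_def using assms by (intro sum_mono card_mono) auto
  thus ?thesis by simp
qed

definition cut_ratio :: "nat \<Rightarrow> nat \<Rightarrow> (nat \<Rightarrow> nat set set) \<Rightarrow> nat set \<Rightarrow> real" where
  "cut_ratio n d M S = real (tuple_cut d M S) / real d * real n / (real (card S) * (real n - real (card S)))"

text \<open>Every vertex of \<open>S\<close> has at most \<open>d\<close> cut edges, and n / (n - s)
  \<le> 2. So the deviation from 1 never exceeds 1, which settles small \<open>d\<close> in the
  theorem.\<close>

lemma cut_ratio_le_2:
  assumes "finite S" "0 < card S" "2 * card S \<le> n" "d > 0"
  shows "0 \<le> cut_ratio n d M S" "cut_ratio n d M S \<le> 2"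
proof -
  define s where "s = real (card S)"
  have s: "0 < s" "2 * s \<le> real n" using assms(2,3) by (auto simp: s_def)
  show "0 \<le> cut_ratio n d M S" using s by (simp add: cut_ratio_def s_def)
  have "real (tuple_cut d M S) \<le> real d * s"
    using tuple_cut_le[OF assms(1), of d M] by (simp add: s_def flip: of_nat_mult)
  hence "real (tuple_cut d M S) / real d \<le> s" using assms(4) by (simp add: divide_le_eq mult_ac)
  hence "real (tuple_cut d M S) / real d * real n \<le> s * real n" by (intro mult_right_mono) auto
  hence "cut_ratio n d M S \<le> s * real n / (s * (real n - s))"
    unfolding cut_ratio_def s_def[symmetric] using s by (intro divide_right_mono) auto
  also have "\<dots> = real n / (real n - s)" using s by simp
  also have "\<dots> \<le> 2" using s by (simp add: divide_le_eq)
  finally show "cut_ratio n d M S \<le> 2" .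
qed

text \<open>Moving one vertex across an extremal set \<open>S\<close> cannot improve the ratio. Both for vertices of
  \<open>S\<close> and of its complement this says that the number of cut edges at the vertex exceeds its
  mean over the respective side by at least \<open>-|\<delta>| d / 2\<close> in the direction \<open>sg\<close>.\<close>

lemma extremal_local:
  fixes n d s B cut :: real
  assumes s: "0 < s" "s < n" and d: "d > 0" "d \<le> n" and sg: "sg = 1 \<or> sg = -1"
    and \<rho>: "\<rho> = cut / d * n / (s * (n - s))" "0 \<le> \<rho>" "\<rho> \<le> 2"
    and e: "e = 1 \<or> e = -1" and t: "t = s - e" "0 < t" "t < n"
    and T: "sg * ((cut + d - 2 * B) / d * n / (t * (n - t))) \<le> sg * \<rho>"
    and pos: "sg * (\<rho> - 1) \<ge> 0"
  shows "sg * (B - cut / (if e = 1 then s else n - s)) \<ge> - (\<bar>\<rho> - 1\<bar> * d / 2 + 1)"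
proof -
  have n: "n > 0" using s by simp
  have cut: "cut = \<rho> * d * (s * (n - s)) / n" using s d n by (simp add: \<rho>(1))
  define K where "K = d * (t * (n - t)) / n"
  have K: "K > 0" using t d n by (simp add: K_def)
  have "(cut + d - 2 * B) / d * n / (t * (n - t)) = (cut + d - 2 * B) / K"
    using t d n by (simp add: K_def field_simps)
  hence "sg * (cut + d - 2 * B) / K \<le> sg * \<rho>" using T by simp
  hence 1: "sg * (cut + d - 2 * B) \<le> sg * \<rho> * K" using K by (simp add: divide_le_eq)
  \<comment> \<open>The change of s (n - s) when one vertex moves; its last term -1 becomes the
    error \<rho> d / n.\<close>
  have tt: "t * (n - t) = s * (n - s) - e * (n - 2 * s) - 1" using e by (auto simp: t(1) algebra_simps)
  have \<rho>K: "\<rho> * K = cut - \<rho> * d * e * (n - 2 * s) / n - \<rho> * d / n"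
    unfolding K_def tt cut using n by (simp add: field_simps)
  define \<mu> where "\<mu> = cut / (if e = 1 then s else n - s)"
  have \<mu>: "2 * \<mu> = d + \<rho> * d * e * (n - 2 * s) / n + d * (\<rho> - 1)"
    using e
  proof
    assume "e = 1"
    thus ?thesis using s n by (simp add: \<mu>_def cut field_simps)
  next
    assume "e = -1"
    thus ?thesis using s n by (simp add: \<mu>_def cut field_simps)
  qed
  \<comment> \<open>From d \<le> n: after halving, this error is the summand 1 in the
    threshold.\<close>
  have "\<rho> * (d / n) \<le> 2 * 1" using \<rho>(2,3) d n by (intro mult_mono) auto
  hence "\<rho> * d / n \<le> 2 * 1" by simp
  moreover have "0 \<le> \<rho> * d / n" using \<rho>(2) d n by simp
  moreover have "sg * (2 * B - 2 * \<mu> + d * (\<rho> - 1) - \<rho> * d / n) \<ge> 0"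
  proof -
    have "sg * (2 * B - 2 * \<mu> + d * (\<rho> - 1) - \<rho> * d / n) = sg * (\<rho> * K) - sg * (cut + d - 2 * B)"
      unfolding \<mu> \<rho>K by (simp add: algebra_simps)
    thus ?thesis using 1 by (simp add: mult.assoc)
  qed
  ultimately have "sg * (B - \<mu>) \<ge> - (\<bar>\<rho> - 1\<bar> * d / 2 + 1)"
  proof -
    assume R: "\<rho> * d / n \<le> 2 * 1" "0 \<le> \<rho> * d / n"
      and Q: "0 \<le> sg * (2 * B - 2 * \<mu> + d * (\<rho> - 1) - \<rho> * d / n)"
    define Z R where "Z = d * (\<rho> - 1)" and "R = \<rho> * d / n"
    have "\<bar>\<rho> - 1\<bar> = sg * (\<rho> - 1)" using sg pos by auto
    hence "\<bar>\<rho> - 1\<bar> * d = sg * Z" by (simp add: Z_def)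
    thus ?thesis using sg R Q unfolding Z_def[symmetric] R_def[symmetric] by auto
  qed
  thus ?thesis by (simp add: \<mu>_def)
qed

text \<open>The maximum runs over all sizes from \<beta> n to (1 - \<beta>) n. This family is closed
  under complements, so a move may cross n/2, and still the maximiser can be chosen of size at most
  n/2. Local optimality is claimed only from 3n/10 on, since near the boundary \<beta> n a move may
  leave the family; \<beta> \<le> 1/5 and n \<ge> 10 give room for one vertex.\<close>

lemma extremal_set_exists:
  fixes n d :: nat and \<beta> \<tau> :: real
  assumes M: "\<And>k. k < d \<Longrightarrow> M k \<in> matchings {1..n}"
    and d: "0 < d" "d \<le> n" and \<beta>: "0 < \<beta>" "\<beta> \<le> 1 / 5" and n: "n \<ge> 10"
    and S0: "S0 \<subseteq> {1..n}" "\<beta> * real n \<le> real (card S0)" "2 * card S0 \<le> n"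
    and dev: "\<bar>cut_ratio n d M S0 - 1\<bar> > \<tau>" and \<tau>: "\<tau> \<ge> 0"
  obtains S sg where "S \<subseteq> {1..n}" "\<beta> * real n \<le> real (card S)" "2 * card S \<le> n"
    "sg = 1 \<or> sg = (-1::real)" "sg * (cut_ratio n d M S - 1) > \<tau>"
    "3 * n \<le> 10 * card S \<longrightarrow> (\<forall>i\<in>{1..n}. {k. k < d \<and> i \<in> cross S (M k)} \<in>
       local_sets sg (real (tuple_cut d M S) / (if i \<in> S then real (card S) else real n - real (card S)))
         (\<bar>cut_ratio n d M S - 1\<bar> * real d / 2 + 1))"
proof -
  define V where "V = {1..n}"
  define sg :: real where "sg = (if cut_ratio n d M S0 > 1 then 1 else -1)"
  have sg: "sg = 1 \<or> sg = -1" by (auto simp: sg_def)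
  have dev': "sg * (cut_ratio n d M S0 - 1) > \<tau>" using dev by (auto simp: sg_def)
  define \<F> where "\<F> = {S. S \<subseteq> V \<and> \<beta> * real n \<le> real (card S) \<and> real (card S) \<le> (1 - \<beta>) * real n}"
  have finV: "finite V" "card V = n" by (auto simp: V_def)
  have "finite \<F>" by (rule finite_subset[of _ "Pow V"]) (auto simp: \<F>_def finV)
  have "\<beta> * real n \<le> 1 / 5 * real n" using \<beta> by (intro mult_right_mono) auto
  hence "S0 \<in> \<F>" using S0 \<beta> by (auto simp: \<F>_def V_def algebra_simps)
  define f where "f S = sg * (cut_ratio n d M S - 1)" for S
  have "Max (f ` \<F>) \<in> f ` \<F>" using \<open>finite \<F>\<close> \<open>S0 \<in> \<F>\<close> by (intro Max_in) auto
  then obtain S1 where S1: "S1 \<in> \<F>" "f S1 = Max (f ` \<F>)" by auto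
  have max1: "f T \<le> f S1" if "T \<in> \<F>" for T using S1 \<open>finite \<F>\<close> that by simp
  have cardc: "real (card (V - T)) = real n - real (card T)" if "T \<subseteq> V" for T
  proof -
    have "card T \<le> n" using that finV card_mono[of V T] by simp
    thus ?thesis using that finV finite_subset[OF that] by (simp add: card_Diff_subset of_nat_diff)
  qed
  define S where "S = (if 2 * card S1 \<le> n then S1 else V - S1)"
  have SF: "S \<in> \<F>" using S1(1) cardc[of S1] by (auto simp: S_def \<F>_def algebra_simps)
  have fS: "f S = f S1"
  proof (cases "2 * card S1 \<le> n")
    case False
    have "tuple_cut d M S = tuple_cut d M S1"
      using False tuple_cut_Diff[of d M V S1] M by (simp add: S_def V_def)
    moreover have "real (card S) = real n - real (card S1)" using cardc[of S1] S1 False by (simp add: S_def \<F>_def)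
    ultimately show ?thesis by (simp add: f_def cut_ratio_def mult.commute)
  qed (simp add: S_def)
  have max: "f T \<le> f S" if "T \<in> \<F>" for T using max1[OF that] fS by simp
  define s where "s = real (card S)"
  have S: "S \<subseteq> V" "\<beta> * real n \<le> s" using SF by (auto simp: \<F>_def s_def)
  have S2: "2 * card S \<le> n"
  proof (cases "2 * card S1 \<le> n")
    case False
    have "real (card S) = real n - real (card S1)" using cardc[of S1] S1 False by (simp add: S_def \<F>_def)
    thus ?thesis using False by linarith
  qed (simp add: S_def)
  have finS: "finite S" using S(1) finV finite_subset by blast
  have npos: "real n > 0" using n by simp
  have "0 < \<beta> * real n" using \<beta> npos by simp
  hence spos: "s > 0" "2 * s \<le> real n" using S(2) S2 by (simp_all add: s_def)
  have big: "f S > \<tau>" using max[OF \<open>S0 \<in> \<F>\<close>] dev' by (simp add: f_def)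
  have local: "\<forall>i\<in>V. {k. k < d \<and> i \<in> cross S (M k)} \<in>
       local_sets sg (real (tuple_cut d M S) / (if i \<in> S then s else real n - s))
         (\<bar>cut_ratio n d M S - 1\<bar> * real d / 2 + 1)" if "3 * n \<le> 10 * card S"
  proof
    fix i assume i: "i \<in> V"
    define e :: real where "e = (if i \<in> S then 1 else -1)"
    have s3: "3 / 10 * real n \<le> s" using that by (simp add: s_def)
    have ct: "real (card (flip i S)) = s - e"
    proof (cases "i \<in> S")
      case True
      hence "Suc (card (S - {i})) = card S" using finS by (intro card_Suc_Diff1)
      hence "real (card (S - {i})) = real (card S) - 1" by linarith
      moreover have "flip i S = S - {i}" "e = 1" using True by (auto simp: flip_def e_def)
      ultimately show ?thesis by (simp only: s_def)
    qed (use finS in \<open>simp add: flip_def e_def s_def\<close>)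
    have b5: "\<beta> * real n \<le> 1 / 5 * real n" "(1 - \<beta>) * real n \<ge> (4 / 5) * real n"
      using \<beta> by (intro mult_right_mono; simp)+
    have e1: "\<bar>e\<bar> = 1" by (simp add: e_def)
    have n10: "real n \<ge> 10" using n by simp
    have "flip i S \<in> \<F>"
    proof -
      have "flip i S \<subseteq> V" using S i by (auto simp: flip_def)
      moreover have "\<beta> * real n \<le> s - e" "s - e \<le> (1 - \<beta>) * real n"
        using b5 s3 e1 n10 spos by linarith+
      ultimately show ?thesis using ct by (simp add: \<F>_def)
    qed
    from max[OF this] have "sg * cut_ratio n d M (flip i S) \<le> sg * cut_ratio n d M S"
      by (simp add: f_def algebra_simps)
    hence T: "sg * ((real (tuple_cut d M S) + real d - 2 * real (card {k. k < d \<and> i \<in> cross S (M k)})) / real d * real n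
         / ((s - e) * (real n - (s - e)))) \<le> sg * cut_ratio n d M S"
      using tuple_cut_flip[of d M V i S] M finV i
      by (simp add: cut_ratio_def ct V_def)
    have "sg * (real (card {k. k < d \<and> i \<in> cross S (M k)}) - real (tuple_cut d M S) / (if e = 1 then s else real n - s))
       \<ge> - (\<bar>cut_ratio n d M S - 1\<bar> * real d / 2 + 1)"
    proof (rule extremal_local[OF _ _ _ _ sg _ _ _ _ refl _ _ T])
      show "0 < s" "s < real n" using spos by auto
      show "0 < real d" "real d \<le> real n" using d by auto
      show "cut_ratio n d M S = real (tuple_cut d M S) / real d * real n / (s * (real n - s))"
        by (simp add: cut_ratio_def s_def)
      show "0 \<le> cut_ratio n d M S" "cut_ratio n d M S \<le> 2"
        using cut_ratio_le_2[OF finS _ S2 d(1), of M] spos by (auto simp: s_def)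
      show "e = 1 \<or> e = -1" by (simp add: e_def)
      show "0 < s - e" "s - e < real n" using s3 e1 n10 spos by linarith+
      show "0 \<le> sg * (cut_ratio n d M S - 1)" using big \<tau> by (simp add: f_def)
    qed
    moreover have "(e = 1) = (i \<in> S)" by (simp add: e_def)
    ultimately show "{k. k < d \<and> i \<in> cross S (M k)} \<in>
       local_sets sg (real (tuple_cut d M S) / (if i \<in> S then s else real n - s))
         (\<bar>cut_ratio n d M S - 1\<bar> * real d / 2 + 1)"
      by (simp add: local_sets_def)
  qed
  show thesis
  proof (rule that[of S sg])
    show "3 * n \<le> 10 * card S \<longrightarrow> (\<forall>i\<in>{1..n}. {k. k < d \<and> i \<in> cross S (M k)} \<in>
       local_sets sg (real (tuple_cut d M S) / (if i \<in> S then real (card S) else real n - real (card S)))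
         (\<bar>cut_ratio n d M S - 1\<bar> * real d / 2 + 1))"
      using local unfolding V_def s_def by blast
  qed (use S S2 sg big in \<open>auto simp: V_def s_def f_def\<close>)
qed

section \<open>Counting tuples of matchings\<close>

text \<open>With the default \<open>{}\<close> this is the set on which the \<open>Pi_pmf\<close> in
  \<open>G_reg\<close> is uniform for even \<open>n\<close>.\<close>

definition matching_tuples :: "nat \<Rightarrow> nat \<Rightarrow> (nat \<Rightarrow> nat set set) set" where
  "matching_tuples n d = PiE_dflt {..<d} {} (\<lambda>_. matchings {1..n})"

lemma matching_tuplesD: "M \<in> matching_tuples n d \<Longrightarrow> k < d \<Longrightarrow> M k \<in> matchings {1..n}"
  by (auto simp: matching_tuples_def PiE_dflt_def)

lemma finite_matching_tuples: "finite (matching_tuples n d)"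
  unfolding matching_tuples_def by (intro finite_PiE_dflt finite_matchings) auto

lemma card_matching_tuples: "card (matching_tuples n d) = nmatch n ^ d"
  unfolding matching_tuples_def by (subst card_PiE_dflt) (auto simp: finite_matchings card_matchings)

text \<open>The Bernoulli parameter of the table entry at vertex \<open>i\<close> and matching
  \<open>k\<close>.\<close>

definition side_prob :: "nat \<Rightarrow> nat set \<Rightarrow> (nat \<Rightarrow> nat) \<Rightarrow> nat \<Rightarrow> nat \<Rightarrow> real" where
  "side_prob n S c i k = real (c k) / (if i \<in> S then real (card S) else real (n - card S))"

lemma prod_if_power:
  fixes p :: real
  assumes "finite A"
  shows "(\<Prod>i\<in>A. if i \<in> C then p else 1 - p) = p ^ card (C \<inter> A) * (1 - p) ^ (card A - card (C \<inter> A))"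
proof -
  have "(\<Prod>i\<in>A. if i \<in> C then p else 1 - p) = p ^ card (A \<inter> C) * (1 - p) ^ card (A \<inter> - C)"
    using assms by (simp add: prod.If_cases)
  also have "A \<inter> - C = A - C \<inter> A" by auto
  also have "card (A - C \<inter> A) = card A - card (C \<inter> A)"
    using assms by (intro card_Diff_subset) auto
  finally show ?thesis by (simp add: Int_commute)
qed

text \<open>The Bernoulli probability of one column of the table, written as a product over vertices
  so that it can later be regrouped by rows.\<close>

lemma layer_weight_prod:
  assumes V: "finite V" "S \<subseteq> V" and C: "C \<subseteq> V" "card (C \<inter> S) = c k" "card (C - S) = c k"
  shows "layer_weight (real (c k) / real (card S)) (real (c k) / real (card V - card S)) (c k) (card S) (card V - card S) =
    (\<Prod>i\<in>V. if i \<in> C then side_prob (card V) S c i k else 1 - side_prob (card V) S c i k)"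
proof -
  define p q where "p = real (c k) / real (card S)" and "q = real (c k) / real (card V - card S)"
  define f where "f i = (if i \<in> C then side_prob (card V) S c i k else 1 - side_prob (card V) S c i k)" for i
  have fin: "finite S" using V finite_subset by auto
  have "prod f V = prod f (V - S) * prod f S" by (rule prod.subset_diff) (use V in auto)
  also have "prod f S = (\<Prod>i\<in>S. if i \<in> C then p else 1 - p)"
    by (intro prod.cong) (auto simp: f_def side_prob_def p_def)
  also have "prod f (V - S) = (\<Prod>i\<in>V - S. if i \<in> C then q else 1 - q)"
    by (intro prod.cong) (auto simp: f_def side_prob_def q_def)
  also have "(\<Prod>i\<in>S. if i \<in> C then p else 1 - p) = p ^ c k * (1 - p) ^ (card S - c k)"
    using prod_if_power[OF fin, of C p] C by simp
  also have "(\<Prod>i\<in>V - S. if i \<in> C then q else 1 - q) = q ^ c k * (1 - q) ^ (card V - card S - c k)"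
  proof -
    have "C \<inter> (V - S) = C - S" using C by auto
    moreover have "card (V - S) = card V - card S" using V fin by (intro card_Diff_subset) auto
    ultimately show ?thesis using prod_if_power[of "V - S" C q] V C by simp
  qed
  finally show ?thesis by (simp add: layer_weight_def f_def p_def q_def mult_ac)
qed

text \<open>The decoupling step; \<open>R i\<close> is an arbitrary condition on row
  \<open>i\<close> of the table. The number of matchings behind each column is bounded through its
  Bernoulli probability; exchanging the products over matchings and vertices and summing over tables
  then factors over the rows.\<close>

lemma tuple_count_le:
  fixes n d :: nat and c :: "nat \<Rightarrow> nat"
  defines "V \<equiv> {1..n}"
  assumes n: "even n" and S: "S \<subseteq> V" "0 < card S" "2 * card S \<le> n" and c: "\<And>k. k < d \<Longrightarrow> c k \<le> card S"
  shows "real (card {M \<in> matching_tuples n d. (\<forall>k<d. card (cross S (M k) \<inter> S) = c k) \<and>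
            (\<forall>i\<in>V. {k. k < d \<and> i \<in> cross S (M k)} \<in> R i)})
    \<le> real (nmatch n) ^ d * ((3 * (real n + 1)) ^ 4) ^ d *
       (exp (- (\<Sum>k<d. layer_rate (real n) (real (card S)) (real (c k)))) *
        (\<Prod>i\<in>V. bern_set_prob d (side_prob n S c i) (R i)))"
proof -
  define s where "s = card S"
  define \<M> where "\<M> = {M \<in> matching_tuples n d. (\<forall>k<d. card (cross S (M k) \<inter> S) = c k) \<and>
            (\<forall>i\<in>V. {k. k < d \<and> i \<in> cross S (M k)} \<in> R i)}"
  define rows where "rows M = restrict (\<lambda>i. {k. k < d \<and> i \<in> cross S (M k)}) V" for M
  define G where "G = PiE V (\<lambda>i. Pow {..<d} \<inter> R i)"
  define P where "P = (3 * (real n + 1)) ^ 4"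
  define J where "J k = layer_rate (real n) (real s) (real (c k))" for k
  define w where "w g k i = (if k \<in> g i then side_prob n S c i k else 1 - side_prob n S c i k)" for g k i
  have V: "finite V" "card V = n" by (auto simp: V_def)
  have fin: "finite \<M>" using finite_matching_tuples by (simp add: \<M>_def)
  have rowsG: "rows ` \<M> \<subseteq> G" by (auto simp: rows_def G_def \<M>_def)
  have finG: "finite G" unfolding G_def using V by (intro finite_PiE) auto
  have sp: "0 \<le> side_prob n S c i k \<and> side_prob n S c i k \<le> 1" if "k < d" for i k
  proof -
    have "real (c k) \<le> real (card S)" "real (c k) \<le> real (n - card S)" using c[OF that] S by auto
    thus ?thesis using S by (auto simp: side_prob_def divide_le_eq)
  qed
  have wpos: "0 \<le> w g k i" if "k < d" for g k i using sp[OF that, of i] by (auto simp: w_def)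
  \<comment> \<open>A table fixes the cut vertices of every matching, so the tuples with that table
    are counted matching by matching.\<close>
  have fiber: "real (card {M \<in> \<M>. rows M = g}) \<le> (\<Prod>k<d. P * real (nmatch n) * (exp (- J k) * (\<Prod>i\<in>V. w g k i)))"
    if g: "g \<in> rows ` \<M>" for g
  proof -
    define C where "C k = {i \<in> V. k \<in> g i}" for k
    have CM: "C k = cross S (M k)" if "M \<in> \<M>" "rows M = g" "k < d" for M k
    proof -
      have "M k \<in> matchings V" using that matching_tuplesD[of M n d k] by (auto simp: \<M>_def V_def)
      from cross_subset[OF this] have "cross S (M k) \<subseteq> V" .
      moreover have "k \<in> g i \<longleftrightarrow> i \<in> cross S (M k)" if "i \<in> V" for i
        using \<open>rows M = g\<close> \<open>k < d\<close> that by (auto simp: rows_def)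
      ultimately show ?thesis by (auto simp: C_def)
    qed
    have "{M \<in> \<M>. rows M = g} \<subseteq> PiE_dflt {..<d} {} (\<lambda>k. {N \<in> matchings V. cross S N = C k})"
      using CM by (auto simp: PiE_dflt_def \<M>_def matching_tuples_def V_def)
    hence "card {M \<in> \<M>. rows M = g} \<le> card (PiE_dflt {..<d} {} (\<lambda>k. {N \<in> matchings V. cross S N = C k}))"
      using finite_matchings[OF V(1)] by (intro card_mono finite_PiE_dflt) auto
    also have "\<dots> = (\<Prod>k<d. card {N \<in> matchings V. cross S N = C k})"
      using finite_matchings[OF V(1)] by (intro card_PiE_dflt) auto
    finally have "real (card {M \<in> \<M>. rows M = g}) \<le> (\<Prod>k<d. real (card {N \<in> matchings V. cross S N = C k}))"
      unfolding of_nat_prod[symmetric] of_nat_le_iff .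
    also have "\<dots> \<le> (\<Prod>k<d. P * real (nmatch n) * (exp (- J k) * (\<Prod>i\<in>V. w g k i)))"
    proof (rule prod_mono, intro conjI)
      fix k assume k: "k \<in> {..<d}"
      obtain M where M: "M \<in> \<M>" "rows M = g" using g by auto
      have Mk: "M k \<in> matchings V" using M k matching_tuplesD[of M n d k] by (auto simp: \<M>_def V_def)
      have Ck: "C k = cross S (M k)" using CM[OF M] k by simp
      have c1: "card (C k \<inter> S) = c k" using M k by (auto simp: Ck \<M>_def)
      have c2: "card (C k - S) = c k" using card_cross_Diff[OF Mk, of S] c1 Ck by simp
      have CV: "C k \<subseteq> V" by (auto simp: C_def)
      have "real (card {N \<in> matchings V. cross S N = C k}) \<le>
          real (fact (c k) * nmatch (card S - c k) * nmatch (card V - card S - c k))"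
        using card_matchings_cross_le[OF V(1) S(1) CV c1 c2] by (simp only: of_nat_le_iff)
      also have "\<dots> \<le> P * real (nmatch n) * (exp (- J k) *
         layer_weight (real (c k) / real s) (real (c k) / real (n - s)) (c k) s (n - s))"
        unfolding V(2) P_def J_def s_def using n S c[of k] k by (intro layer_count_le) auto
      also have "layer_weight (real (c k) / real s) (real (c k) / real (n - s)) (c k) s (n - s) = (\<Prod>i\<in>V. w g k i)"
        using layer_weight_prod[of V S "C k" c k, OF V(1) S(1) CV c1 c2, unfolded V(2)]
        by (simp add: s_def w_def C_def)
      finally show "real (card {N \<in> matchings V. cross S N = C k}) \<le> P * real (nmatch n) * (exp (- J k) * (\<Prod>i\<in>V. w g k i))" .
    qed auto
    finally show ?thesis .
  qed
  have split: "(\<Prod>k<d. P * real (nmatch n) * (exp (- J k) * (\<Prod>i\<in>V. w g k i))) =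
      (real (nmatch n) ^ d * P ^ d * exp (- (\<Sum>k<d. J k))) * (\<Prod>i\<in>V. \<Prod>k<d. w g k i)" for g
    by (simp add: prod.distrib exp_sum prod.swap[of _ V] power_mult_distrib mult_ac flip: sum_negf)
  have "\<M> = (\<Union>g\<in>rows ` \<M>. {M \<in> \<M>. rows M = g})" by auto
  hence "card \<M> \<le> (\<Sum>g\<in>rows ` \<M>. card {M \<in> \<M>. rows M = g})"
    using card_UN_le[of "rows ` \<M>" "\<lambda>g. {M \<in> \<M>. rows M = g}"] fin by simp
  hence "real (card \<M>) \<le> (\<Sum>g\<in>rows ` \<M>. real (card {M \<in> \<M>. rows M = g}))"
    unfolding of_nat_sum[symmetric] of_nat_le_iff .
  also have "\<dots> \<le> (\<Sum>g\<in>rows ` \<M>. (real (nmatch n) ^ d * P ^ d * exp (- (\<Sum>k<d. J k))) * (\<Prod>i\<in>V. \<Prod>k<d. w g k i))"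
    using fiber split by (intro sum_mono) auto
  \<comment> \<open>Here the column sizes \<open>c k\<close> are forgotten: all tables with
    admissible rows are allowed, which makes the rows independent.\<close>
  also have "\<dots> \<le> (\<Sum>g\<in>G. (real (nmatch n) ^ d * P ^ d * exp (- (\<Sum>k<d. J k))) * (\<Prod>i\<in>V. \<Prod>k<d. w g k i))"
    using rowsG finG wpos
    by (intro sum_mono2) (auto intro!: mult_nonneg_nonneg prod_nonneg simp: P_def)
  also have "\<dots> = (real (nmatch n) ^ d * P ^ d * exp (- (\<Sum>k<d. J k))) * (\<Sum>g\<in>G. \<Prod>i\<in>V. \<Prod>k<d. w g k i)"
    by (simp add: sum_distrib_left)
  also have "(\<Sum>g\<in>G. \<Prod>i\<in>V. \<Prod>k<d. w g k i) = (\<Prod>i\<in>V. bern_set_prob d (side_prob n S c i) (R i))"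
    unfolding G_def w_def bern_set_prob_def
    by (rule prod_sum_PiE[OF V(1), symmetric,
          of "\<lambda>i. Pow {..<d} \<inter> R i" "\<lambda>i D. \<Prod>k<d. if k \<in> D then side_prob n S c i k else 1 - side_prob n S c i k"]) auto
  finally show ?thesis by (simp add: \<M>_def P_def J_def s_def mult_ac)
qed

definition mean_dev :: "nat \<Rightarrow> nat \<Rightarrow> nat \<Rightarrow> (nat \<Rightarrow> nat) \<Rightarrow> real" where
  "mean_dev n d s c = (\<Sum>k<d. real (c k)) / real d * real n / (real s * (real n - real s)) - 1"

definition row_sets :: "nat \<Rightarrow> nat \<Rightarrow> nat set \<Rightarrow> (nat \<Rightarrow> nat) \<Rightarrow> real \<Rightarrow> nat \<Rightarrow> nat set set" where
  "row_sets n d S c sg i = (if 3 * n \<le> 10 * card S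
     then local_sets sg (\<Sum>k<d. side_prob n S c i k) (\<bar>mean_dev n d (card S) c\<bar> * real d / 2 + 1) else UNIV)"

text \<open>Joins the two regimes: \<open>first_moment_exponent\<close>, where the row probabilities
  are bounded by 1, and \<open>local_exponent\<close>, where all rows on one side have the same
  probability.\<close>

lemma exponent_bound:
  "\<exists>d0\<ge>1. \<forall>d\<ge>d0. \<forall>n S c sg. S \<subseteq> {1..n} \<and> 0 < card S \<and> 2 * card S \<le> n \<and> (\<forall>k<d. c k \<le> card S) \<and>
     (sg = 1 \<or> sg = -1) \<and> sg * mean_dev n d (card S) c > cut_const / sqrt (real d) \<longrightarrow>
     exp (- (\<Sum>k<d. layer_rate (real n) (real (card S)) (real (c k)))) *
        (\<Prod>i\<in>{1..n}. bern_set_prob d (side_prob n S c i) (row_sets n d S c sg i))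
     \<le> exp (- ent (real n) (real (card S)) - real (card S) / 100000)"
proof -
  from first_moment_exponent obtain d1 where d1: "d1 \<ge> 1" and F: "\<forall>d\<ge>d1. \<forall>n s c :: real. 0 < s \<and> 2 * s \<le> n \<and> 0 \<le> c \<and> c \<le> s \<and>
     cut_const \<le> \<bar>c * n / (s * (n - s)) - 1\<bar> * sqrt (real d) \<and>
     (10 * s \<le> 3 * n \<or> 17 / 10 \<le> \<bar>c * n / (s * (n - s)) - 1\<bar> * sqrt (real d))
     \<longrightarrow> ent n s - real d * layer_rate n s c \<le> - s / 100"
    by (elim exE conjE) (rule that; assumption)
  from local_exponent obtain d2 where L: "\<forall>d\<ge>d2. \<forall>n s :: nat. \<forall>(c :: nat \<Rightarrow> nat) sg \<delta>. 0 < s \<and> 2 * s \<le> n \<and> 3 * n \<le> 10 * s \<and>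
     (\<forall>k<d. c k \<le> s) \<and> (sg = 1 \<or> sg = -1) \<and>
     \<delta> = (\<Sum>k<d. real (c k)) / real d * real n / (real s * (real n - real s)) - 1 \<and>
     cut_const \<le> \<bar>\<delta>\<bar> * sqrt (real d) \<and> \<bar>\<delta>\<bar> * sqrt (real d) \<le> 17 / 10
     \<longrightarrow> exp (- (\<Sum>k<d. layer_rate (real n) (real s) (real (c k)))) *
       (bern_set_prob d (\<lambda>k. real (c k) / real s)
          (local_sets sg (\<Sum>k<d. real (c k) / real s) (\<bar>\<delta>\<bar> * real d / 2 + 1)) ^ s *
        bern_set_prob d (\<lambda>k. real (c k) / real (n - s))
          (local_sets sg (\<Sum>k<d. real (c k) / real (n - s)) (\<bar>\<delta>\<bar> * real d / 2 + 1)) ^ (n - s))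
       \<le> exp (- ent (real n) (real s) - real n / 100000)"
    by (elim exE conjE) (rule that; assumption)
  have "exp (- (\<Sum>k<d. layer_rate (real n) (real (card S)) (real (c k)))) *
        (\<Prod>i\<in>{1..n}. bern_set_prob d (side_prob n S c i) (row_sets n d S c sg i))
     \<le> exp (- ent (real n) (real (card S)) - real (card S) / 100000)"
    if d: "d \<ge> max d1 d2" and S: "S \<subseteq> {1..n}" "0 < card S" "2 * card S \<le> n" and c: "\<forall>k<d. c k \<le> card S"
      and sg: "sg = 1 \<or> sg = -1" and dev: "sg * mean_dev n d (card S) c > cut_const / sqrt (real d)" for d n S c sg
  proof -
    define s where "s = card S"
    define \<delta> where "\<delta> = mean_dev n d s c"
    define R where "R = (\<Sum>k<d. layer_rate (real n) (real s) (real (c k)))"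
    define b where "b i = bern_set_prob d (side_prob n S c i) (row_sets n d S c sg i)" for i
    have dpos: "d > 0" "sqrt (real d) > 0" using d d1 by auto
    have s: "0 < s" "2 * s \<le> n" "s < n" using S by (auto simp: s_def)
    have "cut_const / sqrt (real d) > 0" using dpos by simp
    hence "sg * \<delta> > 0" using dev by (simp only: \<delta>_def s_def)
    hence "sg * \<delta> = \<bar>\<delta>\<bar>" using sg by auto
    hence w: "cut_const \<le> \<bar>\<delta>\<bar> * sqrt (real d)" using dev dpos by (simp add: \<delta>_def s_def divide_less_eq)
    have sp: "0 \<le> side_prob n S c i k \<and> side_prob n S c i k \<le> 1" if "k < d" for i k
    proof -
      have "real (c k) \<le> real (card S)" "real (c k) \<le> real (n - card S)" using c that S by auto
      thus ?thesis using S by (auto simp: side_prob_def divide_le_eq)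
    qed
    have b01: "0 \<le> b i \<and> b i \<le> 1" for i unfolding b_def using bern_set_prob_bounds[of d "side_prob n S c i"] sp by blast
    have "exp (- R) * (\<Prod>i\<in>{1..n}. b i) \<le> exp (- ent (real n) (real s) - real s / 100000)"
    proof (cases "10 * s \<le> 3 * n \<or> 17 / 10 \<le> \<bar>\<delta>\<bar> * sqrt (real d)")
      case True
      define cm where "cm = (\<Sum>k<d. real (c k)) / real d"
      have "(\<Sum>k<d. real (c k)) \<le> (\<Sum>k<d. real s)" using c by (intro sum_mono) (auto simp: s_def)
      hence cm: "0 \<le> cm" "cm \<le> real s" using dpos by (auto simp: cm_def sum_nonneg divide_le_eq mult_ac)
      have \<delta>cm: "cm * real n / (real s * (real n - real s)) - 1 = \<delta>" by (simp add: \<delta>_def mean_dev_def cm_def)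
      have "R \<ge> real d * layer_rate (real n) (real s) cm"
        unfolding R_def cm_def
      proof (rule layer_rate_jensen)
        fix k assume "k < d"
        hence "c k \<le> s" using c by (auto simp: s_def)
        moreover have "real s + real s \<le> real n" using s by linarith
        ultimately show "0 \<le> real (c k) \<and> real (c k) \<le> real s \<and> real (c k) \<le> real n - real s" by linarith
      qed (use dpos in auto)
      moreover have "ent (real n) (real s) - real d * layer_rate (real n) (real s) cm \<le> - real s / 100"
      proof (rule F[rule_format])
        show "d1 \<le> d" using d by simp
        have "10 * real s \<le> 3 * real n \<or> 17 / 10 \<le> \<bar>\<delta>\<bar> * sqrt (real d)" using True by linarith
        thus "0 < real s \<and> 2 * real s \<le> real n \<and> 0 \<le> cm \<and> cm \<le> real s \<and>
          cut_const \<le> \<bar>cm * real n / (real s * (real n - real s)) - 1\<bar> * sqrt (real d) \<and>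
          (10 * real s \<le> 3 * real n \<or> 17 / 10 \<le> \<bar>cm * real n / (real s * (real n - real s)) - 1\<bar> * sqrt (real d))"
          unfolding \<delta>cm using s cm w by simp
      qed
      ultimately have "- R \<le> - ent (real n) (real s) - real s / 100000" by linarith
      moreover have "(\<Prod>i\<in>{1..n}. b i) \<le> 1" using b01 by (intro prod_le_1) auto
      ultimately have "exp (- R) * (\<Prod>i\<in>{1..n}. b i) \<le> exp (- ent (real n) (real s) - real s / 100000) * 1"
        using b01 by (intro mult_mono) (auto intro!: prod_nonneg)
      thus ?thesis by simp
    next
      case False
      define bS where "bS = bern_set_prob d (\<lambda>k. real (c k) / real s)
          (local_sets sg (\<Sum>k<d. real (c k) / real s) (\<bar>\<delta>\<bar> * real d / 2 + 1))"
      define bT where "bT = bern_set_prob d (\<lambda>k. real (c k) / real (n - s))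
          (local_sets sg (\<Sum>k<d. real (c k) / real (n - s)) (\<bar>\<delta>\<bar> * real d / 2 + 1))"
      have big: "3 * n \<le> 10 * card S" using False by (auto simp: s_def)
      have "side_prob n S c i = (\<lambda>k. real (c k) / real s)" if "i \<in> S" for i
        using that by (simp add: side_prob_def fun_eq_iff s_def)
      hence biS: "b i = bS" if "i \<in> S" for i
        using that big by (simp add: b_def bS_def row_sets_def \<delta>_def s_def)
      have "side_prob n S c i = (\<lambda>k. real (c k) / real (n - s))" if "i \<notin> S" for i
        using that by (simp add: side_prob_def fun_eq_iff s_def)
      hence biT: "b i = bT" if "i \<notin> S" for i
        using that big by (simp add: b_def bT_def row_sets_def \<delta>_def s_def)
      have finS: "finite S" using S finite_subset by blast
      have "(\<Prod>i\<in>{1..n}. b i) = (\<Prod>i\<in>{1..n} - S. b i) * (\<Prod>i\<in>S. b i)"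
        by (rule prod.subset_diff) (use S in auto)
      also have "(\<Prod>i\<in>S. b i) = bS ^ s" using biS by (simp add: s_def)
      also have "(\<Prod>i\<in>{1..n} - S. b i) = bT ^ card ({1..n} - S)" using biT by simp
      also have "card ({1..n} - S) = n - s" using S finS by (simp add: card_Diff_subset s_def)
      finally have prod: "(\<Prod>i\<in>{1..n}. b i) = bS ^ s * bT ^ (n - s)" by simp
      have "exp (- R) * (bS ^ s * bT ^ (n - s)) \<le> exp (- ent (real n) (real s) - real n / 100000)"
        unfolding R_def bS_def bT_def
        by (rule L[rule_format]) (use d s big c sg w False in \<open>auto simp: \<delta>_def mean_dev_def s_def\<close>)
      also have "\<dots> \<le> exp (- ent (real n) (real s) - real s / 100000)" using s by simp
      finally show ?thesis by (simp only: prod)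
    qed
    thus ?thesis by (simp add: R_def b_def s_def)
  qed
  thus ?thesis using d1 by (intro exI[of _ "max d1 d2"]) auto
qed

section \<open>The union bound\<close>

text \<open>Each size contributes at most 1, since exp (- ent) cancels the number of sets of that
  size.\<close>

lemma sum_exp_ent_le:
  assumes "X \<subseteq> {S. S \<subseteq> {1..n} \<and> 0 < card S \<and> card S < n}"
  shows "(\<Sum>S\<in>X. exp (- ent (real n) (real (card S)))) \<le> real n + 1"
proof -
  have fin: "finite X" by (rule finite_subset[of _ "Pow {1..n}"]) (use assms in auto)
  have "(\<Sum>S\<in>X. exp (- ent (real n) (real (card S)))) =
      (\<Sum>s\<in>{..n}. \<Sum>S\<in>{S \<in> X. card S = s}. exp (- ent (real n) (real (card S))))"
    using fin assms by (intro sum.group[symmetric]) auto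
  also have "\<dots> \<le> (\<Sum>s\<in>{..n}. 1)"
  proof (rule sum_mono)
    fix s assume "s \<in> {..n}"
    show "(\<Sum>S\<in>{S \<in> X. card S = s}. exp (- ent (real n) (real (card S)))) \<le> 1"
    proof (cases "0 < s \<and> s < n")
      case True
      have "card {S \<in> X. card S = s} \<le> card {S. S \<subseteq> {1..n} \<and> card S = s}"
        using assms by (intro card_mono) auto
      also have "\<dots> = n choose s" by (subst n_subsets) auto
      finally have "real (card {S \<in> X. card S = s}) \<le> exp (ent (real n) (real s))"
        using binomial_le_exp_ent[of s n] True by linarith
      hence "real (card {S \<in> X. card S = s}) * exp (- ent (real n) (real s)) \<le> exp (ent (real n) (real s)) * exp (- ent (real n) (real s))"
        by (intro mult_right_mono) auto
      thus ?thesis by (simp flip: exp_add)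
    next
      case False
      hence "{S \<in> X. card S = s} = {}" using assms by auto
      thus ?thesis by (simp only: sum.empty zero_le_one)
    qed
  qed
  finally show ?thesis by simp
qed

definition bad_tuples :: "nat \<Rightarrow> nat \<Rightarrow> real \<Rightarrow> (nat \<Rightarrow> nat set set) set" where
  "bad_tuples n d \<beta> = {M \<in> matching_tuples n d. \<exists>S. S \<subseteq> {1..n} \<and> \<beta> * real n \<le> real (card S) \<and>
     2 * card S \<le> n \<and> \<bar>cut_ratio n d M S - 1\<bar> > cut_const / sqrt (real d)}"

text \<open>Union bound over the extremal set, the vector of the \<open>d\<close> cut sizes and the
  sign. The latter two take 2 (n + 1)^d values, and the entropy makes the sum over sets at most n +
  1; together with Stirling's factors this is polynomial in \<open>n\<close> for fixed
  \<open>d\<close>.\<close>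

lemma card_bad_tuples_le:
  "\<exists>d0\<ge>1. \<forall>d\<ge>d0. \<forall>\<beta> n. 0 < \<beta> \<and> \<beta> \<le> 1 / 5 \<and> even n \<and> 10 \<le> n \<and> d \<le> n \<longrightarrow>
     real (card (bad_tuples n d \<beta>)) \<le> real (nmatch n) ^ d *
       (((3 * (real n + 1)) ^ 4) ^ d * (2 * (real n + 1) ^ d * (real n + 1)) * exp (- (\<beta> * real n / 100000)))"
proof -
  from exponent_bound obtain d0 where d0: "d0 \<ge> 1" and E:
    "\<forall>d\<ge>d0. \<forall>n S c sg. S \<subseteq> {1..n} \<and> 0 < card S \<and> 2 * card S \<le> n \<and> (\<forall>k<d. c k \<le> card S) \<and>
     (sg = 1 \<or> sg = -1) \<and> sg * mean_dev n d (card S) c > cut_const / sqrt (real d) \<longrightarrow>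
     exp (- (\<Sum>k<d. layer_rate (real n) (real (card S)) (real (c k)))) *
        (\<Prod>i\<in>{1..n}. bern_set_prob d (side_prob n S c i) (row_sets n d S c sg i))
     \<le> exp (- ent (real n) (real (card S)) - real (card S) / 100000)"
    by (elim exE conjE) (rule that; assumption)
  have "real (card (bad_tuples n d \<beta>)) \<le> real (nmatch n) ^ d *
       (((3 * (real n + 1)) ^ 4) ^ d * (2 * (real n + 1) ^ d * (real n + 1)) * exp (- (\<beta> * real n / 100000)))"
    if d: "d \<ge> d0" and \<beta>: "0 < \<beta>" "\<beta> \<le> 1 / 5" and n: "even n" "10 \<le> n" "d \<le> n" for d \<beta> n
  proof -
    define V where "V = {1..n}"
    define \<tau> where "\<tau> = cut_const / sqrt (real d)"
    define K where "K = real (nmatch n) ^ d * ((3 * (real n + 1)) ^ 4) ^ d"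
    define X where "X = {S. S \<subseteq> V \<and> \<beta> * real n \<le> real (card S) \<and> 2 * card S \<le> n}"
    define Y where "Y = PiE {..<d} (\<lambda>_. {..n})"
    define Z :: "real set" where "Z = {1, -1}"
    \<comment> \<open>Vectors \<open>c\<close> that no violating extremal set can produce get the
      empty set, so one estimate covers all terms of the union.\<close>
    define A where "A S c sg = (if (\<forall>k<d. c k \<le> card S) \<and> sg * mean_dev n d (card S) c > \<tau>
      then {M \<in> matching_tuples n d. (\<forall>k<d. card (cross S (M k) \<inter> S) = c k) \<and>
            (\<forall>i\<in>V. {k. k < d \<and> i \<in> cross S (M k)} \<in> row_sets n d S c sg i)} else {})" for S c sg
    have dpos: "d > 0" using d d0 by simp
    have \<tau>: "\<tau> \<ge> 0" by (simp add: \<tau>_def)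
    have finX: "finite X" by (rule finite_subset[of _ "Pow V"]) (auto simp: X_def V_def)
    have finY: "finite Y" unfolding Y_def by (intro finite_PiE) auto
    have npos: "real n > 0" using n by simp
    have Xpos: "0 < card S" "card S < n" if "S \<in> X" for S
    proof -
      have "0 < \<beta> * real n" using \<beta> npos by simp
      hence "0 < real (card S)" using that unfolding X_def by (metis (mono_tags, lifting) less_le_trans mem_Collect_eq)
      thus "0 < card S" "card S < n" using that by (auto simp: X_def)
    qed
    have cover: "bad_tuples n d \<beta> \<subseteq> (\<Union>S\<in>X. \<Union>c\<in>Y. \<Union>sg\<in>Z. A S c sg)"
    proof
      fix M assume "M \<in> bad_tuples n d \<beta>"
      then obtain S0 where M: "M \<in> matching_tuples n d" and S0: "S0 \<subseteq> {1..n}" "\<beta> * real n \<le> real (card S0)"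
        "2 * card S0 \<le> n" "\<bar>cut_ratio n d M S0 - 1\<bar> > \<tau>" by (auto simp: bad_tuples_def \<tau>_def)
      obtain S sg where S: "S \<subseteq> {1..n}" "\<beta> * real n \<le> real (card S)" "2 * card S \<le> n"
        "sg = 1 \<or> sg = (-1::real)" "sg * (cut_ratio n d M S - 1) > \<tau>"
        and loc: "3 * n \<le> 10 * card S \<longrightarrow> (\<forall>i\<in>{1..n}. {k. k < d \<and> i \<in> cross S (M k)} \<in>
           local_sets sg (real (tuple_cut d M S) / (if i \<in> S then real (card S) else real n - real (card S)))
             (\<bar>cut_ratio n d M S - 1\<bar> * real d / 2 + 1))"
        apply (rule extremal_set_exists[of d M n \<beta> S0 \<tau>, OF _ dpos n(3) \<beta> n(2) S0 \<tau>])
         apply (erule matching_tuplesD[OF M])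
        apply (rule that; assumption)
        done
      define c where "c = restrict (\<lambda>k. card (cross S (M k) \<inter> S)) {..<d}"
      have ck: "c k = card (cross S (M k) \<inter> S)" if "k < d" for k using that by (simp add: c_def)
      have finS: "finite S" using S(1) finite_subset by blast
      have cS: "c k \<le> card S" if "k < d" for k
        unfolding ck[OF that] using finS by (intro card_mono) auto
      have "c \<in> Y" unfolding Y_def
      proof (rule PiE_I)
        fix k assume "k \<in> {..<d}"
        thus "c k \<in> {..n}" using cS[of k] S(3) by simp
      qed (simp add: c_def)
      have sumc: "(\<Sum>k<d. real (c k)) = real (tuple_cut d M S)"
        unfolding tuple_cut_def of_nat_sum by (intro sum.cong) (auto simp: ck)
      have md: "mean_dev n d (card S) c = cut_ratio n d M S - 1"
        by (simp add: mean_dev_def cut_ratio_def sumc)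
      have nS: "real (n - card S) = real n - real (card S)" using S(3) by (simp add: of_nat_diff)
      have sps: "(\<Sum>k<d. side_prob n S c i k) = real (tuple_cut d M S) / (if i \<in> S then real (card S) else real n - real (card S))" for i
        by (simp add: side_prob_def nS sumc flip: sum_divide_distrib)
      have "{k. k < d \<and> i \<in> cross S (M k)} \<in> row_sets n d S c sg i" if "i \<in> V" for i
        unfolding row_sets_def sps md using loc that by (auto simp: V_def)
      hence "M \<in> A S c sg" using M S cS ck by (auto simp: A_def md)
      moreover have "S \<in> X" using S by (auto simp: X_def V_def)
      moreover have "sg \<in> Z" using S by (auto simp: Z_def)
      ultimately show "M \<in> (\<Union>S\<in>X. \<Union>c\<in>Y. \<Union>sg\<in>Z. A S c sg)" using \<open>c \<in> Y\<close> by blast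
    qed
    have Abound: "real (card (A S c sg)) \<le> K * (exp (- ent (real n) (real (card S))) * exp (- (\<beta> * real n / 100000)))"
      if "S \<in> X" "sg \<in> Z" for S c sg
    proof (cases "(\<forall>k<d. c k \<le> card S) \<and> sg * mean_dev n d (card S) c > \<tau>")
      case True
      have S: "S \<subseteq> {1..n}" "0 < card S" "2 * card S \<le> n" "\<beta> * real n \<le> real (card S)"
        using that Xpos by (auto simp: X_def V_def)
      have "real (card (A S c sg)) \<le> K * (exp (- (\<Sum>k<d. layer_rate (real n) (real (card S)) (real (c k)))) *
        (\<Prod>i\<in>{1..n}. bern_set_prob d (side_prob n S c i) (row_sets n d S c sg i)))"
      proof -
        have "A S c sg = {M \<in> matching_tuples n d. (\<forall>k<d. card (cross S (M k) \<inter> S) = c k) \<and>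
            (\<forall>i\<in>{1..n}. {k. k < d \<and> i \<in> cross S (M k)} \<in> row_sets n d S c sg i)}"
          unfolding A_def V_def by (rule if_P[OF True])
        thus ?thesis unfolding K_def
          using tuple_count_le[OF n(1) S(1-3), of d c "row_sets n d S c sg"] True by presburger
      qed
      also have "\<dots> \<le> K * exp (- ent (real n) (real (card S)) - real (card S) / 100000)"
      proof (rule mult_left_mono)
        show "exp (- (\<Sum>k<d. layer_rate (real n) (real (card S)) (real (c k)))) *
          (\<Prod>i\<in>{1..n}. bern_set_prob d (side_prob n S c i) (row_sets n d S c sg i))
          \<le> exp (- ent (real n) (real (card S)) - real (card S) / 100000)"
          by (rule E[rule_format]) (use d S True that(2) in \<open>auto simp: Z_def \<tau>_def\<close>)
      qed (simp add: K_def)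
      also have "\<dots> \<le> K * exp (- ent (real n) (real (card S)) + - (\<beta> * real n / 100000))"
        using S by (intro mult_left_mono) (auto simp: K_def)
      finally show ?thesis by (simp only: exp_add)
    next
      case False
      hence "A S c sg = {}" unfolding A_def by (simp only: if_False)
      thus ?thesis by (simp add: K_def)
    qed
    have "card (bad_tuples n d \<beta>) \<le> card (\<Union>S\<in>X. \<Union>c\<in>Y. \<Union>sg\<in>Z. A S c sg)"
      by (rule card_mono[OF _ cover], rule finite_subset[OF _ finite_matching_tuples[of n d]])
         (auto simp: A_def split: if_splits)
    also have "\<dots> \<le> (\<Sum>S\<in>X. card (\<Union>c\<in>Y. \<Union>sg\<in>Z. A S c sg))" by (rule card_UN_le[OF finX])
    also have "\<dots> \<le> (\<Sum>S\<in>X. \<Sum>c\<in>Y. card (\<Union>sg\<in>Z. A S c sg))"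
      by (intro sum_mono card_UN_le finY)
    also have "\<dots> \<le> (\<Sum>S\<in>X. \<Sum>c\<in>Y. \<Sum>sg\<in>Z. card (A S c sg))"
      by (intro sum_mono card_UN_le) (simp add: Z_def)
    finally have "real (card (bad_tuples n d \<beta>)) \<le> real (\<Sum>S\<in>X. \<Sum>c\<in>Y. \<Sum>sg\<in>Z. card (A S c sg))"
      by (simp only: of_nat_le_iff)
    also have "\<dots> = (\<Sum>S\<in>X. \<Sum>c\<in>Y. \<Sum>sg\<in>Z. real (card (A S c sg)))" by (simp only: of_nat_sum)
    also have "\<dots> \<le> (\<Sum>S\<in>X. \<Sum>c\<in>Y. \<Sum>sg\<in>Z. K * (exp (- ent (real n) (real (card S))) * exp (- (\<beta> * real n / 100000))))"
      by (intro sum_mono Abound)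
    also have "\<dots> = (\<Sum>S\<in>X. (2 * (real n + 1) ^ d * K * exp (- (\<beta> * real n / 100000))) * exp (- ent (real n) (real (card S))))"
      by (intro sum.cong refl) (simp add: Y_def Z_def card_PiE add.commute)
    also have "\<dots> = (2 * (real n + 1) ^ d * K * exp (- (\<beta> * real n / 100000))) * (\<Sum>S\<in>X. exp (- ent (real n) (real (card S))))"
      by (simp only: sum_distrib_left)
    also have "\<dots> \<le> (2 * (real n + 1) ^ d * K * exp (- (\<beta> * real n / 100000))) * (real n + 1)"
      using Xpos by (intro mult_left_mono sum_exp_ent_le) (auto simp: K_def X_def V_def)
    finally show ?thesis by (simp only: K_def mult_ac)
  qed
  thus ?thesis using d0 by (intro exI[of _ d0]) blast
qed

section \<open>From counts of tuples to probabilities\<close>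

lemma matching_tuples_nonempty: "even n \<Longrightarrow> nmatch n > 0"
proof -
  assume "even n"
  then obtain m where "n = 2 * m" by (auto elim: evenE)
  thus ?thesis using nmatch_even[of m] by (intro gr0I) auto
qed

lemma prob_G_reg:
  assumes "even n"
  shows "measure_pmf.prob (G_reg n d) E =
    real (card (matching_tuples n d \<inter> (\<lambda>M. \<Sum>k<d. mset_set (M k)) -` E)) / real (nmatch n) ^ d"
proof -
  have ne: "matchings {1..n} \<noteq> {}"
    using matching_tuples_nonempty[OF assms] card_matchings[of "{1..n}"] by auto
  have "Pi_pmf {..<d} {} (\<lambda>_. pmf_of_set (perfect_matchings n)) = pmf_of_set (matching_tuples n d)"
    unfolding matching_tuples_def perfect_matchings_eq using ne by (intro Pi_pmf_of_set) (auto simp: finite_matchings)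
  moreover have "matching_tuples n d \<noteq> {}"
    using card_matching_tuples[of n d] matching_tuples_nonempty[OF assms] by auto
  ultimately show ?thesis
    by (simp add: G_reg_def measure_pmf_of_set finite_matching_tuples card_matching_tuples)
qed

lemma edge_cut_ratio:
  assumes M: "M \<in> matching_tuples n d" and n: "n > 0" and \<alpha>: "real (card S) = \<alpha> * real n"
  shows "real (edge_cut (\<Sum>k<d. mset_set (M k)) S) / (real d * \<alpha> * (1 - \<alpha>) * real n) = cut_ratio n d M S"
proof -
  have e: "edge_cut (\<Sum>k<d. mset_set (M k)) S = tuple_cut d M S"
    by (rule edge_cut_tuple[OF matching_tuplesD[OF M]]) auto
  have "\<alpha> * real n * (real n - \<alpha> * real n) = (\<alpha> * (1 - \<alpha>) * real n) * real n"
    by (simp add: algebra_simps)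
  hence "cut_ratio n d M S = real (tuple_cut d M S) / real d * real n / ((\<alpha> * (1 - \<alpha>) * real n) * real n)"
    unfolding cut_ratio_def \<alpha> by (simp only:)
  thus ?thesis unfolding e using n by (simp add: mult_ac)
qed

lemma poly_exp_tendsto_0:
  assumes "\<kappa> > 0"
  shows "((\<lambda>n::nat. ((3 * (real n + 1)) ^ 4) ^ d * (2 * (real n + 1) ^ d * (real n + 1)) * exp (- (\<kappa> * real n))) \<longlongrightarrow> 0) at_top"
proof -
  \<comment> \<open>The degree of the polynomial factor: 4 d from Stirling, d from the cut sizes, 1
    from the set sizes.\<close>
  define m where "m = 5 * d + 1"
  define C where "C = 2 * 81 ^ d * exp \<kappa> / \<kappa> ^ m"
  have eq: "((3 * (real n + 1)) ^ 4) ^ d * (2 * (real n + 1) ^ d * (real n + 1)) * exp (- (\<kappa> * real n)) =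
      C * ((\<kappa> * (real n + 1)) ^ m / exp (\<kappa> * (real n + 1)))" for n
  proof -
    define x where "x = real n + 1"
    have "((3 * x) ^ 4) ^ d * (2 * x ^ d * x) = 2 * 81 ^ d * x ^ m"
    proof -
      have "((3 * x) ^ 4) ^ d = 81 ^ d * x ^ (4 * d)"
        by (simp add: power_mult_distrib power_mult)
      moreover have "x ^ m = x ^ (4 * d) * x ^ d * x"
      proof -
        have "m = 4 * d + d + 1" by (simp add: m_def)
        thus ?thesis by (simp only: power_add power_one_right)
      qed
      ultimately show ?thesis by (simp only: mult_ac)
    qed
    moreover have "exp (- (\<kappa> * real n)) = exp \<kappa> / exp (\<kappa> * x)"
      by (simp add: x_def algebra_simps flip: exp_diff)
    ultimately show ?thesis using assms by (simp add: C_def x_def power_mult_distrib)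
  qed
  have "filterlim (\<lambda>n::nat. \<kappa> * (real n + 1)) at_top at_top" using assms by real_asymp
  hence "((\<lambda>n::nat. (\<kappa> * (real n + 1)) ^ m / exp (\<kappa> * (real n + 1))) \<longlongrightarrow> 0) at_top"
    by (rule filterlim_compose[OF tendsto_power_div_exp_0])
  hence "((\<lambda>n::nat. C * ((\<kappa> * (real n + 1)) ^ m / exp (\<kappa> * (real n + 1)))) \<longlongrightarrow> C * 0) at_top"
    by (intro tendsto_mult tendsto_const)
  thus ?thesis by (simp only: eq mult_zero_right)
qed

theorem mainTheorem4:
  shows "(\<exists>\<epsilon> :: nat \<Rightarrow> nat \<Rightarrow> real. little_o_nd \<epsilon> \<and>
      (\<forall>d::nat. \<forall>\<beta>::real. 1 \<le> d \<and> 0 < \<beta> \<and> \<beta> < 1 / 2 \<longrightarrow>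
        ((\<lambda>n. measure_pmf.prob (G_reg n d)
            {H. \<forall>S \<alpha>. S \<subseteq> {1..n} \<and> real (card S) = \<alpha> * real n \<and> \<beta> \<le> \<alpha> \<and> \<alpha> \<le> 1 / 2 \<longrightarrow>
                 \<bar>real (edge_cut H S) / (real d * \<alpha> * (1 - \<alpha>) * real n) - 1\<bar>
                   \<le> 1 / sqrt (real d) * (2 * sqrt (2 / pi) + \<epsilon> n d)})
          \<longlongrightarrow> 1) evens_at_top))
    \<and> 1595 / 1000 \<le> 2 * sqrt (2 / pi) \<and> 2 * sqrt (2 / pi) < 1596 / 1000"
proof (intro conjI)
  show "1595 / 1000 \<le> 2 * sqrt (2 / pi)" "2 * sqrt (2 / pi) < 1596 / 1000"
    using cut_const_bounds by auto
  from card_bad_tuples_le obtain d0 where d0: "d0 \<ge> 1" and bad: "\<forall>d\<ge>d0. \<forall>\<beta> n. 0 < \<beta> \<and> \<beta> \<le> 1 / 5 \<and> even n \<and> 10 \<le> n \<and> d \<le> n \<longrightarrow>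
     real (card (bad_tuples n d \<beta>)) \<le> real (nmatch n) ^ d *
       (((3 * (real n + 1)) ^ 4) ^ d * (2 * (real n + 1) ^ d * (real n + 1)) * exp (- (\<beta> * real n / 100000)))"
    by (elim exE conjE) (rule that; assumption)
  \<comment> \<open>For d < d0 the term sqrt d allows a deviation of 1, which always holds by
    \<open>cut_ratio_le_2\<close>; being 0 from d0 on, it vanishes in the limit over d.\<close>
  define \<epsilon> :: "nat \<Rightarrow> nat \<Rightarrow> real" where "\<epsilon> n d = (if d < d0 then sqrt (real d) else 0)" for n d
  define E where "E n d \<beta> = {H. \<forall>S \<alpha>. S \<subseteq> {1..n} \<and> real (card S) = \<alpha> * real n \<and> \<beta> \<le> \<alpha> \<and> \<alpha> \<le> 1 / 2 \<longrightarrow>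
                 \<bar>real (edge_cut H S) / (real d * \<alpha> * (1 - \<alpha>) * real n) - 1\<bar>
                   \<le> 1 / sqrt (real d) * (2 * sqrt (2 / pi) + \<epsilon> n d)}" for n d \<beta>
  have "little_o_nd \<epsilon>"
    unfolding little_o_nd_def
  proof (intro exI conjI allI impI)
    fix d :: nat
    show "((\<lambda>n. \<epsilon> n d) \<longlongrightarrow> (if d < d0 then sqrt (real d) else 0)) evens_at_top"
      by (simp add: \<epsilon>_def)
  next
    have "\<forall>\<^sub>F d in sequentially. (if d < d0 then sqrt (real d) else 0) = 0"
      using eventually_ge_at_top[of d0] by eventually_elim auto
    thus "(\<lambda>d. if d < d0 then sqrt (real d) else 0) \<longlonglongrightarrow> 0" by (rule tendsto_eventually)
  qed
  moreover have "((\<lambda>n. measure_pmf.prob (G_reg n d) (E n d \<beta>)) \<longlongrightarrow> 1) evens_at_top"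
    if d: "1 \<le> d" and \<beta>: "0 < \<beta>" "\<beta> < 1 / 2" for d \<beta>
  proof -
    \<comment> \<open>\<open>extremal_set_exists\<close> needs room between the smallest size and
      3n/10; lowering \<beta> only adds sets to be controlled.\<close>
    define \<gamma> where "\<gamma> = min \<beta> (1 / 5)"
    have \<gamma>: "0 < \<gamma>" "\<gamma> \<le> 1 / 5" "\<gamma> \<le> \<beta>" using \<beta> by (auto simp: \<gamma>_def)
    define r where "r n = ((3 * (real n + 1)) ^ 4) ^ d * (2 * (real n + 1) ^ d * (real n + 1)) * exp (- (\<gamma> / 100000 * real n))" for n :: nat
    have rlim: "(r \<longlongrightarrow> 0) evens_at_top"
      unfolding r_def evens_at_top_def
      by (rule tendsto_mono[OF inf_le1 poly_exp_tendsto_0]) (use \<gamma> in simp)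
    have lower: "measure_pmf.prob (G_reg n d) (E n d \<beta>) \<ge> 1 - r n" if n: "even n" "10 \<le> n" "d \<le> n" for n
    proof -
      \<comment> \<open>For small d no tuple has to be excluded, as the bound is trivial
        there.\<close>
      define B where "B = (if d < d0 then {} else bad_tuples n d \<gamma>)"
      have sub: "matching_tuples n d - B \<subseteq> (\<lambda>M. \<Sum>k<d. mset_set (M k)) -` E n d \<beta>"
      proof
        fix M assume M: "M \<in> matching_tuples n d - B"
        have "\<bar>real (edge_cut (\<Sum>k<d. mset_set (M k)) S) / (real d * \<alpha> * (1 - \<alpha>) * real n) - 1\<bar>
             \<le> 1 / sqrt (real d) * (2 * sqrt (2 / pi) + \<epsilon> n d)"
          if S: "S \<subseteq> {1..n}" "real (card S) = \<alpha> * real n" "\<beta> \<le> \<alpha>" "\<alpha> \<le> 1 / 2" for S \<alpha>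
        proof -
          have npos: "n > 0" using n by simp
          have "\<gamma> * real n \<le> \<alpha> * real n" using S \<gamma> by (intro mult_right_mono) auto
          hence cS: "\<gamma> * real n \<le> real (card S)" using S by simp
          have "\<alpha> * real n \<le> 1 / 2 * real n" using S by (intro mult_right_mono) auto
          hence cS2: "2 * card S \<le> n" using S by linarith
          have finS: "finite S" using S(1) finite_subset by blast
          have "0 < \<gamma> * real n" using \<gamma> npos by simp
          hence cpos: "0 < card S" using cS by linarith
          have eq: "real (edge_cut (\<Sum>k<d. mset_set (M k)) S) / (real d * \<alpha> * (1 - \<alpha>) * real n) = cut_ratio n d M S"
            using edge_cut_ratio[OF _ npos S(2), of M d] M by simp
          show ?thesis unfolding eq
          proof (cases "d < d0")
            case True
            have "\<bar>cut_ratio n d M S - 1\<bar> \<le> 1"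
              using cut_ratio_le_2[OF finS cpos cS2, of d M] d by auto
            also have "1 = 1 / sqrt (real d) * sqrt (real d)" using d by simp
            also have "\<dots> \<le> 1 / sqrt (real d) * (2 * sqrt (2 / pi) + \<epsilon> n d)"
              using True by (intro mult_left_mono) (auto simp: \<epsilon>_def)
            finally show "\<bar>cut_ratio n d M S - 1\<bar> \<le> 1 / sqrt (real d) * (2 * sqrt (2 / pi) + \<epsilon> n d)" .
          next
            case False
            hence "\<not> \<bar>cut_ratio n d M S - 1\<bar> > cut_const / sqrt (real d)"
              using M S(1) cS cS2 unfolding B_def bad_tuples_def by auto
            thus "\<bar>cut_ratio n d M S - 1\<bar> \<le> 1 / sqrt (real d) * (2 * sqrt (2 / pi) + \<epsilon> n d)"
              using False by (simp add: \<epsilon>_def)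
          qed
        qed
        thus "M \<in> (\<lambda>M. \<Sum>k<d. mset_set (M k)) -` E n d \<beta>" by (simp add: E_def)
      qed
      have Kpos: "real (nmatch n) ^ d > 0" using matching_tuples_nonempty[OF n(1)] by simp
      have Bsub: "B \<subseteq> matching_tuples n d" by (auto simp: B_def bad_tuples_def)
      have "real (card B) \<le> real (nmatch n) ^ d * r n"
      proof (cases "d < d0")
        case False
        have "real (card (bad_tuples n d \<gamma>)) \<le> real (nmatch n) ^ d *
       (((3 * (real n + 1)) ^ 4) ^ d * (2 * (real n + 1) ^ d * (real n + 1)) * exp (- (\<gamma> * real n / 100000)))"
          by (rule bad[rule_format]) (use False \<gamma> n in auto)
        thus ?thesis using False by (simp add: B_def r_def)
      qed (simp add: B_def r_def)
      moreover have "real (card (matching_tuples n d - B)) = real (nmatch n) ^ d - real (card B)"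
      proof -
        have fB: "finite B" using Bsub finite_matching_tuples finite_subset by blast
        have "card (matching_tuples n d - B) = card (matching_tuples n d) - card B"
          by (rule card_Diff_subset[OF fB Bsub])
        moreover have "card B \<le> card (matching_tuples n d)" by (rule card_mono[OF finite_matching_tuples Bsub])
        ultimately show ?thesis by (simp add: of_nat_diff card_matching_tuples)
      qed
      moreover have "card (matching_tuples n d - B) \<le> card (matching_tuples n d \<inter> (\<lambda>M. \<Sum>k<d. mset_set (M k)) -` E n d \<beta>)"
        using sub finite_matching_tuples by (intro card_mono) auto
      ultimately have "real (card (matching_tuples n d \<inter> (\<lambda>M. \<Sum>k<d. mset_set (M k)) -` E n d \<beta>)) \<ge> (1 - r n) * real (nmatch n) ^ d"
        by (simp add: algebra_simps)
      thus ?thesis unfolding prob_G_reg[OF n(1)] using Kpos by (simp add: le_divide_eq)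
    qed
    have "\<forall>\<^sub>F n in evens_at_top. even n \<and> 10 \<le> n \<and> d \<le> n"
      unfolding evens_at_top_def eventually_inf_principal
      using eventually_ge_at_top[of 10] eventually_ge_at_top[of d] by eventually_elim auto
    hence ev: "\<forall>\<^sub>F n in evens_at_top. 1 - r n \<le> measure_pmf.prob (G_reg n d) (E n d \<beta>)"
      by eventually_elim (use lower in auto)
    have "((\<lambda>n. 1 - r n) \<longlongrightarrow> 1 - 0) evens_at_top" by (intro tendsto_diff tendsto_const rlim)
    hence "((\<lambda>n. 1 - r n) \<longlongrightarrow> 1) evens_at_top" by simp
    from tendsto_sandwich[OF ev _ this tendsto_const[of 1]] show ?thesis by simp
  qed
  ultimately show "\<exists>\<epsilon> :: nat \<Rightarrow> nat \<Rightarrow> real. little_o_nd \<epsilon> \<and>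
      (\<forall>d::nat. \<forall>\<beta>::real. 1 \<le> d \<and> 0 < \<beta> \<and> \<beta> < 1 / 2 \<longrightarrow>
        ((\<lambda>n. measure_pmf.prob (G_reg n d)
            {H. \<forall>S \<alpha>. S \<subseteq> {1..n} \<and> real (card S) = \<alpha> * real n \<and> \<beta> \<le> \<alpha> \<and> \<alpha> \<le> 1 / 2 \<longrightarrow>
                 \<bar>real (edge_cut H S) / (real d * \<alpha> * (1 - \<alpha>) * real n) - 1\<bar>
                   \<le> 1 / sqrt (real d) * (2 * sqrt (2 / pi) + \<epsilon> n d)})
          \<longlongrightarrow> 1) evens_at_top)"
    unfolding E_def by (intro exI[of _ \<epsilon>]) simp
qed

end
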